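(* Let $k\geq3$ be an integer and let $p_1,\dots,p_r$ be the distinct odd prime divisors of $k-2$. Then for every $\varepsilon>0$, $$\sum_{N\leq x} r_4^{k}(N)^2=\frac{C_k\,\zeta(3)}{(k-2)^4}\prod_{i=1}^{r}\frac{1-p_i^{-3}}{1-p_i^{-4}}\; x^3+O\left(x^{11/4+\varepsilon}\right),$$ where $C_k=448$ if $k\not\equiv0\pmod{4}$ and $C_k=512$ if $k\equiv 0\pmod{4}$.
   Context: Let $p_k(x)=\frac{(k-2)x^2-(k-4)x}{2}$; $r_4^{k}(N)=\#\{\mathbf{x}\in\mathbb{Z}^4:\sum_{i=1}^4 p_k(x_i)=N\}$ is the number of representations of $N$ as a sum of four generalized $k$-gonal numbers. The sum is over positive integers $N\le x$, $\zeta$ is the Riemann zeta function, and the asymptotic is as $x\to\infty$ with $k$ fixed (implied constant depending on $k,\varepsilon$). *)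

theory Defs
  imports Complex_Main "HOL-Library.Landau_Symbols" "HOL-Computational_Algebra.Primes"
begin

text \<open>
  Generalized $k$-gonal numbers are the values at arbitrary integers \<open>x\<close>. These values are
  integers (nonnegative ones if $k \geq 3$), but they are taken as reals so that the division
  by 2 is the exact one.
\<close>
definition polygonal :: "int \<Rightarrow> int \<Rightarrow> real" where
  "polygonal k x = ((of_int k - 2) * (of_int x)^2 - (of_int k - 4) * of_int x) / 2"

text \<open>
  For $k \geq 3$ the set below is finite, so \<open>card\<close> does count the representations.
\<close>
definition r4 :: "int \<Rightarrow> nat \<Rightarrow> nat" where
  "r4 k N = card {(x1 :: int, x2 :: int, x3 :: int, x4 :: int).
     polygonal k x1 + polygonal k x2 + polygonal k x3 + polygonal k x4 = of_nat N}"

text \<open>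
  The Riemann zeta function on the half-line $s > 1$, where it is given by its Dirichlet
  series; the value for $s \leq 1$ has no meaning.
\<close>
definition zeta :: "real \<Rightarrow> real" where
  "zeta s = (\<Sum>n. 1 / of_nat (Suc n) powr s)"

definition C_const :: "int \<Rightarrow> real" where
  "C_const k = (if k mod 4 = 0 then 512 else 448)"

end

theory Submission
  imports Defs "HOL-Analysis.Analysis" "HOL-Computational_Algebra.Squarefree" "HOL-Real_Asymp.Real_Asymp"
begin

text \<open>
  Put \<open>m = k - 2\<close>. The sum counts pairs \<open>(x, y)\<close> of integer 4-vectors with equal shifted norm. With
  \<open>a = x - y\<close>, equality means that \<open>y\<close> lies on a hyperplane orthogonal to \<open>a\<close>, and the bound on the norm
  cuts a 3-dimensional ball out of that hyperplane. The lattice points in the ball are counted by their volume,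
  which for \<open>a = g b\<close> with \<open>b\<close> primitive is a radial function of \<open>b\<close>, subject to a divisibility condition on the
  coordinate sum of \<open>b\<close> that depends only on the parity of \<open>g\<close>. Summing it over primitive \<open>b\<close> by Moebius
  inversion and over \<open>g\<close> gives the main term, where \<open>\<pi>^4\<close> cancels against \<open>\<zeta>(4) = \<pi>^4 / 90\<close>.

  For the error, slice the ball by the first coordinate and then by lines in the direction of a short vector \<open>u\<close>
  orthogonal to the last three coordinates of \<open>a\<close>, of length at most the square root of the size of \<open>a\<close>
  by the pigeonhole principle. If the norm is at most \<open>R^2\<close>, each ball costs \<open>O(R^2 / |u|)\<close>. As only
  \<open>O(R^2 / |u|)\<close> vectors of size \<open>R\<close> in dimension 3 are orthogonal to \<open>u\<close>, and \<open>|u| = O(R^(1/2))\<close>, the total error is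
  \<open>O(R \<sqdot> R^2 \<sqdot> R^(5/2)) = O(R^(11/2))\<close>, which is \<open>O(x^(11/4))\<close>.
\<close>

text \<open>The centres of the balls are rational points that vary with \<open>a\<close> and are not
  controlled, so every lattice point estimate has to be uniform in them; this is why the counts
  carry arbitrary offsets.

  For a primitive \<open>b = (b0, h p)\<close> with \<open>p\<close> primitive, the lattice of
  integer points orthogonal to \<open>b\<close> has the orthogonalised steps \<open>|u|\<close>,
  \<open>|p| / |u|\<close> and \<open>|b| / |p|\<close>. Only \<open>u\<close> is chosen; the other
  two lengths are forced by the covolumes \<open>|p|\<close> and \<open>|b|\<close>. The inequality
  \<open>|u|\<^sup>2 \<le> 9 |p|\<close> in the sup norm turns \<open>|u| / |p|\<close> into a
  multiple of \<open>1 / |u|\<close>, so that \<open>1 / |u|\<close> governs the whole error.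
  Vectors \<open>a\<close> on the first axis have no \<open>p\<close> and are bounded crudely.

  In the main term a factor \<open>g ^ 3\<close> from the radius meets \<open>g ^ (-6)\<close> from
  the cube of the scaled bound, which produces zeta(3). Odd and even \<open>g\<close> carry 7/8 and
  1/8 of that series, with possibly different moduli for the coordinate sum. The larger constant 512
  occurs exactly when the modulus for even \<open>g\<close> is odd: it is then \<open>m / 2\<close>,
  and its Euler factor at 2 drops out.\<close>

section \<open>The value of zeta at 4\<close>

text \<open>The product for \<open>sin\<close> at \<open>x\<close> times the one at \<open>\<i> x\<close>; its \<open>x^4\<close> coefficient gives \<open>\<zeta>(4)\<close>.\<close>
lemma sin_sinh_product:
  fixes x :: real
  assumes "x \<noteq> 0"
  shows "(\<lambda>n. \<Prod>k=1..n. 1 - x ^ 4 / real k ^ 4) \<longlonglongrightarrow> sin (pi * x) * sinh (pi * x) / (pi * x)\<^sup>2"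
proof -
  have "(\<lambda>n. of_real pi * (\<i> * of_real x) * (\<Prod>k=1..n. 1 - (\<i> * of_real x)^2 / of_nat k^2))
      \<longlonglongrightarrow> sin (of_real pi * (\<i> * of_real x))"
    by (rule sin_product_formula_complex)
  also have "sin (of_real pi * (\<i> * of_real x)) = \<i> * of_real (sinh (pi * x))"
    by (simp add: sinh_field_def sin_exp_eq exp_of_real[symmetric] field_simps)
  finally have "(\<lambda>n. (of_real pi * (\<i> * of_real x) * (\<Prod>k=1..n. 1 - (\<i> * of_real x)^2 / of_nat k^2)) / (\<i> * of_real (pi * x)))
      \<longlonglongrightarrow> (\<i> * of_real (sinh (pi * x))) / (\<i> * of_real (pi * x))"
    by (rule tendsto_divide[OF _ tendsto_const]) (use assms in auto)
  also have "(\<lambda>n. (of_real pi * (\<i> * of_real x) * (\<Prod>k=1..n. 1 - (\<i> * of_real x)^2 / of_nat k^2)) / (\<i> * of_real (pi * x)))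
     = (\<lambda>n. complex_of_real (\<Prod>k=1..n. 1 + x^2 / real k^2))"
    using assms by (auto simp: power_mult_distrib fun_eq_iff intro!: prod.cong)
  also have "(\<i> * of_real (sinh (pi * x))) / (\<i> * of_real (pi * x)) = complex_of_real (sinh (pi * x) / (pi * x))"
    by simp
  finally have 1: "(\<lambda>n. \<Prod>k=1..n. 1 + x^2 / real k^2) \<longlonglongrightarrow> sinh (pi * x) / (pi * x)"
    by (simp only: tendsto_of_real_iff)
  have 2: "(\<lambda>n. \<Prod>k=1..n. 1 - x^2 / real k^2) \<longlonglongrightarrow> sin (pi * x) / (pi * x)"
    by (rule sin_product_formula_real'[OF assms])
  have "(\<lambda>n. (\<Prod>k=1..n. 1 - x^2 / real k^2) * (\<Prod>k=1..n. 1 + x^2 / real k^2))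
      \<longlonglongrightarrow> sin (pi * x) / (pi * x) * (sinh (pi * x) / (pi * x))"
    by (intro tendsto_mult 1 2)
  also have "(\<lambda>n. (\<Prod>k=1..n. 1 - x^2 / real k^2) * (\<Prod>k=1..n. 1 + x^2 / real k^2))
     = (\<lambda>n. \<Prod>k=1..n. 1 - x ^ 4 / real k ^ 4)"
  proof
    fix n
    have "(1 - x^2 / real k^2) * (1 + x^2 / real k^2) = 1 - x ^ 4 / real k ^ 4" for k :: nat
      by (simp add: algebra_simps power_divide flip: power_add)
    then show "(\<Prod>k=1..n. 1 - x^2 / real k^2) * (\<Prod>k=1..n. 1 + x^2 / real k^2) = (\<Prod>k=1..n. 1 - x ^ 4 / real k ^ 4)"
      by (simp add: prod.distrib[symmetric])
  qed
  finally show ?thesis by (simp add: power2_eq_square)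
qed

text \<open>Consecutive partial products differ by \<open>x ^ 4 * P x n / (n + 1) ^ 4\<close>.
  Telescoping therefore turns the product formula into a closed form \<open>g\<close> of the series
  \<open>f\<close> for nonzero \<open>x\<close>, and the sum sought is \<open>f 0\<close>. It is
  reached from continuity of \<open>f\<close> on one side and from the expansion of \<open>g\<close>
  on the other.\<close>

lemma inverse_fourth_powers_sums: "(\<lambda>n. 1 / real (Suc n) ^ 4) sums (pi ^ 4 / 90)"
proof -
  define P where "P x n = (\<Prod>k=1..n. 1 - x^4 / real k^4)" for x :: real and n
  define f where "f x = (\<Sum>n. P x n / real (Suc n)^4)" for x
  define g where "g x = (1 - sin (pi * x) * sinh (pi * x) / (pi * x)\<^sup>2) / x ^ 4" for x :: real
  have summ: "summable (\<lambda>n. 1 / real (Suc n) ^ 4)"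
    using inverse_power_summable[of 4, where 'a = real] by (subst summable_Suc_iff) (simp add: inverse_eq_divide)
  have fg: "f x = g x" if x: "x \<noteq> 0" for x
  proof -
    have "(\<lambda>n. P x n - P x (Suc n)) sums (P x 0 - sin (pi * x) * sinh (pi * x) / (pi * x)\<^sup>2)"
      unfolding P_def using x by (intro telescope_sums' sin_sinh_product)
    also have "(\<lambda>n. P x n - P x (Suc n)) = (\<lambda>n. x^4 * (P x n / real (Suc n)^4))"
      unfolding P_def by (simp add: prod.nat_ivl_Suc' algebra_simps)
    also have "P x 0 = 1" by (simp add: P_def)
    finally have "(\<lambda>n. x^4 * (P x n / real (Suc n)^4)) sums (1 - sin (pi * x) * sinh (pi * x) / (pi * x)\<^sup>2)" .
    from sums_divide[OF this, of "x^4"] x show ?thesis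
      unfolding f_def g_def by (simp add: sums_iff)
  qed
  have "continuous_on (ball 0 1) f"
  proof (rule uniform_limit_theorem; (intro always_eventually allI)?)
    \<comment> \<open>For \<open>|x| < 1\<close> all factors of the products lie in
      \<open>{0..1}\<close>, so the terms are dominated by those at \<open>x = 0\<close>.\<close>
    show "uniform_limit (ball 0 1) (\<lambda>n x. \<Sum>k<n. P x k / real (Suc k)^4) f sequentially"
      unfolding f_def
    proof (rule Weierstrass_m_test[OF _ summ])
      fix n :: nat and x :: real assume x: "x \<in> ball 0 1"
      have "1 - x^4 / real k^4 \<in> {0..1}" if "k \<ge> 1" for k :: nat
      proof -
        have "x ^ 4 = \<bar>x\<bar> ^ 4" by simp
        also have "\<dots> \<le> 1" using x by (intro power_le_one) auto
        also have "1 \<le> real k ^ 4" using that by simp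
        finally show ?thesis using that by (simp add: field_simps)
      qed
      then have "(\<Prod>k=1..n. \<bar>1 - x^4 / real k^4\<bar>) \<le> (\<Prod>k=1..n. 1)" by (intro prod_mono) auto
      then show "norm (P x n / real (Suc n)^4) \<le> 1 / real (Suc n)^4"
        unfolding P_def by (simp add: field_simps abs_prod del: of_nat_Suc)
    qed
  qed (auto simp: P_def intro!: continuous_intros)
  then have "isCont f 0" by (subst (asm) continuous_on_eq_continuous_at) simp_all
  then have "(f \<longlongrightarrow> f 0) (at 0)" by (simp add: isCont_def)
  then have "(f \<longlongrightarrow> f 0) (at_right 0)" by (rule tendsto_mono[OF at_le, rotated]) auto
  moreover have "(f \<longlongrightarrow> pi ^ 4 / 90) (at_right 0)"
  proof (rule Lim_transform_eventually)
    show "(g \<longlongrightarrow> pi ^ 4 / 90) (at_right 0)"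
    proof -
      \<comment> \<open>This is \<open>g\<close> in the variable \<open>z = pi * x\<close>, up to
        the factor \<open>pi ^ 4\<close>, with \<open>sinh\<close> written by exponentials. The
        limit comes from \<open>sin z * sinh z = z ^ 2 - z ^ 6 / 90 + ...\<close>.\<close>
      define h where "h z = (1 - sin z * ((exp z - exp (- z)) / 2) / z\<^sup>2) / z ^ 4" for z :: real
      have "(h \<longlongrightarrow> 1 / 90) (at_right 0)" unfolding h_def by real_asymp
      moreover have "filterlim (\<lambda>x. pi * x) (at_right 0) (at_right 0)" by real_asymp
      ultimately have "((\<lambda>x. pi ^ 4 * h (pi * x)) \<longlongrightarrow> pi ^ 4 * (1 / 90)) (at_right 0)"
        by (intro tendsto_mult tendsto_const) (rule filterlim_compose)
      moreover have "(\<lambda>x. pi ^ 4 * h (pi * x)) = g"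
        by (simp add: fun_eq_iff g_def h_def sinh_field_def power_mult_distrib)
      ultimately show ?thesis by simp
    qed
    show "eventually (\<lambda>x. g x = f x) (at_right 0)"
      using fg by (auto simp: eventually_at_filter)
  qed
  ultimately have "f 0 = pi ^ 4 / 90"
    by (rule tendsto_unique[OF trivial_limit_at_right_real])
  moreover have "f 0 = (\<Sum>n. 1 / real (Suc n) ^ 4)" by (simp add: f_def P_def)
  ultimately show ?thesis using summ by (metis summable_sums)
qed

section \<open>Lattice points in ellipsoids\<close>

lemma pos_mult_abs: "0 < x \<Longrightarrow> x * \<bar>y\<bar> = \<bar>x * y\<bar>" for x y :: real
  by (simp add: abs_mult)

text \<open>The mean value theorem replaces integration. Derivatives are assumed only inside the
  interval because the primitives used later contain \<open>arcsin\<close> and \<open>sqrt\<close>,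
  which are not differentiable at the end of the range.\<close>

lemma antimono_primitive_bounds:
  fixes \<phi> G :: "real \<Rightarrow> real"
  assumes anti: "\<And>x y. 0 \<le> x \<Longrightarrow> x \<le> y \<Longrightarrow> y \<le> 1 \<Longrightarrow> \<phi> y \<le> \<phi> x"
    and cont: "continuous_on {0..1} G"
    and der: "\<And>x. 0 < x \<Longrightarrow> x < 1 \<Longrightarrow> (G has_real_derivative \<phi> x) (at x)"
    and "0 \<le> a" "a \<le> b" "b \<le> 1"
  shows "(b - a) * \<phi> b \<le> G b - G a" "G b - G a \<le> (b - a) * \<phi> a"
proof -
  have "(b - a) * \<phi> b \<le> G b - G a \<and> G b - G a \<le> (b - a) * \<phi> a"
  proof (cases "a < b")
    case True
    have "\<exists>l z. a < z \<and> z < b \<and> (G has_real_derivative l) (at z) \<and> G b - G a = (b - a) * l"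
    proof (rule MVT[OF True])
      show "continuous_on {a..b} G" using assms by (intro continuous_on_subset[OF cont]) auto
      fix x assume "a < x" "x < b"
      then have "(G has_real_derivative \<phi> x) (at x)" using der[of x] assms by auto
      then show "G differentiable (at x)" by (subst real_differentiable_def) blast
    qed
    then obtain l z where z: "a < z" "z < b" "(G has_real_derivative l) (at z)" "G b - G a = (b - a) * l"
      by blast
    have "l = \<phi> z" using der[of z] z assms by (intro DERIV_unique[OF z(3)]) auto
    then show ?thesis using z assms by (auto intro!: mult_left_mono anti)
  qed (use assms in auto)
  then show "(b - a) * \<phi> b \<le> G b - G a" "G b - G a \<le> (b - a) * \<phi> a" by auto
qed

text \<open>For a decreasing function the left and the right Riemann sums enclose the integral and
  differ by at most one step times the largest value. The offset \<open>\<theta>\<close> of the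
  first sample point costs no more than that either.\<close>

lemma half_line_sum:
  fixes \<phi> G :: "real \<Rightarrow> real"
  assumes anti: "\<And>x y. 0 \<le> x \<Longrightarrow> x \<le> y \<Longrightarrow> y \<le> 1 \<Longrightarrow> \<phi> y \<le> \<phi> x"
    and nonneg: "\<And>x. 0 \<le> x \<Longrightarrow> x \<le> 1 \<Longrightarrow> 0 \<le> \<phi> x"
    and cont: "continuous_on {0..1} G"
    and der: "\<And>x. 0 < x \<Longrightarrow> x < 1 \<Longrightarrow> (G has_real_derivative \<phi> x) (at x)"
    and lam: "\<mu> > 0" and th: "0 \<le> \<theta>" "\<theta> \<le> 1" and N: "(\<theta> + real N) * \<mu> > 1"
  shows "\<bar>\<mu> * (\<Sum>k | k < N \<and> (\<theta> + real k) * \<mu> \<le> 1. \<phi> ((\<theta> + real k) * \<mu>)) - (G 1 - G 0)\<bar> \<le> \<mu> * \<phi> 0"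
proof -
  \<comment> \<open>Extended by zero beyond 1 the function still decreases, and \<open>H\<close> is
    constant there, so the step across 1 obeys the same two bounds as all others.\<close>
  define f where "f t = (if t \<le> 1 then \<phi> t else 0)" for t
  define H where "H t = G (min t 1)" for t
  define x where "x k = (\<theta> + real k) * \<mu>" for k :: nat
  note B = antimono_primitive_bounds[OF anti cont der]
  have bnd: "(b - a) * f b \<le> H b - H a \<and> H b - H a \<le> (b - a) * f a" if "0 \<le> a" "a \<le> b" for a b
  proof (cases "b \<le> 1")
    case True
    then show ?thesis using B[of a b] that by (auto simp: f_def H_def)
  next
    case False
    show ?thesis
    proof (cases "a \<le> 1")
      case True
      have "(1 - a) * \<phi> 1 \<le> G 1 - G a" "G 1 - G a \<le> (1 - a) * \<phi> a"
        using B[of a 1] that True by auto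
      moreover have "0 \<le> (1 - a) * \<phi> 1" using True nonneg[of 1] by auto
      moreover have "(1 - a) * \<phi> a \<le> (b - a) * \<phi> a"
        using True False nonneg[of a] that by (intro mult_right_mono) auto
      ultimately show ?thesis using True False by (auto simp: f_def H_def min_def)
    qed (use False in \<open>auto simp: f_def H_def\<close>)
  qed
  have x0: "0 \<le> x k" for k using th lam by (auto simp: x_def)
  have xS: "x (Suc k) - x k = \<mu>" for k by (simp add: x_def algebra_simps)
  have stp: "\<mu> * f (x (Suc k)) \<le> H (x (Suc k)) - H (x k)" "H (x (Suc k)) - H (x k) \<le> \<mu> * f (x k)" for k
    using bnd[of "x k" "x (Suc k)"] x0 xS[of k] lam by auto
  have S: "(\<Sum>k | k < N \<and> (\<theta> + real k) * \<mu> \<le> 1. \<phi> ((\<theta> + real k) * \<mu>)) = (\<Sum>k<N. f (x k))"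
    by (rule sum.mono_neutral_cong_left) (auto simp: f_def x_def)
  have low: "H (x n) - H (x 0) \<le> \<mu> * (\<Sum>k<n. f (x k))" for n
  proof (induction n)
    case (Suc n)
    then show ?case using stp(2)[of n] by (simp add: algebra_simps)
  qed simp
  have up: "\<mu> * (\<Sum>k<Suc n. f (x k)) \<le> \<mu> * f (x 0) + H (x n) - H (x 0)" for n
  proof (induction n)
    case (Suc n)
    then show ?case using stp(1)[of n] by (simp add: algebra_simps)
  qed simp
  have f0: "f 0 = \<phi> 0" by (simp add: f_def)
  have fle: "f (x 0) \<le> \<phi> 0" using anti[of 0 "x 0"] nonneg[of 0] x0[of 0] by (auto simp: f_def)
  have H1: "H t \<le> G 1" if "0 \<le> t" for t
  proof (cases "t \<le> 1")
    case True
    have "0 \<le> (1 - t) * \<phi> 1" using True nonneg[of 1] by auto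
    then show ?thesis using B(1)[of t 1] that True by (auto simp: H_def)
  qed (auto simp: H_def)
  have H0: "G 0 \<le> H (x 0)" "H (x 0) - G 0 \<le> \<mu> * \<phi> 0"
  proof -
    have b: "(x 0 - 0) * f (x 0) \<le> H (x 0) - H 0" "H (x 0) - H 0 \<le> (x 0 - 0) * f 0"
      using bnd[of 0 "x 0"] x0 by auto
    have "0 \<le> f (x 0)" using nonneg x0 by (auto simp: f_def)
    then have "0 \<le> (x 0 - 0) * f (x 0)" using x0[of 0] by simp
    then show "G 0 \<le> H (x 0)" using b(1) by (simp add: H_def)
    have "x 0 * \<phi> 0 \<le> \<mu> * \<phi> 0" using th lam nonneg[of 0] by (intro mult_right_mono) (auto simp: x_def)
    then show "H (x 0) - G 0 \<le> \<mu> * \<phi> 0" using b(2) f0 by (simp add: H_def)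
  qed
  have HN: "H (x N) = G 1" using N by (simp add: H_def x_def)
  have "G 1 - G 0 - \<mu> * \<phi> 0 \<le> \<mu> * (\<Sum>k<N. f (x k))"
    using low[of N] H0 HN by linarith
  moreover have "\<mu> * (\<Sum>k<N. f (x k)) \<le> G 1 - G 0 + \<mu> * \<phi> 0"
  proof (cases N)
    case 0
    have "0 \<le> \<phi> 0" using nonneg[of 0] by auto
    moreover have "G 0 \<le> G 1" using H1[of 0] by (simp add: H_def)
    ultimately show ?thesis using 0 lam by auto
  next
    case (Suc n)
    have "\<mu> * f (x 0) \<le> \<mu> * \<phi> 0" using fle lam by auto
    then show ?thesis using up[of n] H1[of "x n"] x0[of n] H0 Suc by auto
  qed
  ultimately show ?thesis unfolding S by (auto simp: abs_le_iff)
qed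

lemma int_line_sum:
  fixes \<phi> G :: "real \<Rightarrow> real"
  assumes anti: "\<And>x y. 0 \<le> x \<Longrightarrow> x \<le> y \<Longrightarrow> y \<le> 1 \<Longrightarrow> \<phi> y \<le> \<phi> x"
    and nonneg: "\<And>x. 0 \<le> x \<Longrightarrow> x \<le> 1 \<Longrightarrow> 0 \<le> \<phi> x"
    and cont: "continuous_on {0..1} G"
    and der: "\<And>x. 0 < x \<Longrightarrow> x < 1 \<Longrightarrow> (G has_real_derivative \<phi> x) (at x)"
    and lam: "\<mu> > 0"
  shows "finite {n::int. \<bar>of_int n + \<theta>\<bar> * \<mu> \<le> 1}"
    and "\<bar>(\<Sum>n | \<bar>of_int n + \<theta>\<bar> * \<mu> \<le> 1. \<phi> (\<bar>of_int n + \<theta>\<bar> * \<mu>)) - 2 * (G 1 - G 0) / \<mu>\<bar> \<le> 2 * \<phi> 0"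
proof -
  \<comment> \<open>\<open>c\<close> is the first integer with \<open>c + \<theta>\<close>
    nonnegative. The integers from \<open>c\<close> on and those below \<open>c\<close> form two
    half lines with offsets \<open>t\<close> and \<open>1 - t\<close>.\<close>
  define c where "c = \<lceil>- \<theta>\<rceil>"
  define t where "t = of_int c + \<theta>"
  have t: "0 \<le> t" "t < 1" unfolding t_def c_def by linarith+
  obtain N :: nat where N: "real N > 1 / \<mu>" using reals_Archimedean2 by blast
  then have N1: "real N * \<mu> > 1" using lam by (simp add: field_simps)
  let ?A = "{n::int. \<bar>of_int n + \<theta>\<bar> * \<mu> \<le> 1}"
  define P where "P = {k. k < N \<and> (t + real k) * \<mu> \<le> 1}"
  define M where "M = {k. k < N \<and> (1 - t + real k) * \<mu> \<le> 1}"
  have NP: "(t + real N) * \<mu> > 1" "(1 - t + real N) * \<mu> > 1"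
  proof -
    have "real N * \<mu> \<le> (t + real N) * \<mu>" "real N * \<mu> \<le> (1 - t + real N) * \<mu>"
      using t lam by (auto intro!: mult_right_mono)
    then show "(t + real N) * \<mu> > 1" "(1 - t + real N) * \<mu> > 1" using N1 by linarith+
  qed
  have less: "k < N" if "(s + real k) * \<mu> \<le> 1" "0 \<le> s" for s k
  proof (rule ccontr)
    assume "\<not> k < N"
    then have "real N * \<mu> \<le> (s + real k) * \<mu>" using that lam by (intro mult_right_mono) auto
    then show False using that N1 by linarith
  qed
  have eq: "?A = (\<lambda>k. c + int k) ` P \<union> (\<lambda>k. c - 1 - int k) ` M"
  proof (intro equalityI subsetI)
    fix n assume n: "n \<in> ?A"
    show "n \<in> (\<lambda>k. c + int k) ` P \<union> (\<lambda>k. c - 1 - int k) ` M"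
    proof (cases "c \<le> n")
      case True
      have *: "\<bar>of_int n + \<theta>\<bar> = t + real (nat (n - c))" using True t by (simp add: t_def)
      have "nat (n - c) \<in> P" using n less[of t "nat (n - c)"] t(1) unfolding P_def by (auto simp: *)
      then show ?thesis using True by (intro UnI1 image_eqI[of _ _ "nat (n - c)"]) auto
    next
      case False
      have *: "\<bar>of_int n + \<theta>\<bar> = 1 - t + real (nat (c - 1 - n))"
        using False t by (simp add: t_def)
      have "nat (c - 1 - n) \<in> M"
        using n less[of "1 - t" "nat (c - 1 - n)"] t(2) unfolding M_def by (auto simp: *)
      then show ?thesis using False by (intro UnI2 image_eqI[of _ _ "nat (c - 1 - n)"]) auto
    qed
  next
    fix n assume "n \<in> (\<lambda>k. c + int k) ` P \<union> (\<lambda>k. c - 1 - int k) ` M"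
    then show "n \<in> ?A"
    proof
      assume "n \<in> (\<lambda>k. c + int k) ` P"
      then obtain k where k: "k \<in> P" "n = c + int k" by auto
      have "\<bar>of_int n + \<theta>\<bar> = t + real k" using k t by (simp add: t_def)
      then show ?thesis using k by (simp add: P_def)
    next
      assume "n \<in> (\<lambda>k. c - 1 - int k) ` M"
      then obtain k where k: "k \<in> M" "n = c - 1 - int k" by auto
      have "\<bar>of_int n + \<theta>\<bar> = 1 - t + real k" using k t by (simp add: t_def)
      then show ?thesis using k by (simp add: M_def)
    qed
  qed
  have fin: "finite P" "finite M" by (auto simp: P_def M_def)
  show "finite ?A" unfolding eq using fin by auto
  have "(\<Sum>n\<in>?A. \<phi> (\<bar>of_int n + \<theta>\<bar> * \<mu>)) =
      (\<Sum>n\<in>(\<lambda>k. c + int k) ` P. \<phi> (\<bar>of_int n + \<theta>\<bar> * \<mu>)) + (\<Sum>n\<in>(\<lambda>k. c - 1 - int k) ` M. \<phi> (\<bar>of_int n + \<theta>\<bar> * \<mu>))"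
    unfolding eq using fin by (intro sum.union_disjoint) auto
  also have "(\<Sum>n\<in>(\<lambda>k. c + int k) ` P. \<phi> (\<bar>of_int n + \<theta>\<bar> * \<mu>)) = (\<Sum>k\<in>P. \<phi> ((t + real k) * \<mu>))"
  proof (subst sum.reindex)
    show "inj_on (\<lambda>k. c + int k) P" by (auto simp: inj_on_def)
    have "\<bar>of_int (c + int k) + \<theta>\<bar> = t + real k" for k using t by (simp add: t_def)
    then show "sum ((\<lambda>n. \<phi> (\<bar>of_int n + \<theta>\<bar> * \<mu>)) \<circ> (\<lambda>k. c + int k)) P = (\<Sum>k\<in>P. \<phi> ((t + real k) * \<mu>))"
      unfolding o_def by simp
  qed
  also have "(\<Sum>n\<in>(\<lambda>k. c - 1 - int k) ` M. \<phi> (\<bar>of_int n + \<theta>\<bar> * \<mu>)) = (\<Sum>k\<in>M. \<phi> ((1 - t + real k) * \<mu>))"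
  proof (subst sum.reindex)
    show "inj_on (\<lambda>k. c - 1 - int k) M" by (auto simp: inj_on_def)
    have "\<bar>of_int (c - 1 - int k) + \<theta>\<bar> = 1 - t + real k" for k using t by (simp add: t_def)
    then show "sum ((\<lambda>n. \<phi> (\<bar>of_int n + \<theta>\<bar> * \<mu>)) \<circ> (\<lambda>k. c - 1 - int k)) M = (\<Sum>k\<in>M. \<phi> ((1 - t + real k) * \<mu>))"
      unfolding o_def by simp
  qed
  finally have sm: "(\<Sum>n\<in>?A. \<phi> (\<bar>of_int n + \<theta>\<bar> * \<mu>)) = (\<Sum>k\<in>P. \<phi> ((t + real k) * \<mu>)) + (\<Sum>k\<in>M. \<phi> ((1 - t + real k) * \<mu>))" .
  have b1: "\<bar>\<mu> * (\<Sum>k\<in>P. \<phi> ((t + real k) * \<mu>)) - (G 1 - G 0)\<bar> \<le> \<mu> * \<phi> 0"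
    unfolding P_def using t by (intro half_line_sum[OF anti nonneg cont der lam]) (use NP in auto)
  have b2: "\<bar>\<mu> * (\<Sum>k\<in>M. \<phi> ((1 - t + real k) * \<mu>)) - (G 1 - G 0)\<bar> \<le> \<mu> * \<phi> 0"
    unfolding M_def using t by (intro half_line_sum[OF anti nonneg cont der lam]) (use NP in auto)
  have lin: "\<mu> * (X + Y - 2 * D / \<mu>) = (\<mu> * X - D) + (\<mu> * Y - D)" for X Y D
    using lam by (simp add: field_simps)
  have "\<mu> * \<bar>(\<Sum>n\<in>?A. \<phi> (\<bar>of_int n + \<theta>\<bar> * \<mu>)) - 2 * (G 1 - G 0) / \<mu>\<bar> =
     \<bar>(\<mu> * (\<Sum>k\<in>P. \<phi> ((t + real k) * \<mu>)) - (G 1 - G 0)) + (\<mu> * (\<Sum>k\<in>M. \<phi> ((1 - t + real k) * \<mu>)) - (G 1 - G 0))\<bar>"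
    unfolding sm pos_mult_abs[OF lam] lin ..
  also have "\<dots> \<le> \<mu> * \<phi> 0 + \<mu> * \<phi> 0" using b1 b2 by linarith
  finally have "\<mu> * \<bar>(\<Sum>n\<in>?A. \<phi> (\<bar>of_int n + \<theta>\<bar> * \<mu>)) - 2 * (G 1 - G 0) / \<mu>\<bar> \<le> \<mu> * (2 * \<phi> 0)" by simp
  then show "\<bar>(\<Sum>n\<in>?A. \<phi> (\<bar>of_int n + \<theta>\<bar> * \<mu>)) - 2 * (G 1 - G 0) / \<mu>\<bar> \<le> 2 * \<phi> 0"
    using lam by (simp only: mult_le_cancel_left_pos)
qed

section \<open>Slices of balls\<close>

text \<open>The integral of \<open>sqrt (1 - x\<^sup>2) ^ j\<close> over \<open>{-1..1}\<close>,
  which is the volume of the unit ball in dimension \<open>j + 1\<close> divided by that in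
  dimension \<open>j\<close>. The last branch is meant for \<open>j = 3\<close>.\<close>

definition slice_vol :: "nat \<Rightarrow> real" where
  "slice_vol j = (if j = 0 then 2 else if j = 1 then pi / 2 else if j = 2 then 4 / 3 else 3 * pi / 8)"

text \<open>The primitives for odd \<open>j\<close> come from the substitution
  \<open>x = sin t\<close>. The factor 2 accounts for the negative half of the slice.\<close>

lemma slice_primitive:
  assumes "j \<le> 3"
  obtains G :: "real \<Rightarrow> real" where "continuous_on {0..1} G"
    "\<And>x. 0 < x \<Longrightarrow> x < 1 \<Longrightarrow> (G has_real_derivative sqrt (1 - x\<^sup>2) ^ j) (at x)"
    "2 * (G 1 - G 0) = slice_vol j"
proof -
  have sq: "0 < 1 - x\<^sup>2" if "0 < x" "x < 1" for x :: real
    using that power_strict_mono[of x 1 2] by simp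
  have ds: "((\<lambda>x. sqrt (1 - x\<^sup>2)) has_real_derivative - x / sqrt (1 - x\<^sup>2)) (at x)"
    if x: "0 < x" "x < 1" for x :: real
  proof -
    have g: "((\<lambda>x. 1 - x\<^sup>2) has_real_derivative - (2 * x)) (at x)"
      by (auto intro!: derivative_eq_intros)
    have "((\<lambda>x. sqrt (1 - x\<^sup>2)) has_real_derivative inverse (sqrt (1 - x\<^sup>2)) / 2 * - (2 * x)) (at x)"
      by (rule DERIV_chain2[where f = sqrt and g = "\<lambda>x. 1 - x\<^sup>2", OF DERIV_real_sqrt[OF sq[OF x]] g])
    then show ?thesis by (simp add: inverse_eq_divide)
  qed
  have da: "(arcsin has_real_derivative inverse (sqrt (1 - x\<^sup>2))) (at x)" if "0 < x" "x < 1" for x :: real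
    using that by (intro DERIV_arcsin) auto
  consider "j = 0" | "j = 1" | "j = 2" | "j = 3" using assms by linarith
  then show thesis
  proof cases
    case 1
    show thesis
      by (rule that[of "\<lambda>x. x"]) (auto simp: 1 slice_vol_def intro!: derivative_eq_intros continuous_intros)
  next
    case 2
    show thesis
    proof (rule that[of "\<lambda>x. (x * sqrt (1 - x\<^sup>2) + arcsin x) / 2"])
      fix x :: real assume x: "0 < x" "x < 1"
      define s where "s = sqrt (1 - x\<^sup>2)"
      have s: "s > 0" "s * s = 1 - x * x" using sq[OF x] by (auto simp: s_def power2_eq_square)
      have "((\<lambda>x. (x * sqrt (1 - x\<^sup>2) + arcsin x) / 2) has_real_derivative
          (1 * s + - x / s * x + inverse s) / 2) (at x)"
        unfolding s_def by (intro DERIV_cdivide DERIV_add DERIV_mult DERIV_ident ds da x)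
      also have "1 * s + - x / s * x + inverse s = (s * s + (1 - x * x)) / s"
        using s(1) by (simp add: inverse_eq_divide field_simps)
      also have "(s * s + (1 - x * x)) / s / 2 = s" unfolding s(2)[symmetric] using s(1) by simp
      finally show "((\<lambda>x. (x * sqrt (1 - x\<^sup>2) + arcsin x) / 2) has_real_derivative sqrt (1 - x\<^sup>2) ^ j) (at x)"
        by (simp add: 2 s_def)
    qed (auto simp: 2 slice_vol_def intro!: continuous_intros)
  next
    case 3
    show thesis
    proof (rule that[of "\<lambda>x. x - x ^ 3 / 3"])
      fix x :: real assume x: "0 < x" "x < 1"
      show "((\<lambda>x. x - x ^ 3 / 3) has_real_derivative sqrt (1 - x\<^sup>2) ^ j) (at x)"
        using sq[OF x] by (auto simp: 3 intro!: derivative_eq_intros)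
    qed (auto simp: 3 slice_vol_def intro!: continuous_intros)
  next
    case 4
    show thesis
    proof (rule that[of "\<lambda>x. (x * (5 - 2 * x\<^sup>2) * sqrt (1 - x\<^sup>2) + 3 * arcsin x) / 8"])
      fix x :: real assume x: "0 < x" "x < 1"
      define s where "s = sqrt (1 - x\<^sup>2)"
      have s: "s > 0" "s * s = 1 - x * x" using sq[OF x] by (auto simp: s_def power2_eq_square)
      have p: "((\<lambda>x. x * (5 - 2 * x\<^sup>2)) has_real_derivative (5 - 6 * x * x)) (at x)"
        by (auto intro!: derivative_eq_intros simp: power2_eq_square algebra_simps)
      have "((\<lambda>x. (x * (5 - 2 * x\<^sup>2) * sqrt (1 - x\<^sup>2) + 3 * arcsin x) / 8) has_real_derivative
          ((5 - 6 * x * x) * s + - x / s * (x * (5 - 2 * x\<^sup>2)) + 3 * inverse s) / 8) (at x)"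
        unfolding s_def by (intro DERIV_cdivide DERIV_add DERIV_mult DERIV_cmult p ds da x)
      also have "((5 - 6 * x * x) * s + - x / s * (x * (5 - 2 * x\<^sup>2)) + 3 * inverse s) / 8
          = ((5 - 6 * x * x) * (s * s) - x * x * (5 - 2 * x * x) + 3) / (8 * s)"
        using s(1) by (simp add: inverse_eq_divide power2_eq_square field_simps)
      also have "(5 - 6 * x * x) * (s * s) - x * x * (5 - 2 * x * x) + 3 = 8 * (s * s) * (s * s)"
        unfolding s(2) by (simp add: algebra_simps)
      also have "8 * (s * s) * (s * s) / (8 * s) = s ^ 3" using s(1) by (simp add: power3_eq_cube)
      finally show "((\<lambda>x. (x * (5 - 2 * x\<^sup>2) * sqrt (1 - x\<^sup>2) + 3 * arcsin x) / 8) has_real_derivative sqrt (1 - x\<^sup>2) ^ j) (at x)"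
        by (simp add: 4 s_def)
    qed (auto simp: 4 slice_vol_def intro!: continuous_intros)
  qed
qed

text \<open>Division by \<open>sqrt Q\<close> turns this into a sum over the unit interval with step
  \<open>d / sqrt Q\<close>. The error is one largest slice on each side of the centre, whatever the
  offset.\<close>

lemma ball_slice_sum:
  fixes d \<theta> Q :: real
  assumes j: "j \<le> 3" and d: "d > 0" and Q: "Q \<ge> 0"
  shows "finite {n::int. d\<^sup>2 * (of_int n + \<theta>)\<^sup>2 \<le> Q}"
    and "\<bar>(\<Sum>n | d\<^sup>2 * (of_int n + \<theta>)\<^sup>2 \<le> Q. sqrt (Q - d\<^sup>2 * (of_int n + \<theta>)\<^sup>2) ^ j) - slice_vol j * sqrt Q ^ Suc j / d\<bar>
      \<le> 2 * sqrt Q ^ j"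
proof -
  let ?A = "{n::int. d\<^sup>2 * (of_int n + \<theta>)\<^sup>2 \<le> Q}"
  have "finite ?A \<and> \<bar>(\<Sum>n\<in>?A. sqrt (Q - d\<^sup>2 * (of_int n + \<theta>)\<^sup>2) ^ j) - slice_vol j * sqrt Q ^ Suc j / d\<bar> \<le> 2 * sqrt Q ^ j"
  \<comment> \<open>The step \<open>d / sqrt Q\<close> makes no sense here. At most one lattice
    point remains; it counts as 1 for \<open>j = 0\<close>, where \<open>0 ^ 0 = 1\<close>, and as 0
    otherwise.\<close>
  proof (cases "Q = 0")
    case True
    have sub: "?A \<subseteq> {\<lfloor>- \<theta>\<rfloor>}" 
    proof
      fix n assume "n \<in> ?A"
      then have "of_int n + \<theta> = 0" using True d by (auto simp: mult_le_0_iff)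
      then have "- \<theta> = of_int n" by linarith
      then show "n \<in> {\<lfloor>- \<theta>\<rfloor>}" by simp
    qed
    have f: "finite ?A" by (rule finite_subset[OF sub]) auto
    have "(\<Sum>n\<in>?A. sqrt (Q - d\<^sup>2 * (of_int n + \<theta>)\<^sup>2) ^ j) = (\<Sum>n\<in>?A. 0 ^ j)"
    proof (rule sum.cong[OF refl])
      fix n assume "n \<in> ?A"
      then have "of_int n + \<theta> = 0" using True d by (auto simp: mult_le_0_iff)
      then show "sqrt (Q - d\<^sup>2 * (of_int n + \<theta>)\<^sup>2) ^ j = 0 ^ j" using True by simp
    qed
    also have "\<dots> = real (card ?A) * 0 ^ j" by simp
    moreover have "card ?A \<le> 1" using card_mono[OF _ sub] by simp
    ultimately show ?thesis using f True by (cases j) auto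
  next
    case False
    define s where "s = sqrt Q"
    have s: "s > 0" "s\<^sup>2 = Q" using False Q by (auto simp: s_def)
    define \<mu> where "\<mu> = d / s"
    have mu: "\<mu> > 0" using s d by (simp add: \<mu>_def)
    obtain G where G: "continuous_on {0..1} G"
      "\<And>x. 0 < x \<Longrightarrow> x < 1 \<Longrightarrow> (G has_real_derivative sqrt (1 - x\<^sup>2) ^ j) (at x)"
      "2 * (G 1 - G 0) = slice_vol j" by (rule slice_primitive[OF j]) blast
    define \<phi> where "\<phi> x = sqrt (1 - x\<^sup>2) ^ j" for x :: real
    have anti: "\<phi> y \<le> \<phi> x" if "0 \<le> x" "x \<le> y" "y \<le> 1" for x y
    proof -
      have "x\<^sup>2 \<le> y\<^sup>2" "y\<^sup>2 \<le> 1" using that power_mono[of y 1 2] by (auto intro: power_mono)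
      then show ?thesis unfolding \<phi>_def by (intro power_mono) auto
    qed
    have nn: "0 \<le> \<phi> x" if "0 \<le> x" "x \<le> 1" for x
      unfolding \<phi>_def using that by (auto simp: abs_square_le_1)
    have key: "(\<bar>y\<bar> * \<mu>)\<^sup>2 * Q = d\<^sup>2 * y\<^sup>2" for y
      using s False by (simp add: \<mu>_def power_mult_distrib power_divide)
    have A: "?A = {n. \<bar>of_int n + \<theta>\<bar> * \<mu> \<le> 1}"
    proof -
      have "(d\<^sup>2 * y\<^sup>2 \<le> Q) = (\<bar>y\<bar> * \<mu> \<le> 1)" for y
      proof -
        have "(d\<^sup>2 * y\<^sup>2 \<le> Q) = ((\<bar>y\<bar> * \<mu>)\<^sup>2 * Q \<le> 1 * Q)" by (simp add: key)
        also have "\<dots> = ((\<bar>y\<bar> * \<mu>)\<^sup>2 \<le> 1)" using False Q by (subst mult_le_cancel_right) auto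
        also have "\<dots> = (\<bar>\<bar>y\<bar> * \<mu>\<bar> \<le> 1)" by (rule abs_square_le_1)
        also have "\<bar>\<bar>y\<bar> * \<mu>\<bar> = \<bar>y\<bar> * \<mu>" using mu by (simp add: abs_mult)
        finally show ?thesis .
      qed
      then show ?thesis by simp
    qed
    have ph: "sqrt (Q - d\<^sup>2 * y\<^sup>2) ^ j = s ^ j * \<phi> (\<bar>y\<bar> * \<mu>)" for y
    proof -
      have "Q - d\<^sup>2 * y\<^sup>2 = Q * (1 - (\<bar>y\<bar> * \<mu>)\<^sup>2)" by (simp add: algebra_simps key[symmetric])
      then show ?thesis by (simp add: real_sqrt_mult s_def power_mult_distrib \<phi>_def)
    qed
    have der: "(G has_real_derivative \<phi> x) (at x)" if "0 < x" "x < 1" for x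
      using G(2)[OF that] by (simp add: \<phi>_def)
    have fin: "finite ?A"
      unfolding A by (rule int_line_sum(1)[OF anti nn G(1) der mu])
    have b: "\<bar>(\<Sum>n\<in>?A. \<phi> (\<bar>of_int n + \<theta>\<bar> * \<mu>)) - 2 * (G 1 - G 0) / \<mu>\<bar> \<le> 2 * \<phi> 0"
      unfolding A by (rule int_line_sum(2)[OF anti nn G(1) der mu])
    have "(\<Sum>n\<in>?A. sqrt (Q - d\<^sup>2 * (of_int n + \<theta>)\<^sup>2) ^ j) - slice_vol j * sqrt Q ^ Suc j / d
        = s ^ j * ((\<Sum>n\<in>?A. \<phi> (\<bar>of_int n + \<theta>\<bar> * \<mu>)) - 2 * (G 1 - G 0) / \<mu>)"
      unfolding ph sum_distrib_left[symmetric] G(3) s_def[symmetric] using s d by (simp add: \<mu>_def algebra_simps)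
    then have "\<bar>(\<Sum>n\<in>?A. sqrt (Q - d\<^sup>2 * (of_int n + \<theta>)\<^sup>2) ^ j) - slice_vol j * sqrt Q ^ Suc j / d\<bar>
        = s ^ j * \<bar>(\<Sum>n\<in>?A. \<phi> (\<bar>of_int n + \<theta>\<bar> * \<mu>)) - 2 * (G 1 - G 0) / \<mu>\<bar>"
      using s by (simp add: abs_mult)
    also have "\<dots> \<le> s ^ j * (2 * \<phi> 0)" using b s by (intro mult_left_mono) auto
    also have "\<dots> = 2 * sqrt Q ^ j" by (simp add: \<phi>_def s_def)
    finally show ?thesis using fin by auto
  qed
  then show "finite ?A" "\<bar>(\<Sum>n\<in>?A. sqrt (Q - d\<^sup>2 * (of_int n + \<theta>)\<^sup>2) ^ j) - slice_vol j * sqrt Q ^ Suc j / d\<bar> \<le> 2 * sqrt Q ^ j"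
    by auto
qed

section \<open>Counting by iterated slicing\<close>

lemma count_line:
  fixes d \<theta> Q :: real
  assumes "d > 0" "Q \<ge> 0"
  shows "\<bar>real (card {n::int. d\<^sup>2 * (of_int n + \<theta>)\<^sup>2 \<le> Q}) - 2 * sqrt Q / d\<bar> \<le> 2"
  using ball_slice_sum(2)[of 0 d Q \<theta>] assms by (simp add: slice_vol_def)

text \<open>The step from one dimension to the next: the main terms of the slices are summed by
  \<open>ball_slice_sum\<close>, while their errors are multiplied by the number of slices, at most
  \<open>2 * sqrt Q / d + 2\<close>.\<close>

lemma count_slices:
  fixes d \<theta> Q c E :: real and S :: "int \<Rightarrow> 'a set"
  defines "A \<equiv> {n::int. d\<^sup>2 * (of_int n + \<theta>)\<^sup>2 \<le> Q}"
  assumes j: "j \<le> 3" and d: "d > 0" and Q: "Q \<ge> 0" and c: "c \<ge> 0" and E: "E \<ge> 0"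
    and fin: "\<And>n. n \<in> A \<Longrightarrow> finite (S n)"
    and S: "\<And>n. n \<in> A \<Longrightarrow> \<bar>real (card (S n)) - c * sqrt (Q - d\<^sup>2 * (of_int n + \<theta>)\<^sup>2) ^ j\<bar> \<le> E"
  shows "finite (Sigma A S)"
    and "\<bar>real (card (Sigma A S)) - c * slice_vol j * sqrt Q ^ Suc j / d\<bar> \<le> 2 * c * sqrt Q ^ j + E * (2 * sqrt Q / d + 2)"
proof -
  have fA: "finite A" unfolding A_def by (rule ball_slice_sum(1)[OF j d Q])
  show "finite (Sigma A S)" using fA fin by auto
  let ?f = "\<lambda>n. sqrt (Q - d\<^sup>2 * (of_int n + \<theta>)\<^sup>2) ^ j"
  have 1: "\<bar>(\<Sum>n\<in>A. ?f n) - slice_vol j * sqrt Q ^ Suc j / d\<bar> \<le> 2 * sqrt Q ^ j"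
    unfolding A_def by (rule ball_slice_sum(2)[OF j d Q])
  have cd: "real (card A) \<le> 2 * sqrt Q / d + 2"
    using count_line[OF d Q, of \<theta>] unfolding A_def by linarith
  have eq: "real (card (Sigma A S)) - c * slice_vol j * sqrt Q ^ Suc j / d
     = (\<Sum>n\<in>A. real (card (S n)) - c * ?f n) + c * ((\<Sum>n\<in>A. ?f n) - slice_vol j * sqrt Q ^ Suc j / d)"
    using fA fin by (simp add: card_SigmaI sum_subtractf sum_distrib_left algebra_simps)
  have e: "2 * c * sqrt Q ^ j = c * (2 * sqrt Q ^ j)" by simp
  have chain: "x \<le> c + t" if "x \<le> a + b" "b \<le> c" "a \<le> s" "s \<le> t" for x a b c s t :: real
    using that by linarith
  from eq have "\<bar>real (card (Sigma A S)) - c * slice_vol j * sqrt Q ^ Suc j / d\<bar>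
      \<le> \<bar>\<Sum>n\<in>A. real (card (S n)) - c * ?f n\<bar> + \<bar>c * ((\<Sum>n\<in>A. ?f n) - slice_vol j * sqrt Q ^ Suc j / d)\<bar>"
    by (simp only: abs_triangle_ineq)
  moreover have "\<bar>c * ((\<Sum>n\<in>A. ?f n) - slice_vol j * sqrt Q ^ Suc j / d)\<bar> \<le> c * (2 * sqrt Q ^ j)"
    using 1 c by (simp only: abs_mult abs_of_nonneg) (intro mult_left_mono)
  moreover have "\<bar>\<Sum>n\<in>A. real (card (S n)) - c * ?f n\<bar> \<le> (\<Sum>n\<in>A. E)"
    by (rule order_trans[OF sum_abs sum_mono]) (rule S)
  moreover have "(\<Sum>n\<in>A. E) \<le> E * (2 * sqrt Q / d + 2)"
    using mult_left_mono[OF cd E] by (simp add: mult.commute)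
  ultimately show "\<bar>real (card (Sigma A S)) - c * slice_vol j * sqrt Q ^ Suc j / d\<bar> \<le> 2 * c * sqrt Q ^ j + E * (2 * sqrt Q / d + 2)"
    unfolding e by (rule chain)
qed

text \<open>The offset \<open>\<theta>1\<close> may depend on the outer index because completing the
  square in a triangular basis produces such a shift. As the bounds on lines are uniform in the
  offset, nothing needs to be known about it.\<close>

lemma count_ellipse:
  fixes d1 d2 Q \<theta>2 :: real and \<theta>1 :: "int \<Rightarrow> real"
  assumes d: "d1 > 0" "d2 > 0" and Q: "Q \<ge> 0"
  defines "E \<equiv> {(n2::int, n1::int). d1\<^sup>2 * (of_int n1 + \<theta>1 n2)\<^sup>2 + d2\<^sup>2 * (of_int n2 + \<theta>2)\<^sup>2 \<le> Q}"
  shows "finite E" and "\<bar>real (card E) - pi / (d1 * d2) * sqrt Q ^ 2\<bar> \<le> 4 * sqrt Q / d1 + 4 * sqrt Q / d2 + 4"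
proof -
  define A where "A = {n::int. d2\<^sup>2 * (of_int n + \<theta>2)\<^sup>2 \<le> Q}"
  define S where "S n2 = {n::int. d1\<^sup>2 * (of_int n + \<theta>1 n2)\<^sup>2 \<le> Q - d2\<^sup>2 * (of_int n2 + \<theta>2)\<^sup>2}" for n2
  have "n2 \<in> A" if "d1\<^sup>2 * (of_int n1 + \<theta>1 n2)\<^sup>2 + d2\<^sup>2 * (of_int n2 + \<theta>2)\<^sup>2 \<le> Q" for n1 n2
  proof -
    have "0 \<le> d1\<^sup>2 * (of_int n1 + \<theta>1 n2)\<^sup>2" by simp
    then show ?thesis using that unfolding A_def mem_Collect_eq by linarith
  qed
  then have E: "E = Sigma A S" by (auto simp: E_def S_def algebra_simps)
  have f: "finite (S n)" if "n \<in> A" for n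
    using that ball_slice_sum(1)[of 0 d1 _ "\<theta>1 n"] d unfolding S_def A_def by auto
  have b: "\<bar>real (card (S n)) - 2 / d1 * sqrt (Q - d2\<^sup>2 * (of_int n + \<theta>2)\<^sup>2) ^ 1\<bar> \<le> 2" if "n \<in> A" for n
    using that count_line[of d1 "Q - d2\<^sup>2 * (of_int n + \<theta>2)\<^sup>2" "\<theta>1 n"] d unfolding S_def A_def by simp
  note C = count_slices[where j = 1 and d = d2 and \<theta> = \<theta>2 and c = "2 / d1" and E = 2 and S = S and Q = Q]
  show "finite E" unfolding E A_def by (rule C(1)) (use d Q f b in \<open>auto simp: A_def\<close>)
  have "\<bar>real (card (Sigma A S)) - 2 / d1 * slice_vol 1 * sqrt Q ^ Suc 1 / d2\<bar> \<le> 2 * (2 / d1) * sqrt Q ^ 1 + 2 * (2 * sqrt Q / d2 + 2)"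
    unfolding A_def by (rule C(2)) (use d Q f b in \<open>auto simp: A_def\<close>)
  then show "\<bar>real (card E) - pi / (d1 * d2) * sqrt Q ^ 2\<bar> \<le> 4 * sqrt Q / d1 + 4 * sqrt Q / d2 + 4"
    unfolding E by (simp add: slice_vol_def power2_eq_square algebra_simps)
qed

lemma count_ellipsoid:
  fixes d1 d2 d3 Q \<theta>3 :: real and \<theta>1 :: "int \<Rightarrow> int \<Rightarrow> real" and \<theta>2 :: "int \<Rightarrow> real"
  assumes d: "d1 > 0" "d2 > 0" "d3 > 0" and Q: "Q \<ge> 0"
  defines "E \<equiv> {(n3::int, n2::int, n1::int). d1\<^sup>2 * (of_int n1 + \<theta>1 n3 n2)\<^sup>2 + d2\<^sup>2 * (of_int n2 + \<theta>2 n3)\<^sup>2 + d3\<^sup>2 * (of_int n3 + \<theta>3)\<^sup>2 \<le> Q}"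
  shows "finite E" and "\<bar>real (card E) - 4 * pi / (3 * d1 * d2 * d3) * sqrt Q ^ 3\<bar> \<le>
     2 * pi / (d1 * d2) * sqrt Q ^ 2 + (4 * sqrt Q / d1 + 4 * sqrt Q / d2 + 4) * (2 * sqrt Q / d3 + 2)"
proof -
  define A where "A = {n::int. d3\<^sup>2 * (of_int n + \<theta>3)\<^sup>2 \<le> Q}"
  define S where "S n3 = {(n2::int, n1::int). d1\<^sup>2 * (of_int n1 + \<theta>1 n3 n2)\<^sup>2 + d2\<^sup>2 * (of_int n2 + \<theta>2 n3)\<^sup>2 \<le> Q - d3\<^sup>2 * (of_int n3 + \<theta>3)\<^sup>2}" for n3
  have "n3 \<in> A" if "d1\<^sup>2 * (of_int n1 + \<theta>1 n3 n2)\<^sup>2 + d2\<^sup>2 * (of_int n2 + \<theta>2 n3)\<^sup>2 + d3\<^sup>2 * (of_int n3 + \<theta>3)\<^sup>2 \<le> Q" for n1 n2 n3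
  proof -
    have "0 \<le> d1\<^sup>2 * (of_int n1 + \<theta>1 n3 n2)\<^sup>2" "0 \<le> d2\<^sup>2 * (of_int n2 + \<theta>2 n3)\<^sup>2" by simp_all
    then show ?thesis using that unfolding A_def mem_Collect_eq by linarith
  qed
  then have E: "E = Sigma A S" by (auto simp: E_def S_def algebra_simps)
  define B where "B = 4 * sqrt Q / d1 + 4 * sqrt Q / d2 + 4"
  have B: "B \<ge> 0" using d Q by (auto simp: B_def)
  have f: "finite (S n)" if "n \<in> A" for n
    using that count_ellipse(1)[of d1 d2 _ "\<theta>1 n" "\<theta>2 n"] d unfolding S_def A_def by auto
  have b: "\<bar>real (card (S n)) - pi / (d1 * d2) * sqrt (Q - d3\<^sup>2 * (of_int n + \<theta>3)\<^sup>2) ^ 2\<bar> \<le> B" if "n \<in> A" for n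
  proof -
    define Q' where "Q' = Q - d3\<^sup>2 * (of_int n + \<theta>3)\<^sup>2"
    have Q': "0 \<le> Q'" "Q' \<le> Q" using that by (auto simp: Q'_def A_def)
    have "\<bar>real (card (S n)) - pi / (d1 * d2) * sqrt Q' ^ 2\<bar> \<le> 4 * sqrt Q' / d1 + 4 * sqrt Q' / d2 + 4"
      using count_ellipse(2)[OF d(1,2) Q'(1), of "\<theta>1 n" "\<theta>2 n"] by (simp only: S_def Q'_def)
    also have "\<dots> \<le> B" unfolding B_def using d Q' by (intro add_mono divide_right_mono mult_left_mono) auto
    finally show ?thesis by (simp only: Q'_def)
  qed
  note C = count_slices[where j = 2 and d = d3 and \<theta> = \<theta>3 and c = "pi / (d1 * d2)" and E = B and S = S and Q = Q]
  show "finite E" unfolding E A_def by (rule C(1)) (use d Q f b B in \<open>auto simp: A_def\<close>)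
  have "\<bar>real (card (Sigma A S)) - pi / (d1 * d2) * slice_vol 2 * sqrt Q ^ Suc 2 / d3\<bar> \<le> 2 * (pi / (d1 * d2)) * sqrt Q ^ 2 + B * (2 * sqrt Q / d3 + 2)"
    unfolding A_def by (rule C(2)) (use d Q f b B in \<open>auto simp: A_def\<close>)
  moreover have "pi / (d1 * d2) * slice_vol 2 * sqrt Q ^ Suc 2 / d3 = 4 * pi / (3 * d1 * d2 * d3) * sqrt Q ^ 3"
    by (simp add: slice_vol_def power3_eq_cube power2_eq_square)
  moreover have "2 * (pi / (d1 * d2)) * sqrt Q ^ 2 = 2 * pi / (d1 * d2) * sqrt Q ^ 2" by simp
  ultimately show "\<bar>real (card E) - 4 * pi / (3 * d1 * d2 * d3) * sqrt Q ^ 3\<bar> \<le>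
     2 * pi / (d1 * d2) * sqrt Q ^ 2 + (4 * sqrt Q / d1 + 4 * sqrt Q / d2 + 4) * (2 * sqrt Q / d3 + 2)"
    unfolding E B_def by (simp only:)
qed

text \<open>The lattice of integer vectors whose coordinate sum is divisible by \<open>D\<close> has the triangular
  basis with diagonal \<open>1, 1, 1, D\<close>.\<close>
lemma count_ball_divisible_sum:
  fixes D :: nat and Q :: real
  assumes D: "D > 0" and Q: "Q \<ge> 0"
  defines "E \<equiv> {(a::int, b::int, c::int, e::int). int D dvd a + b + c + e \<and> of_int (a\<^sup>2 + b\<^sup>2 + c\<^sup>2 + e\<^sup>2) \<le> Q}"
  shows "finite E" and "\<bar>real (card E) - pi\<^sup>2 / (2 * real D) * Q\<^sup>2\<bar> \<le> 60 * (sqrt Q + 1) ^ 3"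
proof -
  define A where "A = {n::int. 1\<^sup>2 * (of_int n + 0)\<^sup>2 \<le> Q}"
  define S where "S a = {(n3::int, n2::int, n1::int).
     (real D)\<^sup>2 * (of_int n1 + (of_int (- a - n3 - n2) / real D))\<^sup>2 + 1\<^sup>2 * (of_int n2 + 0)\<^sup>2 + 1\<^sup>2 * (of_int n3 + 0)\<^sup>2 \<le> Q - 1\<^sup>2 * (of_int a + 0)\<^sup>2}" for a
  have D1: "real D \<ge> 1" using D by simp
  have "n \<in> A" if "(a, b, c) \<in> S n" for n a b c
  proof -
    have "0 \<le> (real D)\<^sup>2 * (of_int c + (of_int (- n - a - b) / real D))\<^sup>2" by simp
    moreover have "0 \<le> 1\<^sup>2 * (real_of_int b + 0)\<^sup>2" "0 \<le> 1\<^sup>2 * (real_of_int a + 0)\<^sup>2" by simp_all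
    ultimately have "0 \<le> Q - 1\<^sup>2 * (of_int n + 0)\<^sup>2" using that unfolding S_def mem_Collect_eq prod.case
      by linarith
    then show ?thesis by (simp add: A_def)
  qed
  have Dsq: "(real D)\<^sup>2 * (of_int n + (of_int m / real D))\<^sup>2 = of_int ((int D * n + m)\<^sup>2)" for n m
    using D1 by (simp add: power_mult_distrib[symmetric] algebra_simps)
  have inS: "(a, n3, n2, n1) \<in> Sigma A S \<longleftrightarrow> of_int (a\<^sup>2 + n3\<^sup>2 + n2\<^sup>2 + (int D * n1 - a - n3 - n2)\<^sup>2) \<le> Q" for a n3 n2 n1
  proof -
    have "(a, n3, n2, n1) \<in> Sigma A S \<longleftrightarrow> (n3, n2, n1) \<in> S a"
      using \<open>\<And>n a b c. (a, b, c) \<in> S n \<Longrightarrow> n \<in> A\<close> by blast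
    also have "\<dots> \<longleftrightarrow> of_int (a\<^sup>2 + n3\<^sup>2 + n2\<^sup>2 + (int D * n1 - a - n3 - n2)\<^sup>2) \<le> Q"
    proof -
      have "int D * n1 + (- a - n3 - n2) = int D * n1 - a - n3 - n2" by simp
      then show ?thesis unfolding S_def Dsq mem_Collect_eq prod.case by (auto simp: algebra_simps)
    qed
    finally show ?thesis .
  qed
  let ?h = "\<lambda>(a, n3, n2, n1). (a, n3, n2, int D * n1 - a - n3 - n2)"
  have inj: "inj_on ?h (Sigma A S)" using D by (auto simp: inj_on_def)
  have E: "E = ?h ` Sigma A S"
  proof (intro equalityI subsetI)
    fix x assume "x \<in> E"
    then obtain a b c e where x: "x = (a, b, c, e)" "int D dvd a + b + c + e" "of_int (a\<^sup>2 + b\<^sup>2 + c\<^sup>2 + e\<^sup>2) \<le> Q"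
      by (auto simp: E_def)
    obtain n where n: "a + b + c + e = int D * n" using x(2) by (auto elim: dvdE)
    then have e: "e = int D * n - a - b - c" by simp
    have "(a, b, c, n) \<in> Sigma A S" unfolding inS using x(3) e by simp
    then show "x \<in> ?h ` Sigma A S" using x(1) e by (intro image_eqI[of _ _ "(a, b, c, n)"]) auto
  next
    fix x assume "x \<in> ?h ` Sigma A S"
    then obtain a b c n where "(a, b, c, n) \<in> Sigma A S" "x = (a, b, c, int D * n - a - b - c)" by auto
    then show "x \<in> E" unfolding inS E_def by auto
  qed
  define s where "s = sqrt Q"
  have s: "s \<ge> 0" "s\<^sup>2 = Q" using Q by (auto simp: s_def)
  \<comment> \<open>The error of \<open>count_ellipsoid\<close> for the diagonal
    \<open>D, 1, 1\<close>, with \<open>D\<close> lowered to 1.\<close>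
  define B where "B = 2 * pi * s ^ 2 + (8 * s + 4) * (2 * s + 2)"
  have B: "B \<ge> 0" using s by (auto simp: B_def)
  have f: "finite (S n)" if "n \<in> A" for n
    unfolding S_def by (rule count_ellipsoid(1)) (use that D1 in \<open>auto simp: A_def\<close>)
  have b: "\<bar>real (card (S n)) - 4 * pi / (3 * real D) * sqrt (Q - 1\<^sup>2 * (of_int n + 0)\<^sup>2) ^ 3\<bar> \<le> B" if "n \<in> A" for n
  proof -
    define Q' where "Q' = Q - 1\<^sup>2 * (of_int n + 0)\<^sup>2"
    have Q': "0 \<le> Q'" "Q' \<le> Q" using that by (auto simp: Q'_def A_def)
    have s': "0 \<le> sqrt Q'" "sqrt Q' \<le> s" using Q' by (auto simp: s_def)
    have "\<bar>real (card (S n)) - 4 * pi / (3 * real D * 1 * 1) * sqrt Q' ^ 3\<bar>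
       \<le> 2 * pi / (real D * 1) * sqrt Q' ^ 2 + (4 * sqrt Q' / real D + 4 * sqrt Q' / 1 + 4) * (2 * sqrt Q' / 1 + 2)"
      using count_ellipsoid(2)[of "real D" 1 1 Q' "\<lambda>n3 n2. of_int (- n - n3 - n2) / real D" "\<lambda>_. 0" 0] D1 Q'
      by (simp only: S_def Q'_def)
    also have "\<dots> \<le> B" unfolding B_def
    proof (rule add_mono; rule mult_mono)
      show "2 * pi / (real D * 1) \<le> 2 * pi" using D1 by (simp add: field_simps mult_le_cancel_left1)
      have "4 * sqrt Q' / real D \<le> 4 * s / 1" using D1 s' s(1) by (intro frac_le) auto
      then show "4 * sqrt Q' / real D + 4 * sqrt Q' / 1 + 4 \<le> 8 * s + 4" using s' by simp
    qed (use s' s Q' in \<open>auto intro: power_mono\<close>)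
    finally show ?thesis by (simp add: Q'_def)
  qed
  note C = count_slices[where j = 3 and d = 1 and \<theta> = 0 and c = "4 * pi / (3 * real D)" and E = B and S = S and Q = Q]
  have "finite (Sigma A S)" unfolding A_def by (rule C(1)) (use Q f b B in \<open>auto simp: A_def\<close>)
  then show "finite E" unfolding E by simp
  have "\<bar>real (card (Sigma A S)) - 4 * pi / (3 * real D) * slice_vol 3 * sqrt Q ^ Suc 3 / 1\<bar> \<le> 2 * (4 * pi / (3 * real D)) * sqrt Q ^ 3 + B * (2 * sqrt Q / 1 + 2)"
    unfolding A_def by (rule C(2)) (use Q f b B in \<open>auto simp: A_def\<close>)
  moreover have "4 * pi / (3 * real D) * slice_vol 3 * sqrt Q ^ Suc 3 / 1 = pi\<^sup>2 / (2 * real D) * Q\<^sup>2"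
  proof -
    have "sqrt Q ^ 4 = Q\<^sup>2" using s by (metis s_def power_mult num_double numeral_times_numeral power2_eq_square numeral_Bit0 mult_2)
    then show ?thesis by (simp add: slice_vol_def power2_eq_square)
  qed
  moreover have "2 * (4 * pi / (3 * real D)) * sqrt Q ^ 3 + B * (2 * sqrt Q / 1 + 2) \<le> 60 * (sqrt Q + 1) ^ 3"
  proof -
    have p: "pi \<le> 4" using pi_less_4 by simp
    have "4 * pi / (3 * real D) \<le> 4 * 4 / (3 * 1)" using p D1 by (intro frac_le) auto
    then have "2 * (4 * pi / (3 * real D)) * s ^ 3 \<le> 2 * (16 / 3) * s ^ 3" using s by (intro mult_right_mono) auto
    moreover have "B \<le> 8 * s\<^sup>2 + (8 * s + 4) * (2 * s + 2)" using p s(1) unfolding B_def by (intro add_mono mult_right_mono) auto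
    then have "B * (2 * s + 2) \<le> (8 * s\<^sup>2 + (8 * s + 4) * (2 * s + 2)) * (2 * s + 2)" using s by (intro mult_right_mono) auto
    moreover have "2 * (16 / 3) * s ^ 3 + (8 * s\<^sup>2 + (8 * s + 4) * (2 * s + 2)) * (2 * s + 2) \<le> 60 * (s + 1) ^ 3"
    proof -
      have "60 * (s + 1) ^ 3 - (2 * (16 / 3) * s ^ 3 + (8 * s\<^sup>2 + (8 * s + 4) * (2 * s + 2)) * (2 * s + 2))
          = (4/3) * s ^ 3 + 84 * s\<^sup>2 + 116 * s + 44"
        by (simp add: algebra_simps power2_eq_square power3_eq_cube)
      moreover have "0 \<le> (4/3) * s ^ 3 + 84 * s\<^sup>2 + 116 * s + 44" using s by (intro add_nonneg_nonneg mult_nonneg_nonneg) auto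
      ultimately show ?thesis by linarith
    qed
    ultimately show ?thesis unfolding s_def by simp
  qed
  moreover have "card (Sigma A S) = card E" unfolding E by (rule card_image[OF inj, symmetric])
  ultimately show "\<bar>real (card E) - pi\<^sup>2 / (2 * real D) * Q\<^sup>2\<bar> \<le> 60 * (sqrt Q + 1) ^ 3"
    by linarith
qed

section \<open>Lattice points on hyperplanes\<close>

lemma sum3_squares_pos:
  fixes x y z :: int
  assumes "x \<noteq> 0 \<or> y \<noteq> 0 \<or> z \<noteq> 0"
  shows "x\<^sup>2 + y\<^sup>2 + z\<^sup>2 > 0"
proof -
  have "x\<^sup>2 \<ge> 0" "y\<^sup>2 \<ge> 0" "z\<^sup>2 \<ge> 0" "x\<^sup>2 \<noteq> 0 \<or> y\<^sup>2 \<noteq> 0 \<or> z\<^sup>2 \<noteq> 0" using assms by auto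
  then show ?thesis by linarith
qed

lemma bezout3_int:
  fixes a b c :: int
  assumes "gcd a (gcd b c) = 1"
  obtains x y z where "a * x + b * y + c * z = 1"
proof -
  obtain u v where 1: "u * a + v * gcd b c = 1" using bezout_int[of a "gcd b c"] assms by auto
  obtain r s where 2: "r * b + s * c = gcd b c" using bezout_int[of b c] by auto
  have "a * u + b * (v * r) + c * (v * s) = 1"
    using 1 unfolding 2[symmetric] by (simp add: algebra_simps)
  then show thesis by (rule that)
qed

text \<open>With \<open>v = p \<times> s\<close> one has \<open>u \<times> v = p\<close>, which makes \<open>u, v\<close> a basis of the plane lattice orthogonal to \<open>p\<close>:
  for \<open>b \<bottom> p\<close> the vector \<open>u \<times> b\<close> is the multiple \<open>t \<sqdot> (u \<times> b)\<close> of \<open>p\<close>.\<close>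
lemma plane_lattice_basis:
  fixes p1 p2 p3 u1 u2 u3 s1 s2 s3 t1 t2 t3 b1 b2 b3 :: int
  assumes pu: "p1 * u1 + p2 * u2 + p3 * u3 = 0" and us: "u1 * s1 + u2 * s2 + u3 * s3 = 1"
    and pt: "p1 * t1 + p2 * t2 + p3 * t3 = 1" and pb: "p1 * b1 + p2 * b2 + p3 * b3 = 0"
  defines "i \<equiv> s1 * b1 + s2 * b2 + s3 * b3"
    and "j \<equiv> t1 * (u2 * b3 - u3 * b2) + t2 * (u3 * b1 - u1 * b3) + t3 * (u1 * b2 - u2 * b1)"
  shows "b1 = i * u1 + j * (p2 * s3 - p3 * s2)" "b2 = i * u2 + j * (p3 * s1 - p1 * s3)"
    "b3 = i * u3 + j * (p1 * s2 - p2 * s1)"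
proof -
  have w: "u2 * b3 - u3 * b2 = j * p1" "u3 * b1 - u1 * b3 = j * p2" "u1 * b2 - u2 * b1 = j * p3"
    unfolding j_def using pu pt pb by algebra+
  show "b1 = i * u1 + j * (p2 * s3 - p3 * s2)" "b2 = i * u2 + j * (p3 * s1 - p1 * s3)"
    "b3 = i * u3 + j * (p1 * s2 - p2 * s1)"
    unfolding i_def using w us by algebra+
qed

text \<open>Pythagoras in the orthogonal frame formed by \<open>u\<close>, the cross product of
  \<open>p\<close> and \<open>u\<close>, and \<open>p\<close>. The cross product has squared length
  \<open>U * P\<close>.\<close>

lemma norm_orthogonal_decomposition:
  fixes u1 u2 u3 p1 p2 p3 x1 x2 x3 :: real
  assumes pu: "p1 * u1 + p2 * u2 + p3 * u3 = 0"
    and U: "U = u1\<^sup>2 + u2\<^sup>2 + u3\<^sup>2" "U > 0" and P: "P = p1\<^sup>2 + p2\<^sup>2 + p3\<^sup>2" "P > 0"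
  shows "x1\<^sup>2 + x2\<^sup>2 + x3\<^sup>2 = (u1 * x1 + u2 * x2 + u3 * x3)\<^sup>2 / U
    + ((p2 * u3 - p3 * u2) * x1 + (p3 * u1 - p1 * u3) * x2 + (p1 * u2 - p2 * u1) * x3)\<^sup>2 / (U * P)
    + (p1 * x1 + p2 * x2 + p3 * x3)\<^sup>2 / P"
proof -
  \<comment> \<open>An identity for arbitrary vectors; its last summand has the factor
    \<open>p1 * u1 + p2 * u2 + p3 * u3\<close>, which vanishes here.\<close>
  have "(x1\<^sup>2 + x2\<^sup>2 + x3\<^sup>2) * (u1\<^sup>2 + u2\<^sup>2 + u3\<^sup>2) * (p1\<^sup>2 + p2\<^sup>2 + p3\<^sup>2)
     = (u1 * x1 + u2 * x2 + u3 * x3)\<^sup>2 * (p1\<^sup>2 + p2\<^sup>2 + p3\<^sup>2)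
     + ((p2 * u3 - p3 * u2) * x1 + (p3 * u1 - p1 * u3) * x2 + (p1 * u2 - p2 * u1) * x3)\<^sup>2
     + (p1 * x1 + p2 * x2 + p3 * x3)\<^sup>2 * (u1\<^sup>2 + u2\<^sup>2 + u3\<^sup>2)
     + (p1 * u1 + p2 * u2 + p3 * u3) * ((p1 * u1 + p2 * u2 + p3 * u3) * (x1\<^sup>2 + x2\<^sup>2 + x3\<^sup>2)
        - 2 * (u1 * x1 + u2 * x2 + u3 * x3) * (p1 * x1 + p2 * x2 + p3 * x3))"
    by algebra
  then show ?thesis unfolding pu U(1)[symmetric] P(1)[symmetric] using U(2) P(2)
    by (simp add: field_simps)
qed

text \<open>The point \<open>z\<close> is the centre of the ball and lies on the hyperplane.
  Relative to the basis \<open>(0, u)\<close>, \<open>(0, v)\<close>, \<open>(h, - a t)\<close> of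
  the direction lattice the squared distance becomes triangular with steps \<open>lu\<close>,
  \<open>lp / lu\<close> and \<open>la / lp\<close>, whose product is the covolume
  \<open>la\<close>.\<close>

lemma count_hyperplane:
  fixes a h p1 p2 p3 u1 u2 u3 c :: int and z0 z1 z2 z3 Q :: real
  assumes h: "h > 0" and ah: "coprime a h"
    and p: "gcd p1 (gcd p2 p3) = 1" and u: "gcd u1 (gcd u2 u3) = 1"
    and pu: "p1 * u1 + p2 * u2 + p3 * u3 = 0"
    and z: "of_int a * z0 + of_int h * (of_int p1 * z1 + of_int p2 * z2 + of_int p3 * z3) = of_int c"
    and Q: "Q \<ge> 0"
  defines "S \<equiv> {(y0::int, y1::int, y2::int, y3::int). a * y0 + h * (p1 * y1 + p2 * y2 + p3 * y3) = c \<and>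
      (of_int y0 - z0)\<^sup>2 + (of_int y1 - z1)\<^sup>2 + (of_int y2 - z2)\<^sup>2 + (of_int y3 - z3)\<^sup>2 \<le> Q}"
    and "lu \<equiv> sqrt (of_int (u1\<^sup>2 + u2\<^sup>2 + u3\<^sup>2))" and "lp \<equiv> sqrt (of_int (p1\<^sup>2 + p2\<^sup>2 + p3\<^sup>2))"
    and "la \<equiv> sqrt (of_int (a\<^sup>2 + h\<^sup>2 * (p1\<^sup>2 + p2\<^sup>2 + p3\<^sup>2)))"
  shows "finite S"
    and "\<bar>real (card S) - 4 * pi / 3 * sqrt Q ^ 3 / la\<bar> \<le>
      2 * pi / lp * sqrt Q ^ 2 + (4 * sqrt Q / lu + 4 * sqrt Q / (lp / lu) + 4) * (2 * sqrt Q / (la / lp) + 2)"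
proof -
  obtain s1 s2 s3 where us: "u1 * s1 + u2 * s2 + u3 * s3 = 1" using bezout3_int[OF u] .
  obtain t1 t2 t3 where pt: "p1 * t1 + p2 * t2 + p3 * t3 = 1" using bezout3_int[OF p] .
  obtain x y where xy: "x * a + y * h = 1" using bezout_int[of a h] ah by auto
  define v1 v2 v3 where v: "v1 = p2 * s3 - p3 * s2" "v2 = p3 * s1 - p1 * s3" "v3 = p1 * s2 - p2 * s1"
  have uv: "u2 * v3 - u3 * v2 = p1" "u3 * v1 - u1 * v3 = p2" "u1 * v2 - u2 * v1 = p3"
    unfolding v using us pu by algebra+
  \<comment> \<open>The particular solution \<open>(c * x, c * y * t)\<close> comes from the Bezout
    relations \<open>x * a + y * h = 1\<close> and \<open>p1 * t1 + p2 * t2 + p3 * t3 = 1\<close>.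
    The index \<open>n3\<close> moves along \<open>(h, - a t)\<close>, which stays on the
    hyperplane.\<close>
  define \<Psi> where "\<Psi> = (\<lambda>(n3, n2, n1). (c * x + h * n3, (c * y - a * n3) * t1 + n2 * v1 + n1 * u1,
     (c * y - a * n3) * t2 + n2 * v2 + n1 * u2, (c * y - a * n3) * t3 + n2 * v3 + n1 * u3))"
  have pv: "p1 * v1 + p2 * v2 + p3 * v3 = 0" unfolding v by algebra
  have u0: "u1\<^sup>2 + u2\<^sup>2 + u3\<^sup>2 > 0" 
  proof -
    have "u1 \<noteq> 0 \<or> u2 \<noteq> 0 \<or> u3 \<noteq> 0" using us by auto
    then show ?thesis by (rule sum3_squares_pos)
  qed
  have p0: "p1\<^sup>2 + p2\<^sup>2 + p3\<^sup>2 > 0"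
  proof -
    have "p1 \<noteq> 0 \<or> p2 \<noteq> 0 \<or> p3 \<noteq> 0" using pt by auto
    then show ?thesis by (rule sum3_squares_pos)
  qed
  have a0: "a\<^sup>2 + h\<^sup>2 * (p1\<^sup>2 + p2\<^sup>2 + p3\<^sup>2) > 0" by (rule add_nonneg_pos[OF zero_le_power2 mult_pos_pos[OF _ p0]]) (use h in simp)
  define U where "U = (of_int u1)\<^sup>2 + (of_int u2)\<^sup>2 + (of_int u3 :: real)\<^sup>2"
  define P where "P = (of_int p1)\<^sup>2 + (of_int p2)\<^sup>2 + (of_int p3 :: real)\<^sup>2"
  define N where "N = (of_int a)\<^sup>2 + (of_int h)\<^sup>2 * P"
  have UPN: "U = of_int (u1\<^sup>2 + u2\<^sup>2 + u3\<^sup>2)" "P = of_int (p1\<^sup>2 + p2\<^sup>2 + p3\<^sup>2)" 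
    "N = of_int (a\<^sup>2 + h\<^sup>2 * (p1\<^sup>2 + p2\<^sup>2 + p3\<^sup>2))"
    by (simp_all add: U_def P_def N_def)
  have pos: "U > 0" "P > 0" "N > 0" unfolding UPN using u0 p0 a0 by (simp_all only: of_int_0_less_iff)
  have l: "lu = sqrt U" "lp = sqrt P" "la = sqrt N" by (simp_all only: lu_def lp_def la_def UPN)
  \<comment> \<open>Along each orthogonalised direction a lattice point has a coordinate
    \<open>n + \<theta>\<close>. Each offset depends on the outer indices only, which is the shape
    required by \<open>count_ellipsoid\<close>.\<close>
  define \<theta>3 where "\<theta>3 = (of_int (c * x) - z0) / of_int h"
  define r1 where "r1 n3 = of_int ((c * y - a * n3) * t1) - z1" for n3
  define r2 where "r2 n3 = of_int ((c * y - a * n3) * t2) - z2" for n3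
  define r3 where "r3 n3 = of_int ((c * y - a * n3) * t3) - z3" for n3
  define \<theta>2 where "\<theta>2 n3 = (of_int (p2 * u3 - p3 * u2) * r1 n3 + of_int (p3 * u1 - p1 * u3) * r2 n3 + of_int (p1 * u2 - p2 * u1) * r3 n3) / P" for n3
  define \<theta>1 where "\<theta>1 n3 n2 = (of_int u1 * (r1 n3 + of_int (n2 * v1)) + of_int u2 * (r2 n3 + of_int (n2 * v2)) + of_int u3 * (r3 n3 + of_int (n2 * v3))) / U" for n3 n2
  define E where "E = {(n3::int, n2::int, n1::int). lu\<^sup>2 * (of_int n1 + \<theta>1 n3 n2)\<^sup>2 + (lp / lu)\<^sup>2 * (of_int n2 + \<theta>2 n3)\<^sup>2 + (la / lp)\<^sup>2 * (of_int n3 + \<theta>3)\<^sup>2 \<le> Q}"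
  have on_plane: "a * y0 + h * (p1 * y1 + p2 * y2 + p3 * y3) = c" if "\<Psi> (n3, n2, n1) = (y0, y1, y2, y3)" for n3 n2 n1 y0 y1 y2 y3
  proof -
    have y: "y0 = c * x + h * n3" "y1 = (c * y - a * n3) * t1 + n2 * v1 + n1 * u1"
      "y2 = (c * y - a * n3) * t2 + n2 * v2 + n1 * u2" "y3 = (c * y - a * n3) * t3 + n2 * v3 + n1 * u3"
      using that by (auto simp: \<Psi>_def)
    have "p1 * y1 + p2 * y2 + p3 * y3 = c * y - a * n3" unfolding y using pt pu pv by algebra
    then show ?thesis unfolding y(1) using xy by algebra
  qed
  have inj: "inj \<Psi>"
  proof (rule injI)
    fix w w' assume ww: "\<Psi> w = \<Psi> w'"
    obtain n3 n2 n1 where w: "w = (n3, n2, n1)" by (metis prod_cases3)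
    obtain m3 m2 m1 where w': "w' = (m3, m2, m1)" by (metis prod_cases3)
    have eq: "\<Psi> (n3, n2, n1) = \<Psi> (m3, m2, m1)" using ww w w' by simp
    then have e3: "n3 = m3" using h by (simp add: \<Psi>_def)
    then have "(n2 - m2) * v1 + (n1 - m1) * u1 = 0" "(n2 - m2) * v2 + (n1 - m1) * u2 = 0" "(n2 - m2) * v3 + (n1 - m1) * u3 = 0"
      using eq by (simp_all add: \<Psi>_def algebra_simps)
    then have "n2 - m2 = 0" "n1 - m1 = 0" using uv us pt unfolding v by algebra+
    then show "w = w'" using e3 w w' by simp
  qed
  have surj: "\<exists>n. \<Psi> n = (y0, y1, y2, y3)" if eq: "a * y0 + h * (p1 * y1 + p2 * y2 + p3 * y3) = c" for y0 y1 y2 y3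
  proof -
    \<comment> \<open>Modulo \<open>h\<close> the equation reads
      \<open>a * y0 = c = c * x * a\<close>, so coprimality fixes the first coordinate modulo
      \<open>h\<close>.\<close>
    have "h dvd a * (y0 - c * x)"
    proof
      have "c = c * (x * a + y * h)" using xy by simp
      then show "a * (y0 - c * x) = h * (c * y - (p1 * y1 + p2 * y2 + p3 * y3))"
        using eq by (simp add: algebra_simps)
    qed
    then have "h dvd y0 - c * x" using ah coprime_dvd_mult_right_iff[of h a] by (simp add: coprime_commute)
    then obtain n3 where n3: "y0 - c * x = h * n3" by (elim dvdE)
    define b1 b2 b3 where b: "b1 = y1 - (c * y - a * n3) * t1" "b2 = y2 - (c * y - a * n3) * t2" "b3 = y3 - (c * y - a * n3) * t3"
    have "h * (p1 * b1 + p2 * b2 + p3 * b3) = 0" 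
    proof -
      have 1: "p1 * b1 + p2 * b2 + p3 * b3 = p1 * y1 + p2 * y2 + p3 * y3 - (c * y - a * n3)"
        unfolding b using pt by algebra
      have "c = c * (x * a + y * h)" using xy by simp
      moreover have "y0 = c * x + h * n3" using n3 by simp
      ultimately show ?thesis unfolding 1 using eq by (simp add: algebra_simps)
    qed
    then have pb: "p1 * b1 + p2 * b2 + p3 * b3 = 0" using h by simp
    note B = plane_lattice_basis[OF pu us pt pb, folded v]
    define i where "i = s1 * b1 + s2 * b2 + s3 * b3"
    define j where "j = t1 * (u2 * b3 - u3 * b2) + t2 * (u3 * b1 - u1 * b3) + t3 * (u1 * b2 - u2 * b1)"
    have "b1 = i * u1 + j * v1" "b2 = i * u2 + j * v2" "b3 = i * u3 + j * v3"
      unfolding i_def j_def by (fact B)+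
    then have "\<Psi> (n3, j, i) = (y0, y1, y2, y3)" using n3 by (simp add: \<Psi>_def b algebra_simps)
    then show ?thesis ..
  qed
  have form: "(of_int y0 - z0)\<^sup>2 + (of_int y1 - z1)\<^sup>2 + (of_int y2 - z2)\<^sup>2 + (of_int y3 - z3)\<^sup>2
     = lu\<^sup>2 * (of_int n1 + \<theta>1 n3 n2)\<^sup>2 + (lp / lu)\<^sup>2 * (of_int n2 + \<theta>2 n3)\<^sup>2 + (la / lp)\<^sup>2 * (of_int n3 + \<theta>3)\<^sup>2"
    if Y: "\<Psi> (n3, n2, n1) = (y0, y1, y2, y3)" for n3 n2 n1 y0 y1 y2 y3
  proof -
    define x1 x2 x3 where x: "x1 = of_int y1 - z1" "x2 = of_int y2 - z2" "x3 = of_int y3 - z3"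
    have x': "x1 = r1 n3 + of_int (n2 * v1) + of_int (n1 * u1)" "x2 = r2 n3 + of_int (n2 * v2) + of_int (n1 * u2)"
      "x3 = r3 n3 + of_int (n2 * v3) + of_int (n1 * u3)"
      using Y by (auto simp: x \<Psi>_def r1_def r2_def r3_def)
    have pu': "real_of_int p1 * of_int u1 + of_int p2 * of_int u2 + of_int p3 * of_int u3 = 0"
      using pu by (metis of_int_0 of_int_add of_int_mult)
    have A: "of_int u1 * x1 + of_int u2 * x2 + of_int u3 * x3 = U * (of_int n1 + \<theta>1 n3 n2)"
    proof -
      have "U * \<theta>1 n3 n2 = of_int u1 * (r1 n3 + of_int (n2 * v1)) + of_int u2 * (r2 n3 + of_int (n2 * v2)) + of_int u3 * (r3 n3 + of_int (n2 * v3))"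
        using pos by (simp add: \<theta>1_def)
      then show ?thesis unfolding x' distrib_left by (simp add: U_def power2_eq_square algebra_simps)
    qed
    have w: "(of_int p2 * of_int u3 - of_int p3 * of_int u2) * real_of_int v1 + (of_int p3 * of_int u1 - of_int p1 * of_int u3) * of_int v2 + (of_int p1 * of_int u2 - of_int p2 * of_int u1) * of_int v3 = P"
    proof -
      have "(p2 * u3 - p3 * u2) * v1 + (p3 * u1 - p1 * u3) * v2 + (p1 * u2 - p2 * u1) * v3 = p1 * (u2 * v3 - u3 * v2) + p2 * (u3 * v1 - u1 * v3) + p3 * (u1 * v2 - u2 * v1)"
        by (simp add: algebra_simps)
      also have "\<dots> = p1\<^sup>2 + p2\<^sup>2 + p3\<^sup>2" unfolding uv by (simp add: power2_eq_square)
      finally have "(p2 * u3 - p3 * u2) * v1 + (p3 * u1 - p1 * u3) * v2 + (p1 * u2 - p2 * u1) * v3 = p1\<^sup>2 + p2\<^sup>2 + p3\<^sup>2" .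
      from arg_cong[OF this, of real_of_int] show ?thesis by (simp add: P_def)
    qed
    have B: "(of_int p2 * of_int u3 - of_int p3 * of_int u2) * x1 + (of_int p3 * of_int u1 - of_int p1 * of_int u3) * x2
       + (of_int p1 * of_int u2 - of_int p2 * of_int u1) * x3 = P * (of_int n2 + \<theta>2 n3)" (is "?l = _")
    proof -
      have "?l = (of_int (p2 * u3 - p3 * u2) * r1 n3 + of_int (p3 * u1 - p1 * u3) * r2 n3 + of_int (p1 * u2 - p2 * u1) * r3 n3)
         + of_int n2 * ((of_int p2 * of_int u3 - of_int p3 * of_int u2) * real_of_int v1 + (of_int p3 * of_int u1 - of_int p1 * of_int u3) * of_int v2 + (of_int p1 * of_int u2 - of_int p2 * of_int u1) * of_int v3)"
        unfolding x' by (simp add: algebra_simps)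
      also have "\<dots> = P * (of_int n2 + \<theta>2 n3)" unfolding w \<theta>2_def using pos by (simp add: field_simps)
      finally show ?thesis .
    qed
    have d0: "of_int y0 - z0 = of_int h * (of_int n3 + \<theta>3)" using Y h by (auto simp: \<Psi>_def \<theta>3_def field_simps)
    have "of_int h * (of_int p1 * x1 + of_int p2 * x2 + of_int p3 * x3) = - of_int a * (of_int y0 - z0)"
    proof -
      have "of_int a * of_int y0 + of_int h * (of_int p1 * of_int y1 + of_int p2 * of_int y2 + of_int p3 * of_int y3) = real_of_int c"
        using arg_cong[OF on_plane[OF Y], of real_of_int] by simp
      then show ?thesis using z unfolding x by (simp add: algebra_simps)
    qed
    then have "of_int h * (of_int p1 * x1 + of_int p2 * x2 + of_int p3 * x3) = of_int h * (- of_int a * (of_int n3 + \<theta>3))"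
      unfolding d0 by (simp add: mult.left_commute)
    \<comment> \<open>On the hyperplane the component along \<open>p\<close> is tied to the first
      coordinate. Together they form one direction whose step has squared length
      \<open>h ^ 2 + a ^ 2 / P = N / P\<close>.\<close>
    then have C: "of_int p1 * x1 + of_int p2 * x2 + of_int p3 * x3 = - of_int a * (of_int n3 + \<theta>3)"
      using h by (subst (asm) mult_cancel_left) simp
    have "x1\<^sup>2 + x2\<^sup>2 + x3\<^sup>2 = (U * (of_int n1 + \<theta>1 n3 n2))\<^sup>2 / U + (P * (of_int n2 + \<theta>2 n3))\<^sup>2 / (U * P) + (- of_int a * (of_int n3 + \<theta>3))\<^sup>2 / P"
      unfolding norm_orthogonal_decomposition[OF pu' U_def pos(1) P_def pos(2), of x1 x2 x3] A B C ..
    also have "\<dots> = U * (of_int n1 + \<theta>1 n3 n2)\<^sup>2 + P / U * (of_int n2 + \<theta>2 n3)\<^sup>2 + (of_int a)\<^sup>2 / P * (of_int n3 + \<theta>3)\<^sup>2"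
      using pos by (simp add: power_mult_distrib power2_eq_square[of U] power2_eq_square[of P])
    finally have "(of_int y0 - z0)\<^sup>2 + (x1\<^sup>2 + x2\<^sup>2 + x3\<^sup>2) = U * (of_int n1 + \<theta>1 n3 n2)\<^sup>2 + P / U * (of_int n2 + \<theta>2 n3)\<^sup>2 + N / P * (of_int n3 + \<theta>3)\<^sup>2"
      unfolding d0 N_def power_mult_distrib using pos by (simp add: add_divide_distrib algebra_simps)
    then show ?thesis using pos by (simp add: l x power_divide)
  qed
  have SE: "S = \<Psi> ` E"
  proof (intro equalityI subsetI)
    fix w assume "w \<in> S"
    then obtain y0 y1 y2 y3 where w: "w = (y0, y1, y2, y3)" "a * y0 + h * (p1 * y1 + p2 * y2 + p3 * y3) = c"
      "(of_int y0 - z0)\<^sup>2 + (of_int y1 - z1)\<^sup>2 + (of_int y2 - z2)\<^sup>2 + (of_int y3 - z3)\<^sup>2 \<le> Q" unfolding S_def by auto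
    obtain n3 n2 n1 where n: "\<Psi> (n3, n2, n1) = (y0, y1, y2, y3)" using surj[OF w(2)] by auto
    have "(n3, n2, n1) \<in> E" using w(3) unfolding form[OF n] by (simp add: E_def)
    then show "w \<in> \<Psi> ` E" using w(1) n by (metis imageI)
  next
    fix w assume "w \<in> \<Psi> ` E"
    then obtain n3 n2 n1 where n: "(n3, n2, n1) \<in> E" "w = \<Psi> (n3, n2, n1)" by auto
    obtain y0 y1 y2 y3 where y: "\<Psi> (n3, n2, n1) = (y0, y1, y2, y3)" by (metis prod_cases4)
    show "w \<in> S" using n on_plane[OF y] form[OF y] unfolding n(2) y S_def E_def by simp
  qed
  have lpos: "lu > 0" "lp / lu > 0" "la / lp > 0" using pos by (auto simp: l)
  show "finite S" unfolding SE E_def by (intro finite_imageI count_ellipsoid(1) lpos Q)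
  have "card S = card E" unfolding SE using inj by (intro card_image) (auto intro: inj_on_subset)
  moreover have "\<bar>real (card E) - 4 * pi / (3 * lu * (lp / lu) * (la / lp)) * sqrt Q ^ 3\<bar> \<le>
     2 * pi / (lu * (lp / lu)) * sqrt Q ^ 2 + (4 * sqrt Q / lu + 4 * sqrt Q / (lp / lu) + 4) * (2 * sqrt Q / (la / lp) + 2)"
    unfolding E_def by (rule count_ellipsoid(2)[OF lpos Q])
  moreover have "3 * lu * (lp / lu) * (la / lp) = 3 * la" "lu * (lp / lu) = lp" using pos by (auto simp: l)
  moreover have "4 * pi / (3 * la) * sqrt Q ^ 3 = 4 * pi / 3 * sqrt Q ^ 3 / la" by simp
  ultimately show "\<bar>real (card S) - 4 * pi / 3 * sqrt Q ^ 3 / la\<bar> \<le>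
      2 * pi / lp * sqrt Q ^ 2 + (4 * sqrt Q / lu + 4 * sqrt Q / (lp / lu) + 4) * (2 * sqrt Q / (la / lp) + 2)"
    by (simp only:)
qed

section \<open>Short orthogonal vectors\<close>

definition supn :: "int \<times> int \<times> int \<Rightarrow> int" where
  "supn u = (case u of (u1, u2, u3) \<Rightarrow> max \<bar>u1\<bar> (max \<bar>u2\<bar> \<bar>u3\<bar>))"

definition gcd3 :: "int \<times> int \<times> int \<Rightarrow> int" where
  "gcd3 u = (case u of (u1, u2, u3) \<Rightarrow> gcd u1 (gcd u2 u3))"

definition dot3 :: "int \<times> int \<times> int \<Rightarrow> int \<times> int \<times> int \<Rightarrow> int" where
  "dot3 u v = (case u of (u1, u2, u3) \<Rightarrow> case v of (v1, v2, v3) \<Rightarrow> u1 * v1 + u2 * v2 + u3 * v3)"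

lemma supn_ge_1:
  assumes "gcd3 u = 1"
  shows "supn u \<ge> 1"
proof (rule ccontr)
  assume n: "\<not> supn u \<ge> 1"
  obtain a b c where abc: "u = (a, b, c)" by (metis prod_cases3)
  have "\<bar>a\<bar> < 1" "\<bar>b\<bar> < 1" "\<bar>c\<bar> < 1" using n unfolding abc supn_def by auto
  then show False using assms by (simp add: abc gcd3_def)
qed

lemma mult_bounded_by_parts:
  fixes p x B :: int
  assumes "0 \<le> x" "x \<le> B"
  shows "B * min p 0 \<le> p * x" "p * x \<le> B * max p 0"
proof -
  have "B * min p 0 \<le> p * x \<and> p * x \<le> B * max p 0"
  proof (cases "p \<ge> 0")
    case True
    then show ?thesis using assms mult_left_mono[of x B p] by (simp add: mult.commute)
  next
    case False
    then have "p * B \<le> p * x" "p * x \<le> 0" using assms by (auto intro: mult_left_mono_neg mult_nonpos_nonneg)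
    then show ?thesis using False by (simp add: mult.commute)
  qed
  then show "B * min p 0 \<le> p * x" "p * x \<le> B * max p 0" by auto
qed

text \<open>Pigeonhole on the cube \<open>{0..B}\<close> cubed: the product with \<open>p\<close>
  takes at most \<open>3 * M * B + 1 \<le> B ^ 3 + 1\<close> values on \<open>(B + 1) ^ 3\<close>
  points. The difference of two points with equal value is orthogonal to \<open>p\<close>, and
  dividing it by its gcd only makes it shorter.\<close>

lemma short_orthogonal_vector:
  fixes p :: "int \<times> int \<times> int"
  assumes "p \<noteq> (0, 0, 0)"
  shows "\<exists>u. gcd3 u = 1 \<and> dot3 p u = 0 \<and> (supn u)\<^sup>2 \<le> 9 * supn p"
proof -
  obtain p1 p2 p3 where p: "p = (p1, p2, p3)" by (metis prod_cases3)
  define M where "M = supn p"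
  have M1: "M \<ge> 1" and pM: "\<bar>p1\<bar> \<le> M" "\<bar>p2\<bar> \<le> M" "\<bar>p3\<bar> \<le> M" using assms by (auto simp: M_def supn_def p)
  \<comment> \<open>The least integer with \<open>3 * M \<le> B\<^sup>2\<close>, as the pigeonhole
    needs; rounding up still leaves \<open>B \<le> 3 * sqrt M\<close>, hence the factor 9.\<close>
  define B where "B = \<lceil>sqrt (3 * of_int M)\<rceil>"
  have Bl: "sqrt (3 * of_int M) \<le> of_int B" unfolding B_def by linarith
  have B0: "B \<ge> 1" unfolding B_def using M1 by simp
  have B3: "3 * M \<le> B\<^sup>2"
  proof -
    have "3 * real_of_int M \<le> (of_int B)\<^sup>2" using Bl by (metis sqrt_le_D)
    then have "real_of_int (3 * M) \<le> real_of_int (B\<^sup>2)" by simp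
    then show ?thesis by (simp only: of_int_le_iff)
  qed
  have B9: "B\<^sup>2 \<le> 9 * M"
  proof -
    have "sqrt (3 * of_int M) \<le> sqrt (4 * of_int M)" using M1 by (intro real_sqrt_le_mono) auto
    also have "\<dots> = 2 * sqrt (of_int M)" by (simp add: real_sqrt_mult)
    finally have "of_int B \<le> 2 * sqrt (of_int M) + 1" unfolding B_def by linarith
    also have "1 \<le> sqrt (real_of_int M)" using M1 by simp
    finally have "of_int B \<le> 3 * sqrt (real_of_int M)" by simp
    then have "(of_int B)\<^sup>2 \<le> (3 * sqrt (real_of_int M))\<^sup>2" using B0 by (intro power_mono) auto
    also have "\<dots> = 9 * of_int M" using M1 by (simp add: power_mult_distrib)
    finally have "real_of_int (B\<^sup>2) \<le> of_int (9 * M)" by simp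
    then show ?thesis by (simp only: of_int_le_iff)
  qed
  define X where "X = {0..B} \<times> {0..B} \<times> {0..B}"
  define lo where "lo = B * min p1 0 + B * min p2 0 + B * min p3 0"
  define hi where "hi = B * max p1 0 + B * max p2 0 + B * max p3 0"
  have img: "dot3 p ` X \<subseteq> {lo..hi}"
  proof
    fix y assume "y \<in> dot3 p ` X"
    then obtain x1 x2 x3 where x: "x1 \<in> {0..B}" "x2 \<in> {0..B}" "x3 \<in> {0..B}" "y = p1 * x1 + p2 * x2 + p3 * x3"
      by (auto simp: X_def dot3_def p)
    then show "y \<in> {lo..hi}"
      using mult_bounded_by_parts[of x1 B p1] mult_bounded_by_parts[of x2 B p2] mult_bounded_by_parts[of x3 B p3]
      by (auto simp: lo_def hi_def)
  qed
  have hl: "hi - lo = B * (\<bar>p1\<bar> + \<bar>p2\<bar> + \<bar>p3\<bar>)"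
  proof -
    have "max q 0 - min q 0 = \<bar>q\<bar>" for q :: int by auto
    moreover have "hi - lo = B * ((max p1 0 - min p1 0) + (max p2 0 - min p2 0) + (max p3 0 - min p3 0))" (is "?x = ?y")
      unfolding hi_def lo_def by (simp add: algebra_simps)
    ultimately show ?thesis by (simp only:)
  qed
  have "hi - lo + 1 \<le> B * (3 * M) + 1" unfolding hl using pM B0 by (intro add_right_mono mult_left_mono) auto
  also have "\<dots> \<le> B * B\<^sup>2 + 1" using B3 B0 by (intro add_right_mono mult_left_mono) auto
  also have "\<dots> < (B + 1) * ((B + 1) * (B + 1))"
    using B0 by (simp add: power2_eq_square algebra_simps add_pos_nonneg)
  finally have "hi - lo + 1 < (B + 1) * ((B + 1) * (B + 1))" .
  moreover have "int (card X) = (B + 1) * ((B + 1) * (B + 1))" using B0 by (simp add: X_def card_cartesian_product)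
  moreover have "0 \<le> hi - lo" unfolding hl using B0 by simp
  ultimately have "int (card {lo..hi}) < int (card X)" by simp
  then have "card {lo..hi} < card X" by (simp only: of_nat_less_iff)
  then have "\<not> inj_on (dot3 p) X" using img card_inj_on_le[of "dot3 p" X "{lo..hi}"] by auto
  then obtain x y where xy: "x \<in> X" "y \<in> X" "x \<noteq> y" "dot3 p x = dot3 p y" unfolding inj_on_def by blast
  obtain x1 x2 x3 where x: "x = (x1, x2, x3)" by (metis prod_cases3)
  obtain y1 y2 y3 where y: "y = (y1, y2, y3)" by (metis prod_cases3)
  define w1 w2 w3 where w: "w1 = x1 - y1" "w2 = x2 - y2" "w3 = x3 - y3"
  have wB: "\<bar>w1\<bar> \<le> B" "\<bar>w2\<bar> \<le> B" "\<bar>w3\<bar> \<le> B" using xy(1,2) by (auto simp: x y w X_def)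
  have wn: "w1 \<noteq> 0 \<or> w2 \<noteq> 0 \<or> w3 \<noteq> 0" using xy(3) by (auto simp: x y w)
  have wp: "p1 * w1 + p2 * w2 + p3 * w3 = 0" using xy(4) by (simp add: x y w p dot3_def algebra_simps)
  define g where "g = gcd w1 (gcd w2 w3)"
  have g: "g > 0" using wn by (auto simp: g_def)
  obtain u1 u2 u3 where u: "w1 = g * u1" "w2 = g * u2" "w3 = g * u3"
  proof -
    have "g dvd w1" "g dvd w2" "g dvd w3" unfolding g_def by (meson dvd_trans gcd_dvd1 gcd_dvd2)+
    then show thesis using that by (metis dvdE)
  qed
  have le: "\<bar>v\<bar> \<le> \<bar>g * v\<bar>" for v using g by (simp add: abs_mult mult_le_cancel_right1)
  have "gcd u1 (gcd u2 u3) = 1"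
  proof -
    have "g * gcd u1 (gcd u2 u3) = gcd w1 (gcd w2 w3)" unfolding u using g by (simp add: gcd_mult_left)
    also have "\<dots> = g" by (simp only: g_def)
    finally have "g * gcd u1 (gcd u2 u3) = g" .
    then show ?thesis using g by simp
  qed
  moreover have "dot3 p (u1, u2, u3) = 0"
  proof -
    have "g * (p1 * u1 + p2 * u2 + p3 * u3) = 0" using wp unfolding u by (simp add: algebra_simps)
    then show ?thesis using g by (simp add: dot3_def p)
  qed
  moreover have "(supn (u1, u2, u3))\<^sup>2 \<le> 9 * supn p"
  proof -
    have "supn (u1, u2, u3) \<le> B" using wB le[of u1] le[of u2] le[of u3] unfolding u supn_def by auto
    moreover have "0 \<le> supn (u1, u2, u3)" by (auto simp: supn_def)
    ultimately have "(supn (u1, u2, u3))\<^sup>2 \<le> B\<^sup>2" by (intro power_mono)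
    then show ?thesis using B9 by (simp add: M_def)
  qed
  ultimately show ?thesis by (intro exI[of _ "(u1, u2, u3)"]) (auto simp: gcd3_def)
qed

section \<open>Vectors in a box orthogonal to a given one\<close>

lemma card_residue_class_interval:
  fixes S :: "int set"
  assumes S: "S \<subseteq> {-K..K}" and k: "k > 0" and K: "K \<ge> 0"
    and d: "\<And>x y. x \<in> S \<Longrightarrow> y \<in> S \<Longrightarrow> k dvd x - y"
  shows "int (card S) * k \<le> 2 * K + k"
proof (cases "S = {}")
  case False
  have fin: "finite S" using S by (rule finite_subset) auto
  define m where "m = Min S"
  have m: "m \<in> S" "\<And>x. x \<in> S \<Longrightarrow> m \<le> x" using fin False by (auto simp: m_def)
  have "S \<subseteq> (\<lambda>i. m + k * i) ` {0..2 * K div k}"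
  proof
    fix x assume x: "x \<in> S"
    obtain i where i: "x - m = k * i" using d[OF x m(1)] by (elim dvdE)
    have "x \<le> K" "- K \<le> m" using x m(1) S by auto
    then have "0 \<le> k * i" "k * i \<le> 2 * K" using m(2)[OF x] i by linarith+
    then have "0 \<le> i" "i \<le> 2 * K div k" using k zdiv_mono1[of "k * i" "2 * K" k]
      by (auto simp: zero_le_mult_iff)
    then show "x \<in> (\<lambda>i. m + k * i) ` {0..2 * K div k}" using i by (intro image_eqI[of _ _ i]) auto
  qed
  then have "card S \<le> card {0..2 * K div k}" by (rule surj_card_le[rotated]) auto
  moreover have "0 \<le> 2 * K div k" using K k by (simp add: pos_imp_zdiv_nonneg_iff)
  ultimately have "int (card S) \<le> 2 * K div k + 1" by simp
  then have "int (card S) * k \<le> (2 * K div k + 1) * k" using k by (intro mult_right_mono) auto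
  also have "\<dots> = 2 * K div k * k + k" by (simp add: distrib_right)
  also have "\<dots> \<le> 2 * K + k" using minus_mod_eq_div_mult[of "2 * K" k] pos_mod_sign[OF k, of "2 * K"] by linarith
  finally show ?thesis .
qed (use assms in auto)

definition box3 :: "int \<Rightarrow> (int \<times> int \<times> int) set" where
  "box3 K = {-K..K} \<times> {-K..K} \<times> {-K..K}"

lemma finite_box3 [simp]: "finite (box3 K)" by (simp add: box3_def)

lemma box3_iff: "x \<in> box3 K \<longleftrightarrow> supn x \<le> K"
  by (cases x) (auto simp: box3_def supn_def)

text \<open>Let \<open>g2\<close> be the gcd of \<open>u2\<close> and \<open>u3 = g2 * k\<close>. It
  is coprime to \<open>u1\<close> and so divides \<open>x\<close>. Once \<open>x\<close> is fixed,
  \<open>y\<close> is determined modulo \<open>k\<close>, and then \<open>z\<close> is determined.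
  This leaves \<open>5 K / g2\<close> choices for \<open>x\<close> times \<open>5 K / |k|\<close>
  for \<open>y\<close>. The bound on \<open>u3\<close> absorbs the \<open>+ 1\<close> in both
  interval counts.\<close>

lemma card_orthogonal_box_last_nonzero:
  fixes u1 u2 u3 K :: int
  assumes K: "K \<ge> 1" and g: "gcd u1 (gcd u2 u3) = 1" and u3: "u3 \<noteq> 0" "\<bar>u3\<bar> \<le> 3 * K"
  defines "S \<equiv> {(x, y, z). x \<in> {-K..K} \<and> y \<in> {-K..K} \<and> z \<in> {-K..K} \<and> x * u1 + y * u2 + z * u3 = 0}"
  shows "int (card S) * \<bar>u3\<bar> \<le> 25 * K\<^sup>2"
proof -
  define g2 where "g2 = gcd u2 u3"
  have g2: "g2 > 0" "g2 \<le> \<bar>u3\<bar>" using u3 by (auto simp: g2_def intro: zdvd_imp_le)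
  obtain k where k: "u3 = g2 * k" using gcd_dvd2[of u2 u3] unfolding g2_def[symmetric] by (elim dvdE)
  have k0: "\<bar>k\<bar> > 0" using u3 k by auto
  obtain l where l: "u2 = g2 * l" using gcd_dvd1[of u2 u3] unfolding g2_def[symmetric] by (elim dvdE)
  have kl: "coprime k l"
  proof -
    have "g2 * gcd l k = g2" using g2 g2_def gcd_mult_distrib_int[of g2 l k] unfolding k l by simp
    then show ?thesis using g2 by (simp add: coprime_iff_gcd_eq_1 gcd.commute)
  qed
  have ku3: "\<bar>k\<bar> \<le> \<bar>u3\<bar>" unfolding k abs_mult using g2 by (simp add: mult_le_cancel_right1)
  define A where "A = {x \<in> {-K..K}. g2 dvd x}"
  define T where "T x = {y \<in> {-K..K}. u3 dvd x * u1 + y * u2}" for x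
  have fin: "finite A" "finite (T x)" for x
    by (rule finite_subset[of _ "{-K..K}"]; auto simp: A_def T_def)+
  have A: "int (card A) * g2 \<le> 5 * K"
  proof -
    have "int (card A) * g2 \<le> 2 * K + g2"
      using K by (intro card_residue_class_interval) (auto simp: A_def g2)
    then show ?thesis using g2 u3 by linarith
  qed
  have T: "int (card (T x)) * \<bar>k\<bar> \<le> 5 * K" for x
  proof -
    have "int (card (T x)) * \<bar>k\<bar> \<le> 2 * K + \<bar>k\<bar>"
    proof (rule card_residue_class_interval)
      fix y z assume "y \<in> T x" "z \<in> T x"
      then have "u3 dvd (x * u1 + y * u2) - (x * u1 + z * u2)" unfolding T_def by (intro dvd_diff) auto
      then have "g2 * k dvd g2 * (l * (y - z))" unfolding k l by (simp add: algebra_simps)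
      then have "k dvd l * (y - z)" using g2 by simp
      then show "\<bar>k\<bar> dvd y - z" using kl by (simp add: coprime_dvd_mult_right_iff)
    qed (use K k0 in \<open>auto simp: T_def\<close>)
    then show ?thesis using ku3 u3 by linarith
  qed
  have canc: "z = z'" if "x * u1 + y * u2 + z * u3 = 0" "x * u1 + y * u2 + z' * u3 = 0" for x y z z'
  proof -
    have "z * u3 = z' * u3" using that by linarith
    then show ?thesis using u3 by simp
  qed
  have "card S = card ((\<lambda>(x, y, z). (x, y)) ` S)"
    by (intro card_image[symmetric]) (auto simp: inj_on_def S_def intro: canc)
  also have "\<dots> \<le> card (Sigma A T)"
  proof (intro card_mono finite_SigmaI fin subsetI)
    fix w assume "w \<in> (\<lambda>(x, y, z). (x, y)) ` S"
    then obtain x y z where w: "w = (x, y)" "x \<in> {-K..K}" "y \<in> {-K..K}" "x * u1 + y * u2 + z * u3 = 0"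
      by (auto simp: S_def)
    then have e: "x * u1 + y * u2 = u3 * (- z)" by (simp add: algebra_simps)
    have "x * u1 = g2 * (k * (- z) - y * l)" using e unfolding k l by (simp add: algebra_simps)
    then have "g2 dvd x * u1" by simp
    moreover have "coprime g2 u1" using g unfolding g2_def[symmetric] by (simp add: coprime_iff_gcd_eq_1 gcd.commute)
    ultimately have "g2 dvd x" by (simp add: coprime_dvd_mult_left_iff)
    then show "w \<in> Sigma A T" using w e by (auto simp: A_def T_def)
  qed
  also have "\<dots> = (\<Sum>x\<in>A. card (T x))" using fin by simp
  finally have "int (card S) \<le> (\<Sum>x\<in>A. int (card (T x)))" by (simp flip: of_nat_sum)
  then have "int (card S) * \<bar>k\<bar> \<le> (\<Sum>x\<in>A. int (card (T x))) * \<bar>k\<bar>" by (intro mult_right_mono) auto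
  also have "\<dots> = (\<Sum>x\<in>A. int (card (T x)) * \<bar>k\<bar>)" by (simp add: sum_distrib_right)
  also have "\<dots> \<le> (\<Sum>x\<in>A. 5 * K)" by (intro sum_mono T)
  also have "\<dots> = int (card A) * (5 * K)" by simp
  finally have "int (card S) * \<bar>k\<bar> * g2 \<le> int (card A) * (5 * K) * g2" using g2 by (intro mult_right_mono) auto
  also have "\<dots> = int (card A) * g2 * (5 * K)" by simp
  also have "\<dots> \<le> 5 * K * (5 * K)" using A K by (intro mult_right_mono) auto
  finally show ?thesis using g2 by (simp add: k abs_mult power2_eq_square algebra_simps)
qed

lemma card_orthogonal_box:
  assumes K: "K \<ge> 1" and g: "gcd3 u = 1" and u: "supn u \<le> 3 * K"
  shows "int (card {x \<in> box3 K. dot3 x u = 0}) * supn u \<le> 25 * K\<^sup>2"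
proof -
  obtain u1 u2 u3 where uu: "u = (u1, u2, u3)" by (metis prod_cases3)
  have g1: "gcd u1 (gcd u2 u3) = 1" using g by (simp add: gcd3_def uu)
  have g2: "gcd u2 (gcd u3 u1) = 1" "gcd u3 (gcd u1 u2) = 1"
    using g1 by (simp_all add: ac_simps)
  have n0: "u1 \<noteq> 0 \<or> u2 \<noteq> 0 \<or> u3 \<noteq> 0" using g1 by auto
  have b: "\<bar>u1\<bar> \<le> 3 * K" "\<bar>u2\<bar> \<le> 3 * K" "\<bar>u3\<bar> \<le> 3 * K" using u by (auto simp: supn_def uu)
  let ?S = "\<lambda>u1 u2 u3. {(x, y, z). x \<in> {-K..K} \<and> y \<in> {-K..K} \<and> z \<in> {-K..K} \<and> x * u1 + y * u2 + z * u3 = 0}"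
  have S: "{x \<in> box3 K. dot3 x u = 0} = ?S u1 u2 u3" by (auto simp: box3_def dot3_def uu)
  \<comment> \<open>A cyclic rotation brings the largest coordinate into the last place.\<close>
  consider "supn u = \<bar>u3\<bar>" "u3 \<noteq> 0" | "supn u = \<bar>u1\<bar>" "u1 \<noteq> 0" | "supn u = \<bar>u2\<bar>" "u2 \<noteq> 0"
  proof -
    have "supn u = \<bar>u3\<bar> \<or> supn u = \<bar>u1\<bar> \<or> supn u = \<bar>u2\<bar>" by (auto simp: supn_def uu max_def)
    moreover have "supn u \<noteq> 0" using n0 by (auto simp: supn_def uu max_def split: if_splits)
    ultimately show thesis using that by (metis abs_zero)
  qed
  then show ?thesis
  proof cases
    case 1
    then show ?thesis unfolding S using card_orthogonal_box_last_nonzero[OF K g1 1(2) b(3)] by simp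
  next
    case 2
    have "bij_betw (\<lambda>(x, y, z). (y, z, x)) (?S u1 u2 u3) (?S u2 u3 u1)"
      by (rule bij_betwI[where g = "\<lambda>(y, z, x). (x, y, z)"]) (auto simp: algebra_simps)
    then have "card (?S u1 u2 u3) = card (?S u2 u3 u1)" by (rule bij_betw_same_card)
    then show ?thesis unfolding S using card_orthogonal_box_last_nonzero[OF K g2(1) 2(2) b(1)] 2(1) by simp
  next
    case 3
    have "bij_betw (\<lambda>(x, y, z). (z, x, y)) (?S u1 u2 u3) (?S u3 u1 u2)"
      by (rule bij_betwI[where g = "\<lambda>(z, x, y). (x, y, z)"]) (auto simp: algebra_simps)
    then have "card (?S u1 u2 u3) = card (?S u3 u1 u2)" by (rule bij_betw_same_card)
    then show ?thesis unfolding S using card_orthogonal_box_last_nonzero[OF K g2(2) 3(2) b(2)] 3(1) by simp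
  qed
qed

lemma card_shell:
  fixes n :: int
  assumes n: "n \<ge> 1"
  shows "finite {u. supn u = n}" and "real (card {u. supn u = n}) \<le> 54 * (of_int n)\<^sup>2"
proof -
  let ?I = "{-n..n}" and ?P = "{-n, n}"
  have sub: "{u. supn u = n} \<subseteq> (?P \<times> ?I \<times> ?I) \<union> ((?I \<times> ?P \<times> ?I) \<union> (?I \<times> ?I \<times> ?P))"
  proof
    fix u assume u: "u \<in> {u. supn u = n}"
    obtain a b c where abc: "u = (a, b, c)" by (metis prod_cases3)
    have "\<bar>a\<bar> \<le> n" "\<bar>b\<bar> \<le> n" "\<bar>c\<bar> \<le> n" using u by (auto simp: supn_def abc)
    then have I: "a \<in> ?I" "b \<in> ?I" "c \<in> ?I" by (simp_all add: abs_le_iff)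
    have "supn u = \<bar>a\<bar> \<or> supn u = \<bar>b\<bar> \<or> supn u = \<bar>c\<bar>" by (auto simp: supn_def abc max_def)
    then have "\<bar>a\<bar> = n \<or> \<bar>b\<bar> = n \<or> \<bar>c\<bar> = n" using u by auto
    moreover have P: "v \<in> ?P" if "\<bar>v\<bar> = n" for v using that by auto
    ultimately consider "a \<in> ?P" | "b \<in> ?P" | "c \<in> ?P" by blast
    then show "u \<in> (?P \<times> ?I \<times> ?I) \<union> ((?I \<times> ?P \<times> ?I) \<union> (?I \<times> ?I \<times> ?P))"
      unfolding abc by cases (intro UnI1 SigmaI I, assumption, intro UnI2 UnI1 SigmaI I, assumption, intro UnI2 SigmaI I, assumption)
  qed
  show "finite {u. supn u = n}" by (rule finite_subset[OF sub]) auto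
  have cP: "card ?P = 2" using n by simp
  have cI: "int (card ?I) = 2 * n + 1" using n by simp
  have "card {u. supn u = n} \<le> card ((?P \<times> ?I \<times> ?I) \<union> ((?I \<times> ?P \<times> ?I) \<union> (?I \<times> ?I \<times> ?P)))"
    by (rule card_mono[OF _ sub]) auto
  also have "\<dots> \<le> card (?P \<times> ?I \<times> ?I) + (card (?I \<times> ?P \<times> ?I) + card (?I \<times> ?I \<times> ?P))"
    by (intro order_trans[OF card_Un_le] add_mono card_Un_le order_refl)
  also have "\<dots> = 6 * (card ?I * card ?I)" unfolding card_cartesian_product cP by simp
  finally have "int (card {u. supn u = n}) \<le> int (6 * (card ?I * card ?I))" by (simp only: of_nat_le_iff)
  also have "\<dots> = 6 * (int (card ?I) * int (card ?I))" by (simp only: of_nat_mult of_nat_numeral)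
  also have "\<dots> \<le> 6 * ((3 * n) * (3 * n))" unfolding cI using n by (intro mult_left_mono mult_mono) auto
  finally have "int (card {u. supn u = n}) \<le> 54 * n\<^sup>2" by (simp add: power2_eq_square)
  then have "real_of_int (int (card {u. supn u = n})) \<le> of_int (54 * n\<^sup>2)" by (simp only: of_int_le_iff)
  then show "real (card {u. supn u = n}) \<le> 54 * (of_int n)\<^sup>2" by simp
qed

text \<open>In dimension 3 the shell of radius \<open>n\<close> has a number of vectors of order
  \<open>n ^ 2\<close>, which cancels the weight.\<close>

lemma sum_inverse_square_supn:
  fixes N :: int
  assumes "N \<ge> 0"
  shows "(\<Sum>u\<in>{u. 1 \<le> supn u \<and> supn u \<le> N}. 1 / (of_int (supn u))\<^sup>2) \<le> 54 * real_of_int N"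
proof -
  let ?U = "{u. 1 \<le> supn u \<and> supn u \<le> N}"
  have fin: "finite ?U" by (rule finite_subset[of _ "box3 N"]) (auto simp: box3_iff)
  have "(\<Sum>u\<in>?U. 1 / (real_of_int (supn u))\<^sup>2) = (\<Sum>n\<in>{1..N}. \<Sum>u\<in>{u \<in> ?U. supn u = n}. 1 / (of_int (supn u))\<^sup>2)"
    by (rule sum.group[symmetric]) (use fin in auto)
  also have "\<dots> \<le> (\<Sum>n\<in>{1..N}. 54)"
  proof (rule sum_mono)
    fix n assume n: "n \<in> {1..N}"
    have "(\<Sum>u\<in>{u \<in> ?U. supn u = n}. 1 / (real_of_int (supn u))\<^sup>2) = (\<Sum>u\<in>{u. supn u = n}. 1 / (of_int n)\<^sup>2)"
      using n by (intro sum.cong) auto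
    also have "\<dots> = real (card {u. supn u = n}) / (of_int n)\<^sup>2" by simp
    also have "\<dots> \<le> 54 * (of_int n)\<^sup>2 / (of_int n)\<^sup>2" using n card_shell(2)[of n] by (intro divide_right_mono) auto
    also have "\<dots> = 54" using n by simp
    finally show "(\<Sum>u\<in>{u \<in> ?U. supn u = n}. 1 / (real_of_int (supn u))\<^sup>2) \<le> 54" .
  qed
  also have "\<dots> = 54 * of_int N" using assms by simp
  finally show ?thesis .
qed

text \<open>Vectors \<open>x\<close> are grouped by \<open>u = uf x\<close>. At most
  \<open>25 K ^ 2 / |u|\<close> of them are orthogonal to \<open>u\<close>, each of weight
  \<open>1 / |u|\<close>, so what remains is the sum of \<open>1 / |u| ^ 2\<close> over
  \<open>|u| \<le> 3 * sqrt K\<close>. The constant is \<open>25 * 54 * 3\<close>.\<close>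

lemma sum_inverse_orthogonal:
  fixes K :: int and uf :: "int \<times> int \<times> int \<Rightarrow> int \<times> int \<times> int"
  assumes K: "K \<ge> 1"
    and uf: "\<And>x. x \<in> box3 K - {(0, 0, 0)} \<Longrightarrow> gcd3 (uf x) = 1 \<and> dot3 x (uf x) = 0 \<and> (supn (uf x))\<^sup>2 \<le> 9 * K"
  shows "(\<Sum>x\<in>box3 K - {(0, 0, 0)}. 1 / real_of_int (supn (uf x))) \<le> 4050 * (of_int K)\<^sup>2 * sqrt (of_int K)"
proof -
  let ?B = "box3 K - {(0, 0, 0)}"
  define N where "N = \<lfloor>3 * sqrt (of_int K)\<rfloor>"
  have K1: "real_of_int K \<ge> 1" using K by simp
  have N0: "N \<ge> 0" using K by (simp add: N_def)
  let ?U = "{u. 1 \<le> supn u \<and> supn u \<le> N}"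
  have finU: "finite ?U" by (rule finite_subset[of _ "box3 N"]) (auto simp: box3_iff)
  have U: "uf x \<in> ?U" if "x \<in> ?B" for x
  proof -
    have "1 \<le> supn (uf x)" using uf[OF that] supn_ge_1 by auto
    moreover have "of_int (supn (uf x)) \<le> 3 * sqrt (real_of_int K)"
    proof -
      have "of_int ((supn (uf x))\<^sup>2) \<le> real_of_int (9 * K)" using uf[OF that] by (simp only: of_int_le_iff)
      then have "(real_of_int (supn (uf x)))\<^sup>2 \<le> 9 * of_int K" by simp
      then have "real_of_int (supn (uf x)) \<le> sqrt (9 * of_int K)" by (rule real_le_rsqrt)
      then show ?thesis by (simp add: real_sqrt_mult)
    qed
    ultimately show ?thesis by (simp add: N_def le_floor_iff)
  qed
  have img: "uf ` ?B \<subseteq> ?U" by (rule image_subsetI) (rule U)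
  have fB: "finite ?B" by simp
  have "(\<Sum>x\<in>?B. 1 / real_of_int (supn (uf x))) = (\<Sum>u\<in>?U. \<Sum>x\<in>{x \<in> ?B. uf x = u}. 1 / of_int (supn (uf x)))"
    by (rule sum.group[OF fB finU img, symmetric])
  also have "\<dots> \<le> (\<Sum>u\<in>?U. 25 * (of_int K)\<^sup>2 * (1 / (of_int (supn u))\<^sup>2))"
  proof (rule sum_mono)
    fix u assume u: "u \<in> ?U"
    have pos: "real_of_int (supn u) > 0" using u by simp
    show "(\<Sum>x\<in>{x \<in> ?B. uf x = u}. 1 / real_of_int (supn (uf x))) \<le> 25 * (of_int K)\<^sup>2 * (1 / (of_int (supn u))\<^sup>2)"
    proof (cases "{x \<in> ?B. uf x = u} = {}")
      case True
      then show ?thesis by (simp only: sum.empty) simp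
    next
      case False
      then obtain x0 where x0: "x0 \<in> ?B" "uf x0 = u" by auto
      have g: "gcd3 u = 1" using uf[OF x0(1)] x0(2) by simp
      \<comment> \<open>\<open>K \<ge> 1\<close> turns the bound by \<open>3 * sqrt K\<close> into
        the bound by \<open>3 * K\<close> that \<open>card_orthogonal_box\<close> asks for.\<close>
      have "of_int (supn u) \<le> 3 * sqrt (real_of_int K)" using u unfolding N_def by (simp add: le_floor_iff)
      moreover have "sqrt (real_of_int K) \<le> of_int K"
        using K1 mult_left_mono[of 1 "real_of_int K" "of_int K"] by (intro real_le_lsqrt) (auto simp: power2_eq_square)
      ultimately have "supn u \<le> 3 * K" by linarith
      from card_orthogonal_box[OF K g this]
      have "real_of_int (int (card {x \<in> box3 K. dot3 x u = 0}) * supn u) \<le> of_int (25 * K\<^sup>2)" by (simp only: of_int_le_iff)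
      then have c: "real (card {x \<in> box3 K. dot3 x u = 0}) * of_int (supn u) \<le> 25 * (of_int K)\<^sup>2" by simp
      have "(\<Sum>x\<in>{x \<in> ?B. uf x = u}. 1 / real_of_int (supn (uf x))) = (\<Sum>x\<in>{x \<in> ?B. uf x = u}. 1 / of_int (supn u))"
        by (rule sum.cong) auto
      also have "\<dots> = real (card {x \<in> ?B. uf x = u}) / of_int (supn u)" by simp
      also have "\<dots> \<le> real (card {x \<in> box3 K. dot3 x u = 0}) / of_int (supn u)"
      proof (intro divide_right_mono of_nat_mono card_mono)
        show "{x \<in> ?B. uf x = u} \<subseteq> {x \<in> box3 K. dot3 x u = 0}"
        proof
          fix x assume "x \<in> {x \<in> ?B. uf x = u}"
          then show "x \<in> {x \<in> box3 K. dot3 x u = 0}" using uf[of x] by simp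
        qed
      qed (use pos in auto)
      also have "\<dots> = real (card {x \<in> box3 K. dot3 x u = 0}) * of_int (supn u) / (of_int (supn u))\<^sup>2"
        using pos by (simp add: power2_eq_square)
      also have "\<dots> \<le> 25 * (of_int K)\<^sup>2 / (of_int (supn u))\<^sup>2" using c by (intro divide_right_mono) auto
      finally show ?thesis by simp
    qed
  qed
  also have "\<dots> = 25 * (of_int K)\<^sup>2 * (\<Sum>u\<in>?U. 1 / (of_int (supn u))\<^sup>2)" by (simp add: sum_distrib_left)
  also have "\<dots> \<le> 25 * (of_int K)\<^sup>2 * (54 * of_int N)" by (intro mult_left_mono sum_inverse_square_supn N0) auto
  also have "\<dots> \<le> 25 * (of_int K)\<^sup>2 * (54 * (3 * sqrt (of_int K)))"
    unfolding N_def by (intro mult_left_mono of_int_floor_le) auto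
  also have "\<dots> = 4050 * (of_int K)\<^sup>2 * sqrt (of_int K)" by simp
  finally show ?thesis .
qed

section \<open>The error for one hyperplane\<close>

text \<open>With \<open>n = |u|\<close> in the sup norm, \<open>n ^ 2 \<le> 9 |p|\<close> gives
  \<open>1 / lp \<le> 9 / n\<close> and \<open>lu / lp \<le> 18 / n\<close>, while
  \<open>lp \<le> la\<close> bounds the number of planes by a multiple of \<open>R\<close>. Every
  term of the error in \<open>count_hyperplane\<close> is then a multiple of
  \<open>R ^ 2 / n\<close>.\<close>

lemma hyperplane_count_error:
  fixes a h c :: int and p u :: "int \<times> int \<times> int" and z0 z1 z2 z3 Q R :: real
  assumes h: "h > 0" and ah: "coprime a h" and pp: "p = (p1, p2, p3)" "gcd3 p = 1"
    and u: "gcd3 u = 1" "dot3 p u = 0" "(supn u)\<^sup>2 \<le> 9 * supn p"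
    and z: "of_int a * z0 + of_int h * (of_int p1 * z1 + of_int p2 * z2 + of_int p3 * z3) = of_int c"
    and Q: "Q \<ge> 0" "sqrt Q \<le> R" and R: "R \<ge> 1" "of_int (supn p) \<le> R"
  defines "S \<equiv> {(y0::int, y1::int, y2::int, y3::int). a * y0 + h * (p1 * y1 + p2 * y2 + p3 * y3) = c \<and>
      (of_int y0 - z0)\<^sup>2 + (of_int y1 - z1)\<^sup>2 + (of_int y2 - z2)\<^sup>2 + (of_int y3 - z3)\<^sup>2 \<le> Q}"
    and "la \<equiv> sqrt (of_int (a\<^sup>2 + h\<^sup>2 * (p1\<^sup>2 + p2\<^sup>2 + p3\<^sup>2)))"
  shows "\<bar>real (card S) - 4 * pi / 3 * sqrt Q ^ 3 / la\<bar> \<le> 500 * R\<^sup>2 / of_int (supn u)"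
proof -
  obtain u1 u2 u3 where uu: "u = (u1, u2, u3)" by (metis prod_cases3)
  define lu where "lu = sqrt (real_of_int (u1\<^sup>2 + u2\<^sup>2 + u3\<^sup>2))"
  define lp where "lp = sqrt (real_of_int (p1\<^sup>2 + p2\<^sup>2 + p3\<^sup>2))"
  have main: "\<bar>real (card S) - 4 * pi / 3 * sqrt Q ^ 3 / la\<bar> \<le>
      2 * pi / lp * sqrt Q ^ 2 + (4 * sqrt Q / lu + 4 * sqrt Q / (lp / lu) + 4) * (2 * sqrt Q / (la / lp) + 2)"
    unfolding S_def la_def lu_def lp_def
    by (rule count_hyperplane(2)[OF h ah _ _ _ z Q(1)]) (use pp u in \<open>simp_all add: gcd3_def dot3_def uu\<close>)
  define n where "n = real_of_int (supn u)"
  define M where "M = real_of_int (supn p)"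
  have sq_bounds: "max \<bar>x\<bar> (max \<bar>y\<bar> \<bar>w\<bar>) \<le> sqrt (real_of_int (x\<^sup>2 + y\<^sup>2 + w\<^sup>2)) \<and>
      sqrt (real_of_int (x\<^sup>2 + y\<^sup>2 + w\<^sup>2)) \<le> 2 * max \<bar>x\<bar> (max \<bar>y\<bar> \<bar>w\<bar>)" for x y w :: int
  proof -
    define t where "t = max \<bar>x\<bar> (max \<bar>y\<bar> \<bar>w\<bar>)"
    have t: "\<bar>x\<bar> \<le> t" "\<bar>y\<bar> \<le> t" "\<bar>w\<bar> \<le> t" by (auto simp: t_def)
    have t0: "t \<ge> 0" using t(1) by simp
    have q: "x\<^sup>2 \<le> t\<^sup>2" "y\<^sup>2 \<le> t\<^sup>2" "w\<^sup>2 \<le> t\<^sup>2" using t t0 by (simp_all add: abs_le_square_iff[symmetric])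
    have "t = \<bar>x\<bar> \<or> t = \<bar>y\<bar> \<or> t = \<bar>w\<bar>" by (auto simp: t_def max_def)
    then have "t\<^sup>2 = x\<^sup>2 \<or> t\<^sup>2 = y\<^sup>2 \<or> t\<^sup>2 = w\<^sup>2" by auto
    moreover have "0 \<le> x\<^sup>2" "0 \<le> y\<^sup>2" "0 \<le> w\<^sup>2" by auto
    ultimately have lo: "t\<^sup>2 \<le> x\<^sup>2 + y\<^sup>2 + w\<^sup>2" by linarith
    have hi: "x\<^sup>2 + y\<^sup>2 + w\<^sup>2 \<le> (2 * t)\<^sup>2" 
    proof -
      have "(2 * t)\<^sup>2 = 4 * t\<^sup>2" by (simp add: power_mult_distrib)
      then show ?thesis using q zero_le_power2[of t] by linarith
    qed
    have "(real_of_int t)\<^sup>2 \<le> real_of_int (x\<^sup>2 + y\<^sup>2 + w\<^sup>2)" using lo by (metis of_int_le_iff of_int_power)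
    moreover have "real_of_int (x\<^sup>2 + y\<^sup>2 + w\<^sup>2) \<le> (real_of_int (2 * t))\<^sup>2" using hi by (metis of_int_le_iff of_int_power)
    ultimately show ?thesis unfolding t_def[symmetric] using t0
      by (auto intro!: real_le_rsqrt real_le_lsqrt)
  qed
  have lu: "n \<le> lu" "lu \<le> 2 * n" using sq_bounds[of u1 u2 u3] by (auto simp: lu_def n_def supn_def uu)
  have lp: "M \<le> lp" using sq_bounds[of p1 p2 p3] by (auto simp: lp_def M_def supn_def pp)
  have n1: "n \<ge> 1" using supn_ge_1[OF u(1)] by (simp add: n_def)
  have M1: "M \<ge> 1" using supn_ge_1[OF pp(2)] by (simp add: M_def)
  have nM: "n\<^sup>2 \<le> 9 * M"
  proof -
    have "real_of_int ((supn u)\<^sup>2) \<le> real_of_int (9 * supn p)" using u(3) by (simp only: of_int_le_iff)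
    then show ?thesis by (simp add: n_def M_def)
  qed
  have nn: "n \<le> n\<^sup>2" using n1 by (simp add: power2_eq_square)
  \<comment> \<open>Needed to absorb the boundary constant 4 into a multiple of
    \<open>R / n\<close>.\<close>
  have nR: "n \<le> 3 * R"
  proof (rule power2_le_imp_le)
    have "n\<^sup>2 \<le> 9 * R" using nM R by (simp add: M_def)
    also have "9 * R \<le> 9 * (R * R)" using R(1) by simp
    finally show "n\<^sup>2 \<le> (3 * R)\<^sup>2" by (simp add: power2_eq_square)
  qed (use R in auto)
  have la: "lp \<le> la"
  proof -
    have "h\<^sup>2 \<ge> 1" using h by (simp add: power2_eq_square mult_pos_pos int_one_le_iff_zero_less)
    then have "1 * (p1\<^sup>2 + p2\<^sup>2 + p3\<^sup>2) \<le> h\<^sup>2 * (p1\<^sup>2 + p2\<^sup>2 + p3\<^sup>2)" by (intro mult_right_mono) auto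
    then have "p1\<^sup>2 + p2\<^sup>2 + p3\<^sup>2 \<le> a\<^sup>2 + h\<^sup>2 * (p1\<^sup>2 + p2\<^sup>2 + p3\<^sup>2)" by (simp add: add_increasing)
    then show ?thesis unfolding lp_def la_def by (intro real_sqrt_le_mono) (simp only: of_int_le_iff)
  qed
  define s where "s = sqrt Q"
  have s: "0 \<le> s" "s \<le> R" using Q by (auto simp: s_def)
  have pos: "lp > 0" "lu > 0" "n > 0" "la > 0" using lp lu n1 M1 la by linarith+
  have lpn: "n / 9 \<le> lp" using nn nM lp by linarith
  have t1: "2 * pi / lp * s ^ 2 \<le> 72 * R\<^sup>2 / n"
  proof -
    have "2 * pi / lp \<le> 8 / (n / 9)" using pi_less_4 lpn pos by (intro frac_le) auto
    moreover have "s ^ 2 \<le> R\<^sup>2" using s by (intro power_mono) auto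
    ultimately have "2 * pi / lp * s ^ 2 \<le> 8 / (n / 9) * R\<^sup>2" using pos by (intro mult_mono) auto
    then show ?thesis by simp
  qed
  have t2: "4 * s / lu \<le> 4 * R / n" using s lu pos by (intro frac_le) auto
  have t3: "4 * s / (lp / lu) \<le> 72 * R / n"
  proof -
    have "n * lu \<le> n * (2 * n)" using lu n1 by (intro mult_left_mono) auto
    also have "\<dots> = 2 * n\<^sup>2" by (simp add: power2_eq_square)
    also have "\<dots> \<le> 18 * lp" using nM lp by linarith
    finally have f: "n / 18 \<le> lp / lu" using pos by (simp add: field_simps)
    have "4 * s / (lp / lu) \<le> 4 * R / (n / 18)" by (rule frac_le[OF _ _ _ f]) (use s pos in auto)
    then show ?thesis by simp
  qed
  have t4: "4 \<le> 12 * R / n" using nR pos by (simp add: field_simps)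
  have t5: "2 * s / (la / lp) + 2 \<le> 4 * R"
  proof -
    have "1 \<le> la / lp" using la pos by simp
    then have "2 * s / (la / lp) \<le> 2 * R / 1" using s by (intro frac_le) auto
    then show ?thesis using R by simp
  qed
  have "(4 * s / lu + 4 * s / (lp / lu) + 4) * (2 * s / (la / lp) + 2) \<le> (88 * R / n) * (4 * R)"
    using t2 t3 t4 t5 s pos R by (intro mult_mono) (auto simp: add_nonneg_nonneg)
  then have "2 * pi / lp * s ^ 2 + (4 * s / lu + 4 * s / (lp / lu) + 4) * (2 * s / (la / lp) + 2) \<le> 72 * R\<^sup>2 / n + (88 * R / n) * (4 * R)"
    using t1 by linarith
  also have "\<dots> = 424 * R\<^sup>2 / n" by (simp add: power2_eq_square field_simps)
  also have "\<dots> \<le> 500 * R\<^sup>2 / n" using pos by (intro divide_right_mono) auto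
  finally show ?thesis using main unfolding s_def n_def by linarith
qed

section \<open>A radial sum over a lattice\<close>

type_synonym int4 = "int \<times> int \<times> int \<times> int"

definition sq4 :: "int4 \<Rightarrow> int" where
  "sq4 a = (case a of (a0, a1, a2, a3) \<Rightarrow> a0\<^sup>2 + a1\<^sup>2 + a2\<^sup>2 + a3\<^sup>2)"

definition sum4 :: "int4 \<Rightarrow> int" where
  "sum4 a = (case a of (a0, a1, a2, a3) \<Rightarrow> a0 + a1 + a2 + a3)"

text \<open>Isabelle extends \<open>sqrt\<close> to negative arguments as an odd function, so \<open>wt Q a\<close> is only summed over \<open>sq4 a \<le> Q\<close>.\<close>
definition wt :: "real \<Rightarrow> int4 \<Rightarrow> real" where
  "wt Q a = sqrt (Q - of_int (sq4 a)) ^ 3 / sqrt (of_int (sq4 a))"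

lemma sq4_nonneg [simp]: "sq4 a \<ge> 0"
  by (auto simp: sq4_def split: prod.splits)

lemma sq4_eq_0_iff: "sq4 a = 0 \<longleftrightarrow> a = (0, 0, 0, 0)"
  by (auto simp: sq4_def add_nonneg_eq_0_iff split: prod.splits)

lemma finite_sq4_le: "finite {a. real_of_int (sq4 a) \<le> Q}"
proof (cases "Q \<ge> 0")
  case True
  have "{a. real_of_int (sq4 a) \<le> Q} = {(a, b, c, e). int 1 dvd a + b + c + e \<and> real_of_int (a\<^sup>2 + b\<^sup>2 + c\<^sup>2 + e\<^sup>2) \<le> Q}"
    by (auto simp: sq4_def)
  then show ?thesis using count_ball_divisible_sum(1)[of 1 Q] True by simp
next
  case False
  have "\<not> real_of_int (sq4 a) \<le> Q" for a
  proof -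
    have "0 \<le> real_of_int (sq4 a)" by simp
    then show ?thesis using False by linarith
  qed
  then have e: "{a. real_of_int (sq4 a) \<le> Q} = {}" by blast
  show ?thesis unfolding e by simp
qed

section \<open>The radial integral\<close>

text \<open>The value \<open>pi / 16\<close> is the Beta integral \<open>B(3/2, 5/2)\<close>; the
  primitive comes from the substitution \<open>v = sin t ^ 2\<close>.\<close>

lemma radial_primitive:
  obtains K :: "real \<Rightarrow> real" where "K 1 - K 0 = pi / 16" "continuous_on {0..1} K"
    "\<And>v. 0 < v \<Longrightarrow> v < 1 \<Longrightarrow> (K has_real_derivative sqrt v * sqrt (1 - v) ^ 3) (at v)"
proof -
  define K where "K v = (arcsin (sqrt v) + sqrt (1 - v) * sqrt v * (- 8 * v\<^sup>2 + 14 * v - 3) / 3) / 8" for v :: real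
  have "K 1 - K 0 = pi / 16" by (simp add: K_def)
  moreover have "continuous_on {0..1} K" unfolding K_def
    by (intro continuous_intros) (auto intro: order_trans[of _ 0])
  moreover have "(K has_real_derivative sqrt v * sqrt (1 - v) ^ 3) (at v)" if v: "0 < v" "v < 1" for v
  proof -
    define w where "w = sqrt v"
    define t where "t = sqrt (1 - v)"
    have w: "w > 0" "w * w = v" and t: "t > 0" "t * t = 1 - v" using v by (auto simp: w_def t_def)
    have dw: "(sqrt has_real_derivative 1 / (2 * w)) (at v)"
      using DERIV_real_sqrt[OF v(1)] by (simp add: w_def inverse_eq_divide mult.commute)
    have dt: "((\<lambda>v. sqrt (1 - v)) has_real_derivative - 1 / (2 * t)) (at v)"
    proof -
      have g: "((\<lambda>v. 1 - v) has_real_derivative - 1) (at v)" by (auto intro!: derivative_eq_intros)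
      have "((\<lambda>v. sqrt (1 - v)) has_real_derivative inverse (sqrt (1 - v)) / 2 * - 1) (at v)"
        by (rule DERIV_chain2[where f = sqrt and g = "\<lambda>v. 1 - v", OF DERIV_real_sqrt g]) (use v in simp)
      then show ?thesis by (simp add: t_def inverse_eq_divide mult.commute)
    qed
    have "w < 1" using v by (simp add: w_def)
    then have da: "((\<lambda>v. arcsin (sqrt v)) has_real_derivative 1 / t * (1 / (2 * w))) (at v)"
    proof -
      have "(arcsin has_real_derivative inverse (sqrt (1 - (sqrt v)\<^sup>2))) (at (sqrt v))"
        using \<open>w < 1\<close> w(1) unfolding w_def by (intro DERIV_arcsin) linarith+
      moreover have "sqrt (1 - (sqrt v)\<^sup>2) = t" using v by (simp add: t_def)
      ultimately have "(arcsin has_real_derivative 1 / t) (at (sqrt v))" by (simp add: inverse_eq_divide)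
      then show ?thesis by (rule DERIV_chain2[where f = arcsin and g = sqrt, OF _ dw])
    qed
    have dp: "((\<lambda>v. - 8 * v\<^sup>2 + 14 * v - 3) has_real_derivative (- 16 * v + 14)) (at v)"
      by (auto intro!: derivative_eq_intros)
    have "(K has_real_derivative (1 / t * (1 / (2 * w)) +
       ((- 1 / (2 * t) * sqrt v + 1 / (2 * w) * sqrt (1 - v)) * (- 8 * v\<^sup>2 + 14 * v - 3)
         + (- 16 * v + 14) * (sqrt (1 - v) * sqrt v)) / 3) / 8) (at v)"
      unfolding K_def by (intro DERIV_cdivide DERIV_add da DERIV_mult[of "\<lambda>v. sqrt (1 - v) * sqrt v"] DERIV_mult dt dw dp)
    also have "(1 / t * (1 / (2 * w)) +
       ((- 1 / (2 * t) * sqrt v + 1 / (2 * w) * sqrt (1 - v)) * (- 8 * v\<^sup>2 + 14 * v - 3)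
         + (- 16 * v + 14) * (sqrt (1 - v) * sqrt v)) / 3) / 8
       = (3 + (t * t - w * w) * (- 8 * v\<^sup>2 + 14 * v - 3) + (- 32 * v + 28) * (t * t) * (w * w)) / (48 * t * w)"
      unfolding w_def[symmetric] t_def[symmetric] using w(1) t(1) by (simp add: field_simps)
    also have "3 + (t * t - w * w) * (- 8 * v\<^sup>2 + 14 * v - 3) + (- 32 * v + 28) * (t * t) * (w * w) = 48 * (w * w) * ((t * t) * (t * t))"
      unfolding w(2) t(2) by (simp add: power2_eq_square algebra_simps)
    also have "48 * (w * w) * ((t * t) * (t * t)) / (48 * t * w) = w * t ^ 3"
      using w(1) t(1) by (simp add: power3_eq_cube)
    finally show ?thesis by (simp add: w_def t_def)
  qed
  ultimately show thesis by (rule that)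
qed

lemma cube_diff_le:
  fixes s t :: real
  assumes "0 \<le> t" "t \<le> s"
  shows "s ^ 3 - t ^ 3 \<le> (s * s - t * t) * (3 * s)"
proof -
  have "s ^ 3 - t ^ 3 = (s - t) * (s * s + s * t + t * t)" by (simp add: power3_eq_cube algebra_simps)
  also have "\<dots> \<le> (s - t) * ((s + t) * (3 * s))"
  proof (rule mult_left_mono)
    have "t * t \<le> s * s" "0 \<le> s * t" "0 \<le> s * s" using assms by (auto intro: mult_mono)
    moreover have "(s + t) * (3 * s) = 3 * (s * s) + 3 * (s * t)" by (simp add: algebra_simps)
    ultimately show "s * s + s * t + t * t \<le> (s + t) * (3 * s)" by linarith
  qed (use assms in auto)
  also have "\<dots> = (s * s - t * t) * (3 * s)" by (simp add: algebra_simps)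
  finally show ?thesis .
qed

lemma cube_sqrt_diff:
  fixes Q x y :: real
  assumes "0 \<le> x" "x \<le> y" "y \<le> Q" "y \<le> x + 1"
  shows "sqrt (Q - x) ^ 3 - sqrt (Q - y) ^ 3 \<le> 3 * sqrt Q"
proof -
  define s t where st: "s = sqrt (Q - x)" "t = sqrt (Q - y)"
  have st0: "0 \<le> t" "t \<le> s" "s \<le> sqrt Q" using assms by (auto simp: st)
  have sq: "s * s = Q - x" "t * t = Q - y" using assms by (auto simp: st)
  have "s ^ 3 - t ^ 3 \<le> (s * s - t * t) * (3 * s)" by (rule cube_diff_le[OF st0(1,2)])
  also have "\<dots> \<le> 1 * (3 * s)" using assms st0 unfolding sq by (intro mult_right_mono) auto
  also have "\<dots> \<le> 3 * sqrt Q" using st0 by simp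
  finally show ?thesis by (simp add: st)
qed

text \<open>The summand first rises and then falls, so the monotone comparison does not apply.
  Instead the mean value theorem on each unit interval yields the summand at an intermediate point
  \<open>z\<close>, and between \<open>z\<close> and the integer the factor \<open>sqrt\<close>
  moves by at most 1 and the cube by at most \<open>3 * sqrt Q\<close>. Each of the at most
  \<open>Q\<close> intervals thus costs a multiple of \<open>Q * sqrt Q\<close>.\<close>

lemma radial_sum:
  fixes Q :: real
  assumes Q: "Q \<ge> 1"
  shows "\<bar>(\<Sum>n=1..nat \<lfloor>Q\<rfloor>. sqrt (real n) * sqrt (Q - real n) ^ 3) - pi / 16 * Q ^ 3\<bar> \<le> 5 * Q\<^sup>2 * sqrt Q"
proof -
  obtain K where K: "K 1 - K 0 = pi / 16" "continuous_on {0..1} K"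
    "\<And>v. 0 < v \<Longrightarrow> v < 1 \<Longrightarrow> (K has_real_derivative sqrt v * sqrt (1 - v) ^ 3) (at v)" by (rule radial_primitive) blast
  define f where "f x = sqrt x * sqrt (Q - x) ^ 3" for x
  define H where "H x = Q ^ 3 * K (x / Q)" for x
  define N where "N = nat \<lfloor>Q\<rfloor>"
  have N: "real N \<le> Q" "Q < real N + 1" using Q unfolding N_def by (auto simp: of_nat_nat)  
  have contH: "continuous_on {0..Q} H" unfolding H_def
  proof (intro continuous_intros continuous_on_compose2[OF K(2)])
    show "(\<lambda>x. x / Q) ` {0..Q} \<subseteq> {0..1}" using Q by auto
  qed (use Q in auto)
  have dH: "(H has_real_derivative f x) (at x)" if "0 < x" "x < Q" for x
  proof -
    have "((\<lambda>x. x / Q) has_real_derivative 1 / Q) (at x)" using Q by (auto intro!: derivative_eq_intros)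
    then have "((\<lambda>x. K (x / Q)) has_real_derivative sqrt (x / Q) * sqrt (1 - x / Q) ^ 3 * (1 / Q)) (at x)"
      by (rule DERIV_chain2[where f = K and g = "\<lambda>x. x / Q", OF K(3)[of "x / Q"], rotated 2]) (use that Q in auto)
    then have "(H has_real_derivative Q ^ 3 * (sqrt (x / Q) * sqrt (1 - x / Q) ^ 3 * (1 / Q))) (at x)"
      unfolding H_def by (rule DERIV_cmult)
    also have "Q ^ 3 * (sqrt (x / Q) * sqrt (1 - x / Q) ^ 3 * (1 / Q)) = f x"
    proof -
      define q where "q = sqrt Q"
      have q: "q > 0" "Q = q * q" using Q by (auto simp: q_def)
      have "1 - x / Q = (Q - x) / Q" using Q by (simp add: field_simps)
      then have "sqrt (1 - x / Q) = sqrt (Q - x) / q" "sqrt (x / Q) = sqrt x / q"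
        by (simp_all add: real_sqrt_divide q_def)
      then have "Q ^ 3 * (sqrt (x / Q) * sqrt (1 - x / Q) ^ 3 * (1 / Q)) = Q ^ 3 * (sqrt x / q * (sqrt (Q - x) / q) ^ 3 * (1 / Q))" by simp
      also have "\<dots> = (q * q) ^ 3 * (sqrt x / q * (sqrt (Q - x) / q) ^ 3 * (1 / (q * q)))" unfolding q(2)[symmetric] ..
      also have "\<dots> = sqrt x * sqrt (Q - x) ^ 3" using q(1) by (simp add: power_divide power3_eq_cube)
      finally show ?thesis by (simp add: f_def)
    qed
    finally show ?thesis .
  qed
  have mvt: "\<exists>z. x < z \<and> z < y \<and> H y - H x = (y - x) * f z" if "0 \<le> x" "x < y" "y \<le> Q" for x y
  proof -
    have "\<exists>l z. x < z \<and> z < y \<and> (H has_real_derivative l) (at z) \<and> H y - H x = (y - x) * l"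
    proof (rule MVT[OF that(2)])
      show "continuous_on {x..y} H" using that by (intro continuous_on_subset[OF contH]) auto
      fix w assume "x < w" "w < y"
      then have "(H has_real_derivative f w) (at w)" using dH[of w] that by auto
      then show "H differentiable (at w)" by (subst real_differentiable_def) blast
    qed
    then obtain l z where z: "x < z" "z < y" "(H has_real_derivative l) (at z)" "H y - H x = (y - x) * l" by blast
    have "l = f z" using dH[of z] z that by (intro DERIV_unique[OF z(3)]) auto
    then show ?thesis using z by auto
  qed
  have fb: "0 \<le> f x" "f x \<le> Q\<^sup>2" if "0 \<le> x" "x \<le> Q" for x
  proof -
    show "0 \<le> f x" using that by (auto simp: f_def)
    have "f x \<le> sqrt Q * sqrt Q ^ 3" unfolding f_def using that by (intro mult_mono power_mono) auto
    also have "\<dots> = (sqrt Q * sqrt Q) * (sqrt Q * sqrt Q)" by (simp only: power3_eq_cube mult.assoc)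
    also have "\<dots> = Q\<^sup>2"
    proof -
      have "sqrt Q * sqrt Q = Q" using Q by simp
      then show ?thesis by (simp only: power2_eq_square)
    qed
    finally show "f x \<le> Q\<^sup>2" .
  qed
  have stp: "\<bar>f (real n) - (H (real n) - H (real n - 1))\<bar> \<le> sqrt Q ^ 3 + 3 * Q" if n: "n \<in> {1..N}" for n
  proof -
    have n1: "1 \<le> real n" "real n \<le> Q" using n N by auto
    obtain z where z: "real n - 1 < z" "z < real n" "H (real n) - H (real n - 1) = f z"
      using mvt[of "real n - 1" "real n"] n1 by auto
    have z0: "0 \<le> z" "z \<le> Q" using z n1 by linarith+
    have a1: "0 \<le> sqrt (real n) - sqrt z" using z by simp
    have a2: "sqrt (real n) - sqrt z \<le> 1"
    proof -
      have "sqrt (real n) \<le> sqrt (z + 1)" using z by simp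
      also have "\<dots> \<le> sqrt z + sqrt 1" using z0 by (intro sqrt_add_le_add_sqrt) auto
      finally show ?thesis by simp
    qed
    have b1: "0 \<le> sqrt (Q - z) ^ 3 - sqrt (Q - real n) ^ 3" using z n1 by (simp add: power_mono)
    have b2: "sqrt (Q - z) ^ 3 - sqrt (Q - real n) ^ 3 \<le> 3 * sqrt Q"
      using cube_sqrt_diff[of z "real n" Q] z z0 n1 by auto
    have "f (real n) - f z = (sqrt (real n) - sqrt z) * sqrt (Q - real n) ^ 3 - sqrt z * (sqrt (Q - z) ^ 3 - sqrt (Q - real n) ^ 3)"
      by (simp add: f_def algebra_simps)
    moreover have "(sqrt (real n) - sqrt z) * sqrt (Q - real n) ^ 3 \<le> 1 * sqrt Q ^ 3"
      using a1 a2 n1 Q by (intro mult_mono power_mono) auto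
    moreover have "0 \<le> (sqrt (real n) - sqrt z) * sqrt (Q - real n) ^ 3" using a1 n1 by auto
    moreover have "sqrt z * (sqrt (Q - z) ^ 3 - sqrt (Q - real n) ^ 3) \<le> sqrt Q * (3 * sqrt Q)"
      using b1 b2 z0 Q by (intro mult_mono) auto
    moreover have "0 \<le> sqrt z * (sqrt (Q - z) ^ 3 - sqrt (Q - real n) ^ 3)" using b1 z0 by auto
    moreover have "sqrt Q * (3 * sqrt Q) = 3 * Q" using Q by simp
    moreover have "0 \<le> sqrt Q ^ 3" using Q by auto
    ultimately show ?thesis unfolding z(3) using Q by linarith
  qed
  have tele: "(\<Sum>n=1..N. H (real n) - H (real n - 1)) = H (real N) - H 0"
    by (induction N) auto
  have "\<bar>(\<Sum>n=1..N. f (real n)) - (H (real N) - H 0)\<bar> = \<bar>\<Sum>n=1..N. f (real n) - (H (real n) - H (real n - 1))\<bar>"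
    unfolding tele[symmetric] sum_subtractf ..
  also have "\<dots> \<le> (\<Sum>n=1..N. sqrt Q ^ 3 + 3 * Q)" by (rule order_trans[OF sum_abs]) (intro sum_mono stp)
  also have "\<dots> = real N * (sqrt Q ^ 3 + 3 * Q)" by simp
  also have "\<dots> \<le> Q * (sqrt Q ^ 3 + 3 * Q)" using N Q by (intro mult_right_mono) auto
  finally have A: "\<bar>(\<Sum>n=1..N. f (real n)) - (H (real N) - H 0)\<bar> \<le> Q * (sqrt Q ^ 3 + 3 * Q)" .
  \<comment> \<open>The last interval, from \<open>N\<close> to \<open>Q\<close>, is shorter than 1
    and is bounded by the maximum of the summand.\<close>
  have B: "\<bar>H Q - H (real N)\<bar> \<le> Q\<^sup>2"
  proof (cases "real N < Q")
    case True
    obtain z where z: "real N < z" "z < Q" "H Q - H (real N) = (Q - real N) * f z" using mvt[of "real N" Q] True by auto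
    have "(Q - real N) * f z \<le> 1 * Q\<^sup>2" using N z fb[of z] by (intro mult_mono) auto
    moreover have "0 \<le> (Q - real N) * f z" using N z fb[of z] by auto
    ultimately show ?thesis using z by auto
  qed (use N in auto)
  have HQ: "H Q - H 0 = pi / 16 * Q ^ 3"
  proof -
    have "H Q - H 0 = Q ^ 3 * (K 1 - K 0)" using Q by (simp add: H_def right_diff_distrib)
    then show ?thesis by (simp add: K(1))
  qed
  have "Q * (sqrt Q ^ 3 + 3 * Q) + Q\<^sup>2 \<le> 5 * Q\<^sup>2 * sqrt Q"
  proof -
    define q where "q = sqrt Q"
    have q: "q \<ge> 1" "Q = q * q" using Q by (auto simp: q_def)
    have "q ^ 4 \<le> q ^ 5" using q(1) by (intro power_increasing) auto
    moreover have "Q * (q ^ 3 + 3 * Q) + Q\<^sup>2 = q ^ 5 + 4 * q ^ 4" unfolding q(2) by (simp add: eval_nat_numeral algebra_simps)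
    moreover have "5 * Q\<^sup>2 * q = 5 * q ^ 5" unfolding q(2) by (simp add: eval_nat_numeral)
    ultimately show ?thesis unfolding q_def by linarith
  qed
  then have "\<bar>(\<Sum>n=1..N. f (real n)) - pi / 16 * Q ^ 3\<bar> \<le> 5 * Q\<^sup>2 * sqrt Q"
    using A B HQ by linarith
  then show ?thesis by (simp add: f_def N_def)
qed

section \<open>Partial summation over the norm\<close>

text \<open>Summation by parts in inductive form: the partial sum up to \<open>N'\<close> is at
  least \<open>D N' * f N'\<close>, and this survives each step because \<open>f\<close>
  decreases.\<close>

lemma abel_nonneg:
  fixes D f :: "nat \<Rightarrow> real"
  assumes "D 0 = 0" and "\<And>n. n \<le> N \<Longrightarrow> 0 \<le> D n"
    and f: "\<And>n. 1 \<le> n \<Longrightarrow> n \<le> N \<Longrightarrow> 0 \<le> f n" "\<And>n. 1 \<le> n \<Longrightarrow> Suc n \<le> N \<Longrightarrow> f (Suc n) \<le> f n"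
  shows "0 \<le> (\<Sum>n=1..N. (D n - D (n - 1)) * f n)"
proof -
  have "N' \<le> N \<Longrightarrow> D N' * f N' \<le> (\<Sum>n=1..N'. (D n - D (n - 1)) * f n)" for N'
  proof (induction N')
    case (Suc k)
    have "D k * f (Suc k) \<le> D k * f k"
    proof (cases "k = 0")
      case False
      then show ?thesis using Suc.prems assms(2)[of k] f(2)[of k] by (intro mult_left_mono) auto
    qed (use assms(1) in auto)
    then have "D (Suc k) * f (Suc k) \<le> D k * f k + (D (Suc k) - D k) * f (Suc k)" by (simp add: algebra_simps)
    also have "\<dots> \<le> (\<Sum>n=1..Suc k. (D n - D (n - 1)) * f n)" using Suc by simp
    finally show ?case .
  qed (use assms(1) in auto)
  from this[of N] have "D N * f N \<le> (\<Sum>n=1..N. (D n - D (n - 1)) * f n)" by simp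
  moreover have "0 \<le> D N * f N"
  proof (cases "N = 0")
    case False
    then show ?thesis using assms(2)[of N] f(1)[of N] by auto
  qed (use assms(1) in auto)
  ultimately show ?thesis by linarith
qed

text \<open>Both \<open>B - E\<close> and \<open>B + E\<close> are nonnegative, so summation by
  parts against a decreasing \<open>f\<close> lets the majorant \<open>B\<close> replace an error
  \<open>E\<close> of unknown sign.\<close>

lemma abel_bound:
  fixes E B f :: "nat \<Rightarrow> real"
  assumes "E 0 = 0" "B 0 = 0" and "\<And>n. n \<le> N \<Longrightarrow> \<bar>E n\<bar> \<le> B n"
    and f: "\<And>n. 1 \<le> n \<Longrightarrow> n \<le> N \<Longrightarrow> 0 \<le> f n" "\<And>n. 1 \<le> n \<Longrightarrow> Suc n \<le> N \<Longrightarrow> f (Suc n) \<le> f n"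
  shows "\<bar>\<Sum>n=1..N. (E n - E (n - 1)) * f n\<bar> \<le> (\<Sum>n=1..N. (B n - B (n - 1)) * f n)"
proof -
  have "0 \<le> (\<Sum>n=1..N. ((B n - E n) - (B (n - 1) - E (n - 1))) * f n)"
    by (rule abel_nonneg[where D = "\<lambda>n. B n - E n"]) (use assms(1,2) f in \<open>auto dest: assms(3) simp: abs_le_iff\<close>)
  moreover have "0 \<le> (\<Sum>n=1..N. ((B n + E n) - (B (n - 1) + E (n - 1))) * f n)"
    by (rule abel_nonneg[where D = "\<lambda>n. B n + E n"]) (use assms(1,2) f in \<open>auto dest: assms(3) simp: abs_le_iff\<close>)
  moreover have "(\<Sum>n=1..N. ((B n - E n) - (B (n - 1) - E (n - 1))) * f n) = (\<Sum>n=1..N. (B n - B (n - 1)) * f n) - (\<Sum>n=1..N. (E n - E (n - 1)) * f n)"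
    unfolding sum_subtractf[symmetric] by (intro sum.cong) (auto simp: algebra_simps)
  moreover have "(\<Sum>n=1..N. ((B n + E n) - (B (n - 1) + E (n - 1))) * f n) = (\<Sum>n=1..N. (B n - B (n - 1)) * f n) + (\<Sum>n=1..N. (E n - E (n - 1)) * f n)"
    unfolding sum.distrib[symmetric] by (intro sum.cong) (auto simp: algebra_simps)
  ultimately show ?thesis by linarith
qed

definition lat_sum :: "nat \<Rightarrow> real \<Rightarrow> real" where
  "lat_sum D Q = (\<Sum>a | sq4 a > 0 \<and> int D dvd sum4 a \<and> of_int (sq4 a) \<le> Q. wt Q a)"

lemma lat_sum_eq_0:
  assumes "Q < 1" shows "lat_sum D Q = 0"
proof -
  have "\<not> (sq4 a > 0 \<and> int D dvd sum4 a \<and> real_of_int (sq4 a) \<le> Q)" for a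
  proof
    assume "sq4 a > 0 \<and> int D dvd sum4 a \<and> real_of_int (sq4 a) \<le> Q"
    then have "1 \<le> sq4 a" "real_of_int (sq4 a) \<le> Q" by auto
    then have "1 \<le> real_of_int (sq4 a)" by linarith
    then show False using \<open>real_of_int (sq4 a) \<le> Q\<close> assms by linarith
  qed
  then have e: "{a. sq4 a > 0 \<and> int D dvd sum4 a \<and> real_of_int (sq4 a) \<le> Q} = {}" by blast
  show ?thesis unfolding lat_sum_def e by simp
qed

text \<open>The number \<open>A n\<close> of admissible nonzero vectors of norm at most
  \<open>n\<close> is \<open>c * n ^ 2\<close> up to an error of order \<open>n * sqrt n\<close>.
  Partial summation against the decreasing \<open>f\<close> transfers the error, and the increments
  \<open>c * (2 * n - 1)\<close> lead to twice \<open>c\<close> times \<open>radial_sum\<close>;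
  \<open>2 * c * pi / 16\<close> is the stated constant.\<close>

lemma lat_sum_approx:
  assumes D: "D > 0" and Q: "Q \<ge> 0"
  shows "\<bar>lat_sum D Q - pi ^ 3 / (16 * real D) * Q ^ 3\<bar> \<le> 1600 * (Q\<^sup>2 * sqrt Q)"
\<comment> \<open>The sum is empty, and the main term is itself within the error since
  \<open>Q ^ 3 \<le> Q\<^sup>2 * sqrt Q\<close>. This range supplies the tail of the sum over
  \<open>e\<close> in \<open>prim_sum_approx\<close>.\<close>
proof (cases "Q < 1")
  case True
  have "pi ^ 3 / (16 * real D) \<le> 4 ^ 3 / (16 * 1)"
    using D pi_less_4 by (intro frac_le power_mono) auto
  then have "pi ^ 3 / (16 * real D) * Q ^ 3 \<le> 4 * Q ^ 3" using Q by (intro mult_right_mono) auto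
  also have "\<dots> = 4 * (Q\<^sup>2 * Q)" by (simp add: power3_eq_cube power2_eq_square)
  also have "\<dots> \<le> 4 * (Q\<^sup>2 * sqrt Q)"
  proof -
    have "Q * Q \<le> Q" using True Q mult_left_mono[of Q 1 Q] by simp
    then have "Q \<le> sqrt Q" by (intro real_le_rsqrt) (simp add: power2_eq_square)
    then show ?thesis by (intro mult_left_mono) auto
  qed
  also have "\<dots> \<le> 1600 * (Q\<^sup>2 * sqrt Q)" using Q by (intro mult_right_mono) auto
  finally show ?thesis using Q D by (simp add: lat_sum_eq_0[OF True])
next
  case False
  then have Q1: "Q \<ge> 1" by simp
  define N where "N = nat \<lfloor>Q\<rfloor>"
  have N: "real N \<le> Q" using Q1 unfolding N_def by simp
  have N': "x \<le> int N \<longleftrightarrow> of_int x \<le> Q" if "x > 0" for x :: int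
    using that Q1 unfolding N_def by (simp add: le_floor_iff)
  define r where "r n = {a. sq4 a = int n \<and> int D dvd sum4 a}" for n
  have finr: "finite (r n)" for n
    by (rule finite_subset[OF _ finite_sq4_le[of "real n"]]) (auto simp: r_def)
  define f where "f n = sqrt (Q - real n) ^ 3 / sqrt (real n)" for n
  define c where "c = pi\<^sup>2 / (2 * real D)"
  define A where "A n = (\<Sum>k=1..n. real (card (r k)))" for n
  have c: "0 \<le> c" "c \<le> 8"
  proof -
    have "pi\<^sup>2 / (2 * real D) \<le> 4\<^sup>2 / (2 * 1)" using D pi_less_4 by (intro frac_le power_mono) auto
    then show "c \<le> 8" by (simp add: c_def)
  qed (simp add: c_def)
  have lat: "lat_sum D Q = (\<Sum>n=1..N. real (card (r n)) * f n)"
  proof -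
    let ?L = "{a. sq4 a > 0 \<and> int D dvd sum4 a \<and> real_of_int (sq4 a) \<le> Q}"
    have fin: "finite ?L" by (rule finite_subset[OF _ finite_sq4_le[of Q]]) auto
    have "lat_sum D Q = (\<Sum>n\<in>{1..N}. \<Sum>a\<in>{a \<in> ?L. nat (sq4 a) = n}. wt Q a)"
      unfolding lat_sum_def
    proof (rule sum.group[OF fin, symmetric])
      show "(\<lambda>a. nat (sq4 a)) ` ?L \<subseteq> {1..N}" using N' by fastforce
    qed simp
    also have "\<dots> = (\<Sum>n=1..N. real (card (r n)) * f n)"
    proof (rule sum.cong[OF refl])
      fix n assume n: "n \<in> {1..N}"
      have "{a \<in> ?L. nat (sq4 a) = n} = r n" using n N by (auto simp: r_def)
      then have "(\<Sum>a\<in>{a \<in> ?L. nat (sq4 a) = n}. wt Q a) = (\<Sum>a\<in>r n. f n)"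
        by (intro sum.cong) (auto simp: wt_def f_def r_def)
      then show "(\<Sum>a\<in>{a \<in> ?L. nat (sq4 a) = n}. wt Q a) = real (card (r n)) * f n" by simp
    qed
    finally show ?thesis .
  qed
  have Acount: "A n + 1 = real (card {(a::int, b::int, c::int, e::int). int D dvd a + b + c + e \<and> real_of_int (a\<^sup>2 + b\<^sup>2 + c\<^sup>2 + e\<^sup>2) \<le> real n})" for n
  proof -
    let ?C = "{a. int D dvd sum4 a \<and> sq4 a \<le> int n}"
    have C: "{(a::int, b::int, c::int, e::int). int D dvd a + b + c + e \<and> real_of_int (a\<^sup>2 + b\<^sup>2 + c\<^sup>2 + e\<^sup>2) \<le> real n} = ?C"
    proof -
      have iff: "real_of_int x \<le> real n \<longleftrightarrow> x \<le> int n" for x by linarith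
      show ?thesis
      proof (rule set_eqI)
        fix x :: int4
        obtain a b c e where x: "x = (a, b, c, e)" by (metis prod_cases4)
        show "x \<in> {(a::int, b::int, c::int, e::int). int D dvd a + b + c + e \<and> real_of_int (a\<^sup>2 + b\<^sup>2 + c\<^sup>2 + e\<^sup>2) \<le> real n} \<longleftrightarrow> x \<in> ?C"
          unfolding x mem_Collect_eq prod.case sum4_def sq4_def iff ..
      qed
    qed
    have U: "?C = {(0, 0, 0, 0)} \<union> (\<Union>k\<in>{1..n}. r k)"
    proof (intro equalityI subsetI)
      fix a assume a: "a \<in> ?C"
      show "a \<in> {(0, 0, 0, 0)} \<union> (\<Union>k\<in>{1..n}. r k)"
      proof (cases "sq4 a = 0")
        case False
        then have "sq4 a > 0" using sq4_nonneg[of a] by linarith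
        then have "nat (sq4 a) \<in> {1..n}" "a \<in> r (nat (sq4 a))" using a by (auto simp: r_def)
        then show ?thesis by blast
      qed (simp add: sq4_eq_0_iff)
    qed (auto simp: r_def sum4_def sq4_def)
    have "card ?C = card {(0::int, 0::int, 0::int, 0::int)} + card (\<Union>k\<in>{1..n}. r k)"
      unfolding U by (rule card_Un_disjoint) (use finr in \<open>auto simp: r_def sq4_def\<close>)
    also have "card (\<Union>k\<in>{1..n}. r k) = (\<Sum>k\<in>{1..n}. card (r k))"
      by (rule card_UN_disjoint) (use finr in \<open>auto simp: r_def\<close>)
    finally show ?thesis unfolding C A_def by simp
  qed
  define E where "E n = A n - c * (real n)\<^sup>2" for n
  \<comment> \<open>For \<open>n \<ge> 1\<close> one has
    \<open>60 * (sqrt n + 1) ^ 3 \<le> 480 * n * sqrt n\<close>; one more unit pays for the origin,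
    which \<open>A\<close> omits. The omission makes \<open>E 0 = 0\<close>.\<close>
  define B where "B n = 481 * (real n * sqrt (real n))" for n
  have EB: "\<bar>E n\<bar> \<le> B n" for n
  proof (cases "n = 0")
    case False
    then have n1: "real n \<ge> 1" by simp
    have "\<bar>A n + 1 - c * (real n)\<^sup>2\<bar> \<le> 60 * (sqrt (real n) + 1) ^ 3"
      unfolding Acount c_def by (rule count_ball_divisible_sum(2)[OF D]) simp
    also have "\<dots> \<le> 60 * (sqrt (real n) + sqrt (real n)) ^ 3"
      using n1 by (intro mult_left_mono power_mono add_left_mono) auto
    also have "\<dots> = 480 * (real n * sqrt (real n))" by (simp add: power3_eq_cube)
    finally have "\<bar>E n\<bar> \<le> 480 * (real n * sqrt (real n)) + 1" unfolding E_def by linarith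
    moreover have "1 * 1 \<le> real n * sqrt (real n)" using n1 by (intro mult_mono) auto
    ultimately show ?thesis unfolding B_def by linarith
  qed (simp add: E_def A_def B_def)
  have fpos: "0 \<le> f n" if "n \<le> N" for n using that N by (simp add: f_def)
  have fdec: "f (Suc n) \<le> f n" if "1 \<le> n" "Suc n \<le> N" for n
    unfolding f_def using that N by (intro frac_le power_mono) auto
  have "\<bar>\<Sum>n=1..N. (E n - E (n - 1)) * f n\<bar> \<le> (\<Sum>n=1..N. (B n - B (n - 1)) * f n)"
    by (rule abel_bound) (use EB fpos fdec in \<open>auto simp: E_def B_def A_def\<close>)
  \<comment> \<open>The increments of \<open>n * sqrt n\<close> are at most
    \<open>3 * sqrt n\<close>, and this root cancels the denominator of \<open>f n\<close>.\<close>
  also have "\<dots> \<le> (\<Sum>n=1..N. 1443 * (Q * sqrt Q))"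
  proof (rule sum_mono)
    fix n assume n: "n \<in> {1..N}"
    define s t where st: "s = sqrt (real n)" "t = sqrt (real (n - 1))"
    have st0: "s > 0" "0 \<le> t" "t \<le> s" "s * s = real n" "t * t = real n - 1" using n by (auto simp: st)
    have "B n - B (n - 1) = 481 * (s ^ 3 - t ^ 3)"
      using n by (simp add: B_def st power3_eq_cube)
    also have "s ^ 3 - t ^ 3 \<le> (s * s - t * t) * (3 * s)" by (rule cube_diff_le[OF st0(2,3)])
    also have "\<dots> = 3 * s" using st0 by simp
    finally have b: "B n - B (n - 1) \<le> 1443 * s" by simp
    have "(B n - B (n - 1)) * f n \<le> 1443 * s * f n" using b fpos n by (intro mult_right_mono) auto
    also have "\<dots> = 1443 * sqrt (Q - real n) ^ 3" using st0(1) by (simp add: f_def st)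
    also have "\<dots> \<le> 1443 * sqrt Q ^ 3" using n N by (intro mult_left_mono power_mono) auto
    also have "\<dots> = 1443 * (Q * sqrt Q)" using Q by (simp add: power3_eq_cube)
    finally show "(B n - B (n - 1)) * f n \<le> 1443 * (Q * sqrt Q)" .
  qed
  also have "\<dots> = 1443 * (real N * (Q * sqrt Q))" by simp
  also have "\<dots> \<le> 1443 * (Q * (Q * sqrt Q))" using N Q by (intro mult_left_mono mult_right_mono) auto
  finally have X1: "\<bar>\<Sum>n=1..N. (E n - E (n - 1)) * f n\<bar> \<le> 1443 * (Q\<^sup>2 * sqrt Q)" by (simp add: power2_eq_square)
  \<comment> \<open>The identity \<open>n ^ 2 - (n - 1) ^ 2 = 2 * n - 1\<close> splits the main part
    into the radial sum and a lower order sum of \<open>f\<close>.\<close>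
  have "lat_sum D Q = (\<Sum>n=1..N. (E n - E (n - 1)) * f n + 2 * c * (sqrt (real n) * sqrt (Q - real n) ^ 3) - c * f n)"
    unfolding lat
  proof (rule sum.cong[OF refl])
    fix n assume n: "n \<in> {1..N}"
    then obtain k where k: "n = Suc k" by (cases n) auto
    have "A n - A (n - 1) = real (card (r n))" by (simp add: A_def k)
    then have rE: "real (card (r n)) = (E n - E (n - 1)) + c * (2 * real n - 1)"
      unfolding E_def by (simp add: k power2_eq_square algebra_simps)
    have "real (card (r n)) * f n = (E n - E (n - 1)) * f n + 2 * c * (real n * f n) - c * f n"
      unfolding rE by (simp add: algebra_simps)
    moreover have "real n * f n = sqrt (real n) * sqrt (Q - real n) ^ 3"
    proof -
      have "sqrt (real n) * sqrt (real n) = real n" "sqrt (real n) > 0" using n by auto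
      then show ?thesis unfolding f_def by (metis (no_types, opaque_lifting) mult.assoc mult.left_commute nonzero_mult_div_cancel_left less_irrefl times_divide_eq_right)
    qed
    ultimately show "real (card (r n)) * f n = (E n - E (n - 1)) * f n + 2 * c * (sqrt (real n) * sqrt (Q - real n) ^ 3) - c * f n"
      by (simp only:)
  qed
  also have "\<dots> = (\<Sum>n=1..N. (E n - E (n - 1)) * f n) + 2 * c * (\<Sum>n=1..N. sqrt (real n) * sqrt (Q - real n) ^ 3) - c * (\<Sum>n=1..N. f n)"
    by (simp add: sum.distrib sum_subtractf sum_distrib_left)
  finally have L: "lat_sum D Q = \<dots>" .
  have R: "\<bar>(\<Sum>n=1..N. sqrt (real n) * sqrt (Q - real n) ^ 3) - pi / 16 * Q ^ 3\<bar> \<le> 5 * Q\<^sup>2 * sqrt Q"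
    unfolding N_def by (rule radial_sum[OF Q1])
  have X2: "\<bar>2 * c * (\<Sum>n=1..N. sqrt (real n) * sqrt (Q - real n) ^ 3) - 2 * c * (pi / 16 * Q ^ 3)\<bar> \<le> 80 * (Q\<^sup>2 * sqrt Q)"
  proof -
    have "\<bar>2 * c * (\<Sum>n=1..N. sqrt (real n) * sqrt (Q - real n) ^ 3) - 2 * c * (pi / 16 * Q ^ 3)\<bar>
       = 2 * c * \<bar>(\<Sum>n=1..N. sqrt (real n) * sqrt (Q - real n) ^ 3) - pi / 16 * Q ^ 3\<bar>"
      using c by (simp only: right_diff_distrib[symmetric] abs_mult)
    also have "\<dots> \<le> 2 * 8 * (5 * Q\<^sup>2 * sqrt Q)" using c R by (intro mult_mono) auto
    finally show ?thesis by simp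
  qed
  have X3: "0 \<le> c * (\<Sum>n=1..N. f n)" using c fpos by (intro mult_nonneg_nonneg sum_nonneg) auto
  have X4: "c * (\<Sum>n=1..N. f n) \<le> 8 * (Q\<^sup>2 * sqrt Q)"
  proof -
    have "(\<Sum>n=1..N. f n) \<le> (\<Sum>n=1..N. Q * sqrt Q)"
    proof (rule sum_mono)
      fix n assume n: "n \<in> {1..N}"
      have "f n \<le> sqrt Q ^ 3 / 1" unfolding f_def using n N by (intro frac_le power_mono) auto
      then show "f n \<le> Q * sqrt Q" using Q by (simp add: power3_eq_cube)
    qed
    also have "\<dots> = real N * (Q * sqrt Q)" by simp
    also have "\<dots> \<le> Q * (Q * sqrt Q)" using N Q by (intro mult_right_mono) auto
    finally have "(\<Sum>n=1..N. f n) \<le> Q\<^sup>2 * sqrt Q" by (simp add: power2_eq_square)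
    then show ?thesis using c fpos Q by (intro mult_mono sum_nonneg) auto
  qed
  have "2 * c * (pi / 16 * Q ^ 3) = pi ^ 3 / (16 * real D) * Q ^ 3"
    by (simp add: c_def power3_eq_cube power2_eq_square)
  moreover have "0 \<le> Q\<^sup>2 * sqrt Q" using Q by auto
  ultimately show ?thesis using L X1 X2 X3 X4 by linarith
qed

section \<open>Primitive vectors\<close>

definition moebius :: "nat \<Rightarrow> real" where
  "moebius n = (if squarefree n then (- 1) ^ card (prime_factors n) else 0)"

lemma abs_moebius_le_1: "\<bar>moebius n\<bar> \<le> 1"
  by (simp add: moebius_def power_abs)

lemma moebius_1 [simp]: "moebius 1 = 1" "moebius (Suc 0) = 1"
  by (simp_all add: moebius_def)

lemma moebius_prime_mult:
  assumes "prime q" "n > 0"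
  shows "moebius (q * n) = (if q dvd n then 0 else - moebius n)"
proof (cases "q dvd n")
  case True
  then have "q ^ 2 dvd q * n" by (simp add: power2_eq_square)
  moreover have "\<not> is_unit q" using assms by auto
  ultimately have "\<not> squarefree (q * n)" unfolding squarefree_def by blast
  then show ?thesis using True by (simp add: moebius_def)
next
  case False
  have cop: "coprime q n" using assms False by (simp add: prime_imp_coprime)
  have "squarefree q" using assms by (simp add: squarefree_prime)
  then have "squarefree (q * n) \<longleftrightarrow> squarefree n"
    using cop squarefree_mult_coprime[OF cop] squarefree_multD(2) by blast
  moreover have "prime_factors (q * n) = insert q (prime_factors n)"
    using assms by (simp add: prime_factors_product prime_prime_factors)
  moreover have "q \<notin> prime_factors n" using False by auto
  ultimately show ?thesis using False by (simp add: moebius_def)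
qed

text \<open>For a prime \<open>q\<close> dividing \<open>n\<close>, the divisors prime to
  \<open>q\<close> cancel against their multiples by \<open>q\<close>; the remaining divisors
  contain \<open>q\<close> twice and contribute nothing.\<close>

lemma sum_moebius_divisors:
  assumes n: "n > 0"
  shows "(\<Sum>e | e dvd n. moebius e) = (if n = 1 then 1 else 0)"
proof (cases "n = 1")
  case False
  obtain q where q: "prime q" "q dvd n" using prime_factor_nat[OF False] by blast
  have q0: "q > 0" using q prime_gt_0_nat by auto
  let ?A = "{e. e dvd n \<and> \<not> q dvd e}"
  have fin: "finite {e. e dvd n}" using n by simp
  have finA: "finite ?A" by (rule finite_subset[OF _ fin]) auto
  have pos: "e > 0" if "e dvd n" for e using that n by (auto intro: Nat.gr0I)
  have "(\<Sum>e | e dvd n. moebius e) = (\<Sum>e\<in>?A \<union> (*) q ` ?A. moebius e)"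
  proof (rule sum.mono_neutral_right[OF fin])
    have "q * e dvd n" if "e dvd n" "\<not> q dvd e" for e
      using that q by (intro divides_mult) (auto simp: prime_imp_coprime)
    then show "?A \<union> (*) q ` ?A \<subseteq> {e. e dvd n}" by auto
    show "\<forall>e\<in>{e. e dvd n} - (?A \<union> (*) q ` ?A). moebius e = 0"
    proof
      fix e assume e: "e \<in> {e. e dvd n} - (?A \<union> (*) q ` ?A)"
      then obtain l where l: "e = q * l" by (auto elim: dvdE)
      have "l dvd n" using e l by (auto dest: dvd_mult_right)
      then have "q dvd l" using e l by auto
      then show "moebius e = 0" using moebius_prime_mult[OF q(1), of l] pos[OF \<open>l dvd n\<close>] l by simp
    qed
  qed
  also have "\<dots> = (\<Sum>e\<in>?A. moebius e) + (\<Sum>e\<in>(*) q ` ?A. moebius e)"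
    using finA by (intro sum.union_disjoint) auto
  also have "(\<Sum>e\<in>(*) q ` ?A. moebius e) = (\<Sum>e\<in>?A. moebius (q * e))"
    using q0 by (subst sum.reindex) (auto simp: inj_on_def)
  also have "\<dots> = (\<Sum>e\<in>?A. - moebius e)"
    using moebius_prime_mult[OF q(1)] pos by (intro sum.cong) auto
  finally show ?thesis using False by (simp add: sum_negf)
qed simp

section \<open>Comparison of infinite sums\<close>

lemma summable_on_inverse_power:
  assumes "s \<ge> 2"
  shows "(\<lambda>n::nat. c / real n ^ s) summable_on UNIV"
proof -
  have "summable (\<lambda>n. inverse (real n ^ s))" using inverse_power_summable[of s] assms by (simp add: power_inverse)
  then have "(\<lambda>n. inverse (real n ^ s)) summable_on UNIV"
    by (subst summable_on_UNIV_nonneg_real_iff) auto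
  then have "(\<lambda>n. c * inverse (real n ^ s)) summable_on UNIV" by (rule summable_on_cmult_right)
  then show ?thesis by (simp add: divide_inverse)
qed

lemma summable_on_inverse_power_bound:
  fixes f :: "nat \<Rightarrow> real"
  assumes "s \<ge> 2" and "\<And>n. \<bar>f n\<bar> \<le> c / real n ^ s"
  shows "f summable_on A"
proof -
  have "(\<lambda>n. norm (f n)) summable_on UNIV"
    by (rule summable_on_comparison_test[OF summable_on_inverse_power[OF assms(1), of c]]) (use assms(2) in auto)
  then have "f summable_on UNIV" by (rule abs_summable_summable)
  then show ?thesis by (rule summable_on_subset_banach) simp
qed

text \<open>The term at 0 vanishes by the convention \<open>1 / 0 = 0\<close>, so for
  \<open>s \<ge> 2\<close> this is the value of zeta at \<open>s\<close>.\<close>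

definition inv_powers :: "nat \<Rightarrow> real" where
  "inv_powers s = (\<Sum>\<^sub>\<infinity>n::nat. 1 / real n ^ s)"

text \<open>Both applications compare an exact sum of finite support with an infinite main series.
  The termwise bound also holds outside the support, hence the tail of the series needs no estimate
  of its own.\<close>

lemma infsum_diff_bound:
  fixes x y :: "nat \<Rightarrow> real"
  assumes "x summable_on UNIV" "y summable_on UNIV" and "s \<ge> 2" and b: "\<And>n. \<bar>x n - y n\<bar> \<le> c / real n ^ s"
  shows "\<bar>infsum x UNIV - infsum y UNIV\<bar> \<le> c * inv_powers s"
proof -
  have 1: "((\<lambda>n. x n - y n) has_sum (infsum x UNIV - infsum y UNIV)) UNIV"
    using has_sum_add[OF has_sum_infsum[OF assms(1)] has_sum_cmult_right[OF has_sum_infsum[OF assms(2)], of "-1"]]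
    by simp
  have "((\<lambda>n. 1 / real n ^ s) has_sum inv_powers s) UNIV"
    unfolding inv_powers_def by (intro has_sum_infsum summable_on_inverse_power assms)
  then have 2: "((\<lambda>n. c * (1 / real n ^ s)) has_sum c * inv_powers s) UNIV" by (rule has_sum_cmult_right)
  show ?thesis using norm_infsum_le[OF 1 2] b by simp
qed

section \<open>Moebius inversion over the gcd\<close>

definition gcd4 :: "int4 \<Rightarrow> int" where
  "gcd4 a = (case a of (a0, a1, a2, a3) \<Rightarrow> gcd a0 (gcd a1 (gcd a2 a3)))"

definition smul4 :: "int \<Rightarrow> int4 \<Rightarrow> int4" where
  "smul4 e a = (case a of (a0, a1, a2, a3) \<Rightarrow> (e * a0, e * a1, e * a2, e * a3))"

lemma sq4_smul4: "sq4 (smul4 e a) = e\<^sup>2 * sq4 a"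
  by (cases a) (simp add: sq4_def smul4_def power_mult_distrib algebra_simps)

lemma sum4_smul4: "sum4 (smul4 e a) = e * sum4 a"
  by (cases a) (simp add: sum4_def smul4_def algebra_simps)

lemma gcd4_smul4: "e > 0 \<Longrightarrow> gcd4 (smul4 e a) = e * gcd4 a"
  by (cases a) (simp add: gcd4_def smul4_def gcd_mult_left)

lemma smul4_inject: "e \<noteq> 0 \<Longrightarrow> smul4 e a = smul4 e b \<longleftrightarrow> a = b"
  by (cases a; cases b) (auto simp: smul4_def)

lemma dvd_gcd4_iff: "e dvd gcd4 a \<longleftrightarrow> (\<exists>b. a = smul4 e b)"
proof
  assume e: "e dvd gcd4 a"
  obtain a0 a1 a2 a3 where a: "a = (a0, a1, a2, a3)" by (metis prod_cases4)
  obtain b0 b1 b2 b3 where "a0 = e * b0" "a1 = e * b1" "a2 = e * b2" "a3 = e * b3"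
    using e unfolding a gcd4_def by (auto simp: gcd_greatest_iff elim!: dvdE)
  then have "a = smul4 e (b0, b1, b2, b3)" by (simp add: a smul4_def)
  then show "\<exists>b. a = smul4 e b" ..
qed (auto simp: gcd4_def smul4_def split: prod.splits)

lemma gcd4_eq_0_iff: "gcd4 a = 0 \<longleftrightarrow> sq4 a = 0"
  by (cases a) (simp add: gcd4_def sq4_eq_0_iff)

lemma gcd4_nonneg [simp]: "gcd4 a \<ge> 0"
  by (cases a) (simp add: gcd4_def)

lemma sq4_pos_iff: "sq4 a > 0 \<longleftrightarrow> sq4 a \<noteq> 0"
  using sq4_nonneg[of a] by linarith

lemma dvd_mult_gcd_div_iff:
  fixes d e :: nat and s :: int
  assumes "d > 0"
  shows "int d dvd int e * s \<longleftrightarrow> int (d div gcd d e) dvd s"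
proof -
  define g where "g = gcd d e"
  have g: "g > 0" using assms by (simp add: g_def)
  define d' e' where de: "d' = d div g" "e' = e div g"
  have d: "d = g * d'" and e: "e = g * e'" by (simp_all add: de g_def)
  have "coprime d' e'" using assms unfolding de g_def by (intro div_gcd_coprime) auto
  then have c: "coprime (int d') (int e')" by simp
  have "int d dvd int e * s \<longleftrightarrow> int g * int d' dvd int g * (int e' * s)"
    unfolding d e by (simp add: mult.assoc)
  also have "\<dots> \<longleftrightarrow> int d' dvd int e' * s" using g by simp
  also have "\<dots> \<longleftrightarrow> int d' dvd s" using c by (simp add: coprime_dvd_mult_right_iff)
  finally show ?thesis by (simp add: de g_def)
qed

definition prim_sum :: "nat \<Rightarrow> real \<Rightarrow> real" where
  "prim_sum d Q = (\<Sum>a | gcd4 a = 1 \<and> int d dvd sum4 a \<and> of_int (sq4 a) \<le> Q. wt Q a)"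

lemma wt_smul4:
  assumes "e > 0"
  shows "wt Q (smul4 e a) = (of_int e)\<^sup>2 * wt (Q / (of_int e)\<^sup>2) a"
proof -
  define r where "r = real_of_int e"
  have r: "r > 0" using assms by (simp add: r_def)
  have "Q - r\<^sup>2 * of_int (sq4 a) = r\<^sup>2 * (Q / r\<^sup>2 - of_int (sq4 a))" using r by (simp add: right_diff_distrib)
  then have "sqrt (Q - r\<^sup>2 * of_int (sq4 a)) = r * sqrt (Q / r\<^sup>2 - of_int (sq4 a))" using r by (simp add: real_sqrt_mult)
  moreover have "sqrt (r\<^sup>2 * of_int (sq4 a)) = r * sqrt (of_int (sq4 a))" using r by (simp add: real_sqrt_mult)
  ultimately have "wt Q (smul4 e a) = (r * sqrt (Q / r\<^sup>2 - of_int (sq4 a))) ^ 3 / (r * sqrt (of_int (sq4 a)))"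
    by (simp add: wt_def sq4_smul4 r_def)
  also have "\<dots> = r\<^sup>2 * (sqrt (Q / r\<^sup>2 - of_int (sq4 a)) ^ 3 / sqrt (of_int (sq4 a)))"
    using r by (simp add: power_mult_distrib power2_eq_square power3_eq_cube)
  finally show ?thesis by (simp add: wt_def r_def)
qed

text \<open>Primitivity is detected by the divisors \<open>e\<close> of \<open>gcd4 a\<close>, with
  \<open>a = smul4 e b\<close>. Replacing \<open>a\<close> by \<open>b\<close> divides
  \<open>Q\<close> by \<open>e ^ 2\<close>, multiplies the weight by \<open>e ^ 2\<close>, and
  relaxes the modulus \<open>d\<close> to \<open>d div gcd d e\<close>.\<close>

lemma prim_sum_eq:
  assumes d: "d > 0" and M: "Q < real M + 1"
  shows "prim_sum d Q = (\<Sum>e=1..M. moebius e * ((real e)\<^sup>2 * lat_sum (d div gcd d e) (Q / (real e)\<^sup>2)))"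
proof -
  let ?A = "{a. sq4 a > 0 \<and> int d dvd sum4 a \<and> real_of_int (sq4 a) \<le> Q}"
  have fin: "finite ?A" by (rule finite_subset[OF _ finite_sq4_le[of Q]]) auto
  \<comment> \<open>A generous range is enough:
    \<open>e \<le> e\<^sup>2 \<le> sq4 a \<le> Q\<close>.\<close>
  have le: "e \<in> {1..M}" if a: "a \<in> ?A" and e: "e dvd nat (gcd4 a)" for a e
  proof -
    have g: "gcd4 a > 0" using a gcd4_eq_0_iff[of a] gcd4_nonneg[of a] by (simp add: less_le)
    then have e1: "e \<ge> 1" using e by (auto intro!: Nat.gr0I simp: Suc_le_eq)
    have "int e dvd gcd4 a" using e g by (metis int_dvd_int_iff int_nat_eq less_imp_le)
    then obtain b where b: "a = smul4 (int e) b" unfolding dvd_gcd4_iff by blast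
    have "sq4 b > 0" using a by (auto simp: b sq4_smul4 zero_less_mult_iff)
    then have "1 * 1 \<le> int e * sq4 b" using e1 by (intro mult_mono) auto
    then have "int e * 1 \<le> int e * (int e * sq4 b)" using e1 by (intro mult_left_mono) auto
    then have "int e \<le> sq4 a" by (simp add: b sq4_smul4 power2_eq_square)
    then have "real_of_int (int e) \<le> real_of_int (sq4 a)" by (simp only: of_int_le_iff)
    then have "real e \<le> Q" using a by simp
    then show ?thesis using e1 M by auto
  qed
  have "prim_sum d Q = (\<Sum>a\<in>?A. if gcd4 a = 1 then wt Q a else 0)"
    unfolding prim_sum_def
  proof (subst sum.inter_filter[OF fin, symmetric], rule sum.cong)
    show "{a. gcd4 a = 1 \<and> int d dvd sum4 a \<and> real_of_int (sq4 a) \<le> Q} = {x \<in> ?A. gcd4 x = 1}"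
    proof -
      have "sq4 a > 0" if "gcd4 a = 1" for a using that gcd4_eq_0_iff[of a] by (simp add: sq4_pos_iff)
      then show ?thesis by blast
    qed
  qed simp
  also have "\<dots> = (\<Sum>a\<in>?A. \<Sum>e\<in>{e \<in> {1..M}. int e dvd gcd4 a}. wt Q a * moebius e)"
  proof (rule sum.cong[OF refl])
    fix a assume a: "a \<in> ?A"
    have g: "gcd4 a > 0" using a gcd4_eq_0_iff[of a] gcd4_nonneg[of a] by (simp add: less_le)
    have "{e \<in> {1..M}. int e dvd gcd4 a} = {e. e dvd nat (gcd4 a)}"
    proof -
      have "int e dvd gcd4 a \<longleftrightarrow> e dvd nat (gcd4 a)" for e
        using g by (metis int_dvd_int_iff int_nat_eq less_imp_le)
      then show ?thesis using le[OF a] by auto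
    qed
    then have "(\<Sum>e\<in>{e \<in> {1..M}. int e dvd gcd4 a}. wt Q a * moebius e) = wt Q a * (\<Sum>e | e dvd nat (gcd4 a). moebius e)"
      by (simp add: sum_distrib_left)
    also have "\<dots> = wt Q a * (if nat (gcd4 a) = 1 then 1 else 0)" using g by (subst sum_moebius_divisors) auto
    also have "\<dots> = (if gcd4 a = 1 then wt Q a else 0)" using g by auto
    finally show "(if gcd4 a = 1 then wt Q a else 0) = (\<Sum>e\<in>{e \<in> {1..M}. int e dvd gcd4 a}. wt Q a * moebius e)" ..
  qed
  also have "\<dots> = (\<Sum>e\<in>{1..M}. \<Sum>a\<in>{a \<in> ?A. int e dvd gcd4 a}. wt Q a * moebius e)"
    by (rule sum.swap_restrict[OF fin]) simp
  also have "\<dots> = (\<Sum>e=1..M. moebius e * ((real e)\<^sup>2 * lat_sum (d div gcd d e) (Q / (real e)\<^sup>2)))"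
  proof (rule sum.cong[OF refl])
    fix e assume e: "e \<in> {1..M}"
    then have e0: "int e > 0" "real e > 0" by auto
    let ?B = "{a. sq4 a > 0 \<and> int (d div gcd d e) dvd sum4 a \<and> real_of_int (sq4 a) \<le> Q / (real e)\<^sup>2}"
    have img: "{a \<in> ?A. int e dvd gcd4 a} = smul4 (int e) ` ?B"
    proof -
      have AB: "smul4 (int e) b \<in> ?A \<longleftrightarrow> b \<in> ?B" for b
      proof -
        have "real_of_int ((int e)\<^sup>2 * sq4 b) \<le> Q \<longleftrightarrow> real_of_int (sq4 b) \<le> Q / (real e)\<^sup>2"
          using e0 by (simp add: pos_le_divide_eq mult.commute)
        moreover have "(int e)\<^sup>2 * sq4 b > 0 \<longleftrightarrow> sq4 b > 0" using e0 by (simp add: zero_less_mult_iff)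
        ultimately show ?thesis
          by (simp only: mem_Collect_eq sq4_smul4 sum4_smul4 dvd_mult_gcd_div_iff[OF d])
      qed
      show ?thesis
      proof (intro equalityI subsetI)
        fix x assume x: "x \<in> {a \<in> ?A. int e dvd gcd4 a}"
        then obtain b where b: "x = smul4 (int e) b" unfolding dvd_gcd4_iff by blast
        then have "b \<in> ?B" using x AB by blast
        then show "x \<in> smul4 (int e) ` ?B" using b by blast
      next
        fix x assume "x \<in> smul4 (int e) ` ?B"
        then obtain b where b: "x = smul4 (int e) b" "b \<in> ?B" by blast
        then have "x \<in> ?A" using AB by blast
        then show "x \<in> {a \<in> ?A. int e dvd gcd4 a}" using b(1) dvd_gcd4_iff by blast
      qed
    qed
    have "(\<Sum>a\<in>{a \<in> ?A. int e dvd gcd4 a}. wt Q a * moebius e) = (\<Sum>b\<in>?B. wt Q (smul4 (int e) b) * moebius e)"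
      unfolding img using e0 by (subst sum.reindex) (auto simp: inj_on_def smul4_inject)
    also have "\<dots> = (\<Sum>b\<in>?B. moebius e * ((real e)\<^sup>2 * wt (Q / (real e)\<^sup>2) b))"
      using wt_smul4[OF e0(1)] by (intro sum.cong) auto
    also have "\<dots> = moebius e * ((real e)\<^sup>2 * lat_sum (d div gcd d e) (Q / (real e)\<^sup>2))"
      by (simp add: lat_sum_def sum_distrib_left)
    finally show "(\<Sum>a\<in>{a \<in> ?A. int e dvd gcd4 a}. wt Q a * moebius e) = moebius e * ((real e)\<^sup>2 * lat_sum (d div gcd d e) (Q / (real e)\<^sup>2))" .
  qed
  finally show ?thesis .
qed

text \<open>The main term for the modulus \<open>d div gcd d e\<close> has the factor
  \<open>gcd d e / d\<close>. The exponent 4 is what remains of \<open>e ^ 6\<close>, from the cube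
  of \<open>Q / e ^ 2\<close>, after the scaling factor \<open>e ^ 2\<close> of the weight.\<close>

definition prim_density :: "nat \<Rightarrow> real" where
  "prim_density d = (\<Sum>\<^sub>\<infinity>e. moebius e * real (gcd d e) / real e ^ 4) / real d"

lemma summable_prim_density:
  assumes "d > 0"
  shows "(\<lambda>e. moebius e * real (gcd d e) / real e ^ 4) summable_on A"
proof (rule summable_on_inverse_power_bound[where s = 4 and c = "real d"])
  fix e
  have "\<bar>moebius e\<bar> * real (gcd d e) \<le> 1 * real d"
    using assms abs_moebius_le_1 by (intro mult_mono) (auto intro: gcd_le1_nat)
  then show "\<bar>moebius e * real (gcd d e) / real e ^ 4\<bar> \<le> real d / real e ^ 4"
    by (simp add: abs_mult divide_right_mono)
qed simp

text \<open>The error at \<open>e\<close> is \<open>e ^ 2\<close> times that of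
  \<open>lat_sum\<close> at \<open>Q / e ^ 2\<close>, a multiple of
  \<open>Q\<^sup>2 * sqrt Q / e ^ 3\<close>, and this is summable.\<close>

lemma prim_sum_approx:
  assumes d: "d > 0" and Q: "Q \<ge> 0"
  shows "\<bar>prim_sum d Q - pi ^ 3 / 16 * prim_density d * Q ^ 3\<bar> \<le> 1600 * inv_powers 3 * (Q\<^sup>2 * sqrt Q)"
proof -
  define M where "M = nat \<lfloor>Q\<rfloor>"
  have M: "Q < real M + 1" using Q unfolding M_def by (simp add: of_nat_nat)
  define x where "x e = moebius e * ((real e)\<^sup>2 * lat_sum (d div gcd d e) (Q / (real e)\<^sup>2))" for e
  define y where "y e = pi ^ 3 / (16 * real d) * Q ^ 3 * (moebius e * real (gcd d e) / real e ^ 4)" for e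
  have x0: "x e = 0" if "e \<notin> {1..M}" for e
  proof (cases "e = 0")
    case False
    then have e: "real e \<ge> 1" "real e \<ge> real M + 1" using that by auto
    have "Q < real e * 1" using e M by linarith
    also have "\<dots> \<le> real e * real e" using e by (intro mult_left_mono) auto
    finally have "Q / (real e)\<^sup>2 < 1" using e by (simp add: power2_eq_square)
    then show ?thesis by (simp add: x_def lat_sum_eq_0)
  qed (simp add: x_def)
  have "infsum x UNIV = infsum x {1..M}" by (rule infsum_cong_neutral) (use x0 in auto)
  then have sx: "infsum x UNIV = prim_sum d Q" unfolding prim_sum_eq[OF d M] x_def by simp
  have xs: "x summable_on UNIV"
    using summable_on_cong_neutral[of UNIV "{1..M}" x x] x0 by auto
  have ys: "y summable_on UNIV"
    unfolding y_def by (intro summable_on_cmult_right summable_prim_density d)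
  have sy: "infsum y UNIV = pi ^ 3 / 16 * prim_density d * Q ^ 3"
    unfolding y_def by (subst infsum_cmult_right') (simp add: prim_density_def)
  have "\<bar>infsum x UNIV - infsum y UNIV\<bar> \<le> (1600 * (Q\<^sup>2 * sqrt Q)) * inv_powers 3"
  proof (rule infsum_diff_bound[OF xs ys])
    show "(2::nat) \<le> 3" by simp
  next
    fix e
    show "\<bar>x e - y e\<bar> \<le> 1600 * (Q\<^sup>2 * sqrt Q) / real e ^ 3"
    proof (cases "e = 0")
      case False
      then have e: "real e > 0" by simp
      define g where "g = gcd d e"
      have g: "g > 0" using d by (simp add: g_def)
      have D: "d div g > 0" "real (d div g) = real d / real g"
        using d by (auto simp: g_def real_of_nat_div div_greater_zero_iff intro: gcd_le1_nat)
      define L where "L = lat_sum (d div g) (Q / (real e)\<^sup>2)"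
      have "\<bar>L - pi ^ 3 / (16 * real (d div g)) * (Q / (real e)\<^sup>2) ^ 3\<bar> \<le> 1600 * ((Q / (real e)\<^sup>2)\<^sup>2 * sqrt (Q / (real e)\<^sup>2))"
        unfolding L_def by (rule lat_sum_approx[OF D(1)]) (use Q in auto)
      then have b: "(real e)\<^sup>2 * \<bar>L - pi ^ 3 / (16 * real (d div g)) * (Q / (real e)\<^sup>2) ^ 3\<bar> \<le> (real e)\<^sup>2 * (1600 * ((Q / (real e)\<^sup>2)\<^sup>2 * sqrt (Q / (real e)\<^sup>2)))"
        by (intro mult_left_mono) auto
      have "x e - y e = moebius e * ((real e)\<^sup>2 * (L - pi ^ 3 / (16 * real (d div g)) * (Q / (real e)\<^sup>2) ^ 3))"
        unfolding x_def y_def D(2) g_def[symmetric] L_def[symmetric] using e d g by (simp add: field_simps eval_nat_numeral)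
      then have "\<bar>x e - y e\<bar> = \<bar>moebius e\<bar> * ((real e)\<^sup>2 * \<bar>L - pi ^ 3 / (16 * real (d div g)) * (Q / (real e)\<^sup>2) ^ 3\<bar>)"
        by (simp add: abs_mult)
      also have "\<dots> \<le> 1 * ((real e)\<^sup>2 * (1600 * ((Q / (real e)\<^sup>2)\<^sup>2 * sqrt (Q / (real e)\<^sup>2))))"
        by (rule mult_mono[OF abs_moebius_le_1 b]) auto
      also have "\<dots> = 1600 * (Q\<^sup>2 * sqrt Q) / real e ^ 3"
        using e by (simp add: real_sqrt_divide field_simps eval_nat_numeral)
      finally show ?thesis .
    qed (simp add: x_def y_def)
  qed
  then show ?thesis unfolding sx sy by (simp only: mult_ac)
qed

section \<open>The density as an Euler product\<close>

text \<open>On squarefree \<open>e\<close> this is \<open>gcd d e\<close> when \<open>P\<close> is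
  the set of primes of \<open>d\<close>. In contrast to the gcd it depends on a set that can be
  built up one prime at a time.\<close>

definition prime_weight :: "nat set \<Rightarrow> nat \<Rightarrow> real" where
  "prime_weight P e = (\<Prod>p\<in>{p \<in> P. p dvd e}. real p)"

lemma gcd_squarefree:
  assumes d: "d > 0" and e: "squarefree e"
  shows "real (gcd d e) = prime_weight (prime_factors d) e"
proof -
  define g where "g = gcd d e"
  have g0: "g > 0" using d by (simp add: g_def)
  have e0: "e \<noteq> 0" using e by (intro notI) simp
  have sg: "squarefree g" using e by (rule squarefree_mono[rotated]) (simp add: g_def)
  have m: "multiplicity p g = 1" if "p \<in> prime_factors g" for p
  proof -
    have "prime p" "multiplicity p g > 0" using that by (auto simp: prime_factors_multiplicity)
    moreover have "multiplicity p g \<le> 1" using sg g0 \<open>prime p\<close> by (simp add: squarefree_factorial_semiring'')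
    ultimately show ?thesis by linarith
  qed
  have "g = (\<Prod>p\<in>prime_factors g. p ^ multiplicity p g)"
    using g0 by (intro prime_factorization_nat)
  also have "\<dots> = (\<Prod>p\<in>prime_factors g. p)" using m by (intro prod.cong) auto
  also have "prime_factors g = {p \<in> prime_factors d. p dvd e}"
    using d e0 g0 by (auto simp: prime_factors_dvd g_def)
  finally have "g = (\<Prod>p\<in>{p \<in> prime_factors d. p dvd e}. p)" .
  from arg_cong[OF this, of real] show ?thesis
    unfolding g_def[symmetric] prime_weight_def by (simp only: of_nat_prod)
qed

definition weighted_density :: "nat set \<Rightarrow> real" where
  "weighted_density P = (\<Sum>\<^sub>\<infinity>e. moebius e * prime_weight P e / real e ^ 4)"

lemma prime_weight_bound:
  assumes "finite P" "\<And>p. p \<in> P \<Longrightarrow> prime p"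
  shows "0 \<le> prime_weight P e" "prime_weight P e \<le> (\<Prod>p\<in>P. real p)"
proof -
  show "0 \<le> prime_weight P e" unfolding prime_weight_def by (intro prod_nonneg) auto
  have "1 \<le> real p" if "p \<in> P" for p using prime_ge_1_nat[OF assms(2)[OF that]] by simp
  then show "prime_weight P e \<le> (\<Prod>p\<in>P. real p)"
    unfolding prime_weight_def using assms(1) by (intro prod_mono2) auto
qed

lemma summable_weighted:
  assumes "finite P" "\<And>p. p \<in> P \<Longrightarrow> prime p"
  shows "(\<lambda>e. moebius e * prime_weight P e / real e ^ 4) summable_on A"
proof (rule summable_on_inverse_power_bound[where s = 4 and c = "\<Prod>p\<in>P. real p"])
  fix e
  have "\<bar>moebius e\<bar> * prime_weight P e \<le> 1 * (\<Prod>p\<in>P. real p)"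
    using prime_weight_bound[OF assms] abs_moebius_le_1 by (intro mult_mono) auto
  then show "\<bar>moebius e * prime_weight P e / real e ^ 4\<bar> \<le> (\<Prod>p\<in>P. real p) / real e ^ 4"
    using prime_weight_bound(1)[OF assms] by (simp add: abs_mult divide_right_mono)
qed simp

text \<open>Among the multiples \<open>q e\<close> of \<open>q\<close> only those with \<open>q\<close> not dividing \<open>e\<close> survive, and on them the Moebius function changes sign.\<close>
lemma weighted_density_split:
  assumes P: "finite P" "\<And>p. p \<in> P \<Longrightarrow> prime p" and q: "prime q"
  shows "weighted_density P = (1 - prime_weight P q / real q ^ 4)
    * (\<Sum>\<^sub>\<infinity>e\<in>{e. \<not> q dvd e}. moebius e * prime_weight P e / real e ^ 4)"
proof -
  let ?f = "\<lambda>e. moebius e * prime_weight P e / real e ^ 4"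
  let ?N = "{e. \<not> q dvd e}"
  have q0: "q > 0" using q prime_gt_0_nat by auto
  have mu: "moebius (q * e) = - moebius e" if "\<not> q dvd e" for e
    using moebius_prime_mult[OF q, of e] that by (cases "e = 0") auto
  have w: "prime_weight P (q * e) = prime_weight P q * prime_weight P e" if "\<not> q dvd e" for e
  proof -
    have "{p \<in> P. p dvd q * e} = {p \<in> P. p dvd q} \<union> {p \<in> P. p dvd e}"
      using P(2) by (auto simp: prime_dvd_mult_iff)
    moreover have "{p \<in> P. p dvd q} \<inter> {p \<in> P. p dvd e} = {}"
    proof -
      have "x = q" if "x \<in> P" "x dvd q" for x using P(2)[OF that(1)] q that(2) by (rule primes_dvd_imp_eq)
      then show ?thesis using that by auto
    qed
    ultimately show ?thesis unfolding prime_weight_def using P(1) by (simp add: prod.union_disjoint)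
  qed
  have inj: "inj_on ((*) q) ?N" using q0 by (auto simp: inj_on_def)
  have "weighted_density P = infsum ?f (?N \<union> (*) q ` ?N)"
    unfolding weighted_density_def
  proof (rule infsum_cong_neutral)
    fix e assume e: "e \<in> UNIV - (?N \<union> (*) q ` ?N)"
    then obtain l where l: "e = q * l" by (auto elim: dvdE)
    then have "q dvd l" using e by auto
    then show "?f e = 0" using moebius_prime_mult[OF q, of l] l by (cases "l = 0") auto
  qed auto
  also have "\<dots> = infsum ?f ?N + infsum ?f ((*) q ` ?N)"
    by (rule infsum_Un_disjoint) (use summable_weighted[OF P] in auto)
  also have "infsum ?f ((*) q ` ?N) = (\<Sum>\<^sub>\<infinity>e\<in>?N. ?f (q * e))"
    using infsum_reindex[OF inj, of ?f] by (simp add: o_def)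
  also have "\<dots> = (\<Sum>\<^sub>\<infinity>e\<in>?N. - (prime_weight P q / real q ^ 4) * ?f e)"
    by (rule infsum_cong) (use mu w in \<open>auto simp: power_mult_distrib\<close>)
  also have "\<dots> = - (prime_weight P q / real q ^ 4) * infsum ?f ?N" by (rule infsum_cmult_right')
  finally show ?thesis by (simp add: left_diff_distrib)
qed

text \<open>Adding \<open>q\<close> to \<open>P\<close> changes the weights of multiples of
  \<open>q\<close> only. After \<open>weighted_density_split\<close> both densities share the sum
  over \<open>e\<close> prime to \<open>q\<close>, and their quotient is that of the two factors at
  \<open>q\<close>.\<close>

lemma weighted_density_insert:
  assumes P: "finite P" "\<And>p. p \<in> P \<Longrightarrow> prime p" and q: "prime q" "q \<notin> P"
  shows "weighted_density (insert q P) = (1 - 1 / real q ^ 3) / (1 - 1 / real q ^ 4) * weighted_density P"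
proof -
  let ?S = "\<lambda>P. \<Sum>\<^sub>\<infinity>e\<in>{e. \<not> q dvd e}. moebius e * prime_weight P e / real e ^ 4"
  have q1: "real q > 1" using q prime_gt_1_nat by auto
  have eqq: "x = q" if "x \<in> P" "x dvd q" for x using P(2)[OF that(1)] q(1) that(2) by (rule primes_dvd_imp_eq)
  have w1: "prime_weight P q = 1"
  proof -
    have e: "{p \<in> P. p dvd q} = {}" using eqq q(2) by auto
    show ?thesis unfolding prime_weight_def e by simp
  qed
  have w2: "prime_weight (insert q P) q = real q"
  proof -
    have e: "{p \<in> insert q P. p dvd q} = {q}" using eqq q(2) by auto
    show ?thesis unfolding prime_weight_def e by simp
  qed
  have S: "?S (insert q P) = ?S P"
  proof (rule infsum_cong)
    fix e assume "e \<in> {e. \<not> q dvd e}"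
    then have "{p \<in> insert q P. p dvd e} = {p \<in> P. p dvd e}" by auto
    then show "moebius e * prime_weight (insert q P) e / real e ^ 4 = moebius e * prime_weight P e / real e ^ 4"
      by (simp add: prime_weight_def)
  qed
  have "weighted_density (insert q P) = (1 - real q / real q ^ 4) * ?S P"
    using weighted_density_split[of "insert q P" q] P q w2 S by auto
  moreover have "weighted_density P = (1 - 1 / real q ^ 4) * ?S P"
    using weighted_density_split[OF P q(1)] w1 by simp
  moreover have "1 - 1 / real q ^ 4 \<noteq> 0"
  proof -
    have "1 < real q ^ 4" using q1 by (intro one_less_power) auto
    then show ?thesis by simp
  qed
  moreover have "real q / real q ^ 4 = 1 / real q ^ 3" using q1 by (simp add: eval_nat_numeral)
  moreover have "A = u / v * B" if "A = u * S" "B = v * S" "v \<noteq> 0" for A B u v S :: real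
    using that by simp
  ultimately show ?thesis by metis
qed

lemma infsum_inverse_fourth_powers: "(\<Sum>\<^sub>\<infinity>k::nat. 1 / real k ^ 4) = pi ^ 4 / 90"
proof -
  have "(\<lambda>k. 1 / real k ^ 4) sums (pi ^ 4 / 90)"
    using inverse_fourth_powers_sums sums_Suc_iff[of "\<lambda>k. 1 / real k ^ 4"] by simp
  moreover have "summable (\<lambda>k. norm (1 / real k ^ 4))"
    using \<open>(\<lambda>k. 1 / real k ^ 4) sums (pi ^ 4 / 90)\<close> by (simp add: sums_iff)
  ultimately show ?thesis by (intro infsumI norm_summable_imp_has_sum)
qed

text \<open>Multiplied by the value of zeta at 4 this becomes a sum over pairs
  \<open>(e, k)\<close>. Collected by the product \<open>n = e * k\<close> it consists of divisor
  sums of \<open>moebius\<close>, of which only that of \<open>n = 1\<close> survives.\<close>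

lemma weighted_density_empty: "weighted_density {} = 90 / pi ^ 4"
proof -
  let ?Z = "\<Sum>\<^sub>\<infinity>k::nat. 1 / real k ^ 4"
  define h where "h = (\<lambda>(e::nat, k::nat). moebius e / real e ^ 4 * (1 / real k ^ 4))"
  have one: "(\<lambda>k::nat. 1 / real k ^ 4) summable_on UNIV" by (rule summable_on_inverse_power) simp
  have absh: "(\<lambda>(e::nat, k::nat). 1 / real e ^ 4 * (1 / real k ^ 4)) summable_on (UNIV \<times> UNIV)"
  proof (rule summable_on_SigmaI)
    show "((\<lambda>k. case (e, k) of (e, k) \<Rightarrow> 1 / real e ^ 4 * (1 / real k ^ 4)) has_sum 1 / real e ^ 4 * ?Z) UNIV" for e :: nat
      unfolding prod.case by (rule has_sum_cmult_right[OF has_sum_infsum[OF one]])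
    show "(\<lambda>e::nat. 1 / real e ^ 4 * ?Z) summable_on UNIV" by (intro summable_on_cmult_left one)
  qed auto
  have hs: "h summable_on (UNIV \<times> UNIV)"
  proof (rule abs_summable_summable, rule summable_on_comparison_test[OF absh])
    fix x :: "nat \<times> nat"
    obtain e k where x: "x = (e, k)" by (cases x)
    have "\<bar>moebius e\<bar> / real e ^ 4 * (1 / real k ^ 4) \<le> 1 / real e ^ 4 * (1 / real k ^ 4)"
      using abs_moebius_le_1 by (intro mult_right_mono divide_right_mono) auto
    then show "norm (h x) \<le> (case x of (e, k) \<Rightarrow> 1 / real e ^ 4 * (1 / real k ^ 4))"
      by (simp add: h_def x abs_mult)
  qed auto
  have "weighted_density {} * ?Z = (\<Sum>\<^sub>\<infinity>e. moebius e / real e ^ 4 * ?Z)"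
    unfolding infsum_cmult_left' by (simp add: weighted_density_def prime_weight_def)
  also have "\<dots> = (\<Sum>\<^sub>\<infinity>e. \<Sum>\<^sub>\<infinity>k. h (e, k))"
    unfolding h_def prod.case infsum_cmult_right' ..
  also have "\<dots> = infsum h (UNIV \<times> UNIV)" by (rule infsum_Sigma_banach[OF hs])
  also have "\<dots> = infsum h ({e. e > 0} \<times> {k. k > 0})"
    by (rule infsum_cong_neutral) (auto simp: h_def)
  also have "\<dots> = infsum (\<lambda>(n, e). moebius e / real n ^ 4) (Sigma {n. n > 0} (\<lambda>n. {e. e dvd n}))"
  proof (rule infsum_reindex_bij_witness[where i = "\<lambda>(n, e). (e, n div e)" and j = "\<lambda>(e, k). (e * k, e)"])
    fix b :: "nat \<times> nat" assume "b \<in> Sigma {n. n > 0} (\<lambda>n. {e. e dvd n})"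
    then show "(case case b of (n, e) \<Rightarrow> (e, n div e) of (e, k) \<Rightarrow> (e * k, e)) = b"
      "(case b of (n, e) \<Rightarrow> (e, n div e)) \<in> {e. e > 0} \<times> {k. k > 0}"
      by (auto simp: dvd_def)
  qed (auto simp: h_def power_mult_distrib)
  also have "\<dots> = (\<Sum>\<^sub>\<infinity>n\<in>{n. n > 0}. \<Sum>\<^sub>\<infinity>e\<in>{e. e dvd n}. moebius e / real n ^ 4)"
  proof (subst infsum_Sigma_banach[symmetric])
    have "(\<lambda>(n, e). moebius e / real n ^ 4) summable_on (Sigma {n. n > 0} (\<lambda>n. {e. e dvd n})) \<longleftrightarrow> h summable_on ({e. e > 0} \<times> {k. k > 0})"
    proof (rule summable_on_reindex_bij_witness[where j = "\<lambda>(n, e). (e, n div e)" and i = "\<lambda>(e, k). (e * k, e)"])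
      fix b :: "nat \<times> nat" assume "b \<in> Sigma {n. n > 0} (\<lambda>n. {e. e dvd n})"
      then show "(case case b of (n, e) \<Rightarrow> (e, n div e) of (e, k) \<Rightarrow> (e * k, e)) = b"
        "(case b of (n, e) \<Rightarrow> (e, n div e)) \<in> {e. e > 0} \<times> {k. k > 0}"
        "h (case b of (n, e) \<Rightarrow> (e, n div e)) = (case b of (n, e) \<Rightarrow> moebius e / real n ^ 4)"
        by (auto simp: dvd_def h_def power_mult_distrib)
    qed auto
    then show "(\<lambda>(n, e). moebius e / real n ^ 4) summable_on (Sigma {n. n > 0} (\<lambda>n. {e. e dvd n}))"
      using summable_on_subset_banach[OF hs] by auto
  qed simp
  also have "\<dots> = (\<Sum>\<^sub>\<infinity>n\<in>{n::nat. n > 0}. if n = 1 then 1 else 0)"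
  proof (rule infsum_cong)
    fix n :: nat assume n: "n \<in> {n. n > 0}"
    have "(\<Sum>\<^sub>\<infinity>e\<in>{e. e dvd n}. moebius e / real n ^ 4) = (\<Sum>e | e dvd n. moebius e) / real n ^ 4"
      using n by (simp add: sum_divide_distrib)
    also have "\<dots> = (if n = 1 then 1 else 0)" using n by (subst sum_moebius_divisors) auto
    finally show "(\<Sum>\<^sub>\<infinity>e\<in>{e. e dvd n}. moebius e / real n ^ 4) = (if n = 1 then 1 else 0)" .
  qed
  also have "\<dots> = (\<Sum>\<^sub>\<infinity>n\<in>{1::nat}. 1)" by (rule infsum_cong_neutral) auto
  also have "\<dots> = 1" by simp
  finally show ?thesis unfolding infsum_inverse_fourth_powers by (simp add: field_simps)
qed

lemma weighted_density_eq:
  assumes "finite P" "\<And>p. p \<in> P \<Longrightarrow> prime p"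
  shows "weighted_density P = 90 / pi ^ 4 * (\<Prod>p\<in>P. (1 - 1 / real p ^ 3) / (1 - 1 / real p ^ 4))"
  using assms
proof (induction P rule: finite_induct)
  case (insert q P)
  define r where "r p = (1 - 1 / real p ^ 3) / (1 - 1 / real p ^ 4)" for p
  have "weighted_density (insert q P) = r q * weighted_density P"
    unfolding r_def by (rule weighted_density_insert) (use insert in auto)
  also have "weighted_density P = 90 / pi ^ 4 * (\<Prod>p\<in>P. r p)" using insert by (simp add: r_def)
  also have "r q * (90 / pi ^ 4 * (\<Prod>p\<in>P. r p)) = 90 / pi ^ 4 * (\<Prod>p\<in>insert q P. r p)"
    using insert.hyps by simp
  finally show ?case by (simp only: r_def)
qed (simp add: weighted_density_empty)

lemma prim_density_eq:
  assumes "d > 0"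
  shows "prim_density d = 90 / pi ^ 4 / real d * (\<Prod>p\<in>prime_factors d. (1 - 1 / real p ^ 3) / (1 - 1 / real p ^ 4))"
proof -
  \<comment> \<open>The gcd and the weight may differ where \<open>e\<close> is not squarefree, but
    there \<open>moebius\<close> vanishes.\<close>
  have "(\<Sum>\<^sub>\<infinity>e. moebius e * real (gcd d e) / real e ^ 4) = weighted_density (prime_factors d)"
    unfolding weighted_density_def
    by (rule infsum_cong) (use gcd_squarefree[OF assms] in \<open>auto simp: moebius_def\<close>)
  also have "\<dots> = 90 / pi ^ 4 * (\<Prod>p\<in>prime_factors d. (1 - 1 / real p ^ 3) / (1 - 1 / real p ^ 4))"
    by (rule weighted_density_eq) auto
  finally show ?thesis unfolding prim_density_def by (simp only: times_divide_eq_left)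
qed

section \<open>Pairs of representations\<close>

text \<open>With \<open>m = k - 2\<close>, completing the square gives \<open>8 m \<Sum> p\<^sub>k(y\<^sub>i) + 4 (m - 2)^2 = shifted_norm m y\<close>.\<close>
definition shifted_norm :: "int \<Rightarrow> int4 \<Rightarrow> int" where
  "shifted_norm m y = (case y of (y0, y1, y2, y3) \<Rightarrow>
     (2 * m * y0 - (m - 2))\<^sup>2 + (2 * m * y1 - (m - 2))\<^sup>2 + (2 * m * y2 - (m - 2))\<^sup>2 + (2 * m * y3 - (m - 2))\<^sup>2)"

lemma r4_eq_card:
  assumes m: "m \<ge> 1"
  shows "r4 (m + 2) N = card {y. shifted_norm m y = 8 * m * int N + 4 * (m - 2)\<^sup>2}"
proof -
  have key: "polygonal (m + 2) y0 + polygonal (m + 2) y1 + polygonal (m + 2) y2 + polygonal (m + 2) y3 = real N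
     \<longleftrightarrow> shifted_norm m (y0, y1, y2, y3) = 8 * m * int N + 4 * (m - 2)\<^sup>2" for y0 y1 y2 y3
  proof -
    define M where "M = real_of_int m"
    have M: "M > 0" using m by (simp add: M_def)
    have one: "8 * M * polygonal (m + 2) x = of_int ((2 * m * x - (m - 2))\<^sup>2) - (M - 2)\<^sup>2" for x
    proof -
      have "2 * polygonal (m + 2) x = M * (of_int x)\<^sup>2 - (M - 2) * of_int x"
        by (simp add: polygonal_def M_def)
      then have "4 * M * (2 * polygonal (m + 2) x) = 4 * M * (M * (of_int x)\<^sup>2 - (M - 2) * of_int x)" by simp
      then show ?thesis by (simp add: M_def power2_eq_square algebra_simps)
    qed
    have "polygonal (m + 2) y0 + polygonal (m + 2) y1 + polygonal (m + 2) y2 + polygonal (m + 2) y3 = real N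
       \<longleftrightarrow> 8 * M * (polygonal (m + 2) y0 + polygonal (m + 2) y1 + polygonal (m + 2) y2 + polygonal (m + 2) y3) = 8 * M * real N"
      using M by simp
    also have "\<dots> \<longleftrightarrow> real_of_int (shifted_norm m (y0, y1, y2, y3)) = real_of_int (8 * m * int N + 4 * (m - 2)\<^sup>2)"
    proof -
      have lin: "(q0 - c + (q1 - c) + (q2 - c) + (q3 - c) = w) = (q0 + q1 + q2 + q3 = w + 4 * c)" for q0 q1 q2 q3 c w :: real
        by auto
      have rhs: "real_of_int (8 * m * int N + 4 * (m - 2)\<^sup>2) = 8 * M * real N + 4 * (M - 2)\<^sup>2" by (simp add: M_def)
      show ?thesis unfolding distrib_left one lin shifted_norm_def prod.case of_int_add rhs[unfolded of_int_add] ..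
    qed
    also have "\<dots> \<longleftrightarrow> shifted_norm m (y0, y1, y2, y3) = 8 * m * int N + 4 * (m - 2)\<^sup>2" by (rule of_int_eq_iff)
    finally show ?thesis .
  qed
  have "{(x1, x2, x3, x4). polygonal (m + 2) x1 + polygonal (m + 2) x2 + polygonal (m + 2) x3 + polygonal (m + 2) x4 = real N}
    = {y. shifted_norm m y = 8 * m * int N + 4 * (m - 2)\<^sup>2}"
  proof (rule set_eqI)
    fix y :: int4
    obtain y0 y1 y2 y3 where y: "y = (y0, y1, y2, y3)" by (metis prod_cases4)
    show "y \<in> {(x1, x2, x3, x4). polygonal (m + 2) x1 + polygonal (m + 2) x2 + polygonal (m + 2) x3 + polygonal (m + 2) x4 = real N}
      \<longleftrightarrow> y \<in> {y. shifted_norm m y = 8 * m * int N + 4 * (m - 2)\<^sup>2}"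
      unfolding y mem_Collect_eq prod.case key ..
  qed
  then show ?thesis by (simp add: r4_def)
qed

text \<open>With \<open>t = x * (x - 1) / 2\<close> the polygonal number at \<open>x\<close> is
  \<open>m * t + x\<close>. It is nonnegative since \<open>m \<ge> 1\<close> and both
  \<open>t\<close> and \<open>t + x = x * (x + 1) / 2\<close> are nonnegative. Thus bounding the
  shifted norm amounts to bounding the represented number.\<close>

lemma shifted_norm_value:
  assumes m: "m \<ge> 1"
  obtains N :: nat where "shifted_norm m y = 8 * m * int N + 4 * (m - 2)\<^sup>2"
proof -
  have one: "\<exists>n\<ge>0. (2 * m * x - (m - 2))\<^sup>2 = 8 * m * n + (m - 2)\<^sup>2" for x
  proof -
    have "even (x * (x - 1))" by auto
    then obtain t where t: "x * (x - 1) = 2 * t" by (elim evenE)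
    have "0 \<le> x * (x - 1)" "0 \<le> x * (x + 1)" by (simp_all add: zero_le_mult_iff) linarith+
    then have t0: "0 \<le> t" "0 \<le> t + x" using t by (simp_all add: algebra_simps)
    have "1 * t \<le> m * t" using m t0 by (intro mult_right_mono) auto
    then have "0 \<le> m * t + x" using t0 by linarith
    moreover have "(2 * m * x - (m - 2))\<^sup>2 = 8 * m * (m * t + x) + (m - 2)\<^sup>2"
    proof -
      have "(2 * m * x - (m - 2))\<^sup>2 = 4 * m * m * (x * (x - 1)) + 8 * m * x + (m - 2)\<^sup>2"
        by (simp add: power2_eq_square algebra_simps)
      then show ?thesis unfolding t by (simp add: algebra_simps)
    qed
    ultimately show ?thesis by blast
  qed
  obtain y0 y1 y2 y3 where y: "y = (y0, y1, y2, y3)" by (metis prod_cases4)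
  obtain n0 where n0: "n0 \<ge> 0" "(2 * m * y0 - (m - 2))\<^sup>2 = 8 * m * n0 + (m - 2)\<^sup>2" using one by blast
  obtain n1 where n1: "n1 \<ge> 0" "(2 * m * y1 - (m - 2))\<^sup>2 = 8 * m * n1 + (m - 2)\<^sup>2" using one by blast
  obtain n2 where n2: "n2 \<ge> 0" "(2 * m * y2 - (m - 2))\<^sup>2 = 8 * m * n2 + (m - 2)\<^sup>2" using one by blast
  obtain n3 where n3: "n3 \<ge> 0" "(2 * m * y3 - (m - 2))\<^sup>2 = 8 * m * n3 + (m - 2)\<^sup>2" using one by blast
  have "shifted_norm m y = 8 * m * int (nat (n0 + n1 + n2 + n3)) + 4 * (m - 2)\<^sup>2"
    unfolding shifted_norm_def y prod.case n0(2) n1(2) n2(2) n3(2) using n0 n1 n2 n3 by (simp add: algebra_simps)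
  then show thesis by (rule that)
qed

lemma shifted_coordinate_bound:
  fixes m x K :: int
  assumes m: "m \<ge> 1" and K: "K \<ge> 0" and le: "(2 * m * x - (m - 2))\<^sup>2 < (K + 1)\<^sup>2"
  shows "\<bar>x\<bar> \<le> K"
proof (rule ccontr)
  assume "\<not> \<bar>x\<bar> \<le> K"
  then have x: "K + 1 \<le> \<bar>x\<bar>" by simp
  have "\<bar>2 * m * x - (m - 2)\<bar> < \<bar>K + 1\<bar>" 
  proof -
    have "\<bar>2 * m * x - (m - 2)\<bar>\<^sup>2 < (K + 1)\<^sup>2" using le by simp
    then have "\<bar>2 * m * x - (m - 2)\<bar> < K + 1" by (rule power2_less_imp_less) (use K in simp)
    then show ?thesis by simp
  qed
  then have "\<bar>2 * m * x - (m - 2)\<bar> \<le> K" using K by simp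
  moreover have "\<bar>m - 2\<bar> \<le> m" using m by simp
  ultimately have "\<bar>2 * m * x\<bar> \<le> K + m" by linarith
  moreover have "\<bar>2 * m * x\<bar> = 2 * m * \<bar>x\<bar>" using m by (simp add: abs_mult)
  moreover have "2 * m * (K + 1) \<le> 2 * m * \<bar>x\<bar>" using x m by (intro mult_left_mono) auto
  moreover have "1 * K \<le> m * K" using m K by (intro mult_right_mono) auto
  ultimately show False using m K by (simp add: algebra_simps)
qed

definition box4 :: "int \<Rightarrow> int4 set" where
  "box4 K = {-K..K} \<times> {-K..K} \<times> {-K..K} \<times> {-K..K}"

lemma finite_box4 [simp]: "finite (box4 K)"
  by (simp add: box4_def)

lemma shifted_norm_le_box:
  assumes m: "m \<ge> 1" and K: "K \<ge> 0" "T < (K + 1)\<^sup>2" and y: "shifted_norm m y \<le> T"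
  shows "y \<in> box4 K"
proof -
  obtain y0 y1 y2 y3 where yy: "y = (y0, y1, y2, y3)" by (metis prod_cases4)
  have s: "(2 * m * y0 - (m - 2))\<^sup>2 + (2 * m * y1 - (m - 2))\<^sup>2 + (2 * m * y2 - (m - 2))\<^sup>2 + (2 * m * y3 - (m - 2))\<^sup>2 < (K + 1)\<^sup>2"
    using y K by (simp add: shifted_norm_def yy)
  have nn: "0 \<le> (2 * m * y0 - (m - 2))\<^sup>2" "0 \<le> (2 * m * y1 - (m - 2))\<^sup>2" "0 \<le> (2 * m * y2 - (m - 2))\<^sup>2" "0 \<le> (2 * m * y3 - (m - 2))\<^sup>2" by simp_all
  have "\<bar>y0\<bar> \<le> K" "\<bar>y1\<bar> \<le> K" "\<bar>y2\<bar> \<le> K" "\<bar>y3\<bar> \<le> K"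
    by (rule shifted_coordinate_bound[OF m K(1)]; use s nn in linarith)+
  then show ?thesis by (simp add: box4_def yy abs_le_iff)
qed

lemma finite_shifted_norm_le: "m \<ge> 1 \<Longrightarrow> finite {y. shifted_norm m y \<le> T}"
proof (rule finite_subset[OF _ finite_box4])
  assume m: "m \<ge> 1"
  have T: "T < (\<bar>T\<bar> + 1)\<^sup>2" 
  proof -
    have "(\<bar>T\<bar> + 1)\<^sup>2 = \<bar>T\<bar> * \<bar>T\<bar> + 2 * \<bar>T\<bar> + 1" by (simp add: power2_eq_square algebra_simps)
    moreover have "0 \<le> \<bar>T\<bar> * \<bar>T\<bar>" by simp
    ultimately show ?thesis by linarith
  qed
  show "{y. shifted_norm m y \<le> T} \<subseteq> box4 \<bar>T\<bar>"
  proof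
    fix y assume "y \<in> {y. shifted_norm m y \<le> T}"
    then show "y \<in> box4 \<bar>T\<bar>" by (intro shifted_norm_le_box[OF m _ T]) simp_all
  qed
qed

definition norm_pairs :: "int \<Rightarrow> int \<Rightarrow> (int4 \<times> int4) set" where
  "norm_pairs m T = {(x, y). shifted_norm m x = shifted_norm m y \<and> shifted_norm m y \<le> T}"

lemma sum_r4_squares:
  assumes m: "m \<ge> 1"
  shows "(\<Sum>N\<le>n. (r4 (m + 2) N)\<^sup>2) = card (norm_pairs m (8 * m * int n + 4 * (m - 2)\<^sup>2))"
proof -
  define S where "S N = {y. shifted_norm m y = 8 * m * int N + 4 * (m - 2)\<^sup>2}" for N
  have finS: "finite (S N)" for N
    by (rule finite_subset[OF _ finite_shifted_norm_le[OF m, of "8 * m * int N + 4 * (m - 2)\<^sup>2"]]) (auto simp: S_def)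
  have eq: "(norm_pairs m (8 * m * int n + 4 * (m - 2)\<^sup>2)) = (\<Union>N\<in>{..n}. S N \<times> S N)" (is "?L = ?R")
  proof (intro equalityI subsetI)
    fix w assume "w \<in> ?L"
    then obtain x y where w: "w = (x, y)" "shifted_norm m x = shifted_norm m y" "shifted_norm m y \<le> 8 * m * int n + 4 * (m - 2)\<^sup>2" unfolding norm_pairs_def by blast
    obtain N where N: "shifted_norm m y = 8 * m * int N + 4 * (m - 2)\<^sup>2" using shifted_norm_value[OF m] by blast
    have "8 * m * int N \<le> 8 * m * int n" using w(3) N by simp
    then have "N \<le> n" using m by simp
    then show "w \<in> ?R" using w(1,2) N by (auto simp: S_def)
  next
    fix w assume "w \<in> ?R"
    then obtain N x y where w: "N \<le> n" "w = (x, y)" "x \<in> S N" "y \<in> S N" by blast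
    have "m * int N \<le> m * int n" using w(1) m by (intro mult_left_mono) auto
    then show "w \<in> ?L" using w by (simp add: S_def norm_pairs_def)
  qed
  have "card (\<Union>N\<in>{..n}. S N \<times> S N) = (\<Sum>N\<le>n. card (S N \<times> S N))"
  proof (rule card_UN_disjoint)
    show "\<forall>i\<in>{..n}. \<forall>j\<in>{..n}. i \<noteq> j \<longrightarrow> S i \<times> S i \<inter> S j \<times> S j = {}"
    proof (intro ballI impI)
      fix i j :: nat assume "i \<noteq> j"
      then have "S i \<inter> S j = {}" using m by (auto simp: S_def)
      then show "S i \<times> S i \<inter> S j \<times> S j = {}" by blast
    qed
  qed (use finS in auto)
  then show ?thesis unfolding eq using r4_eq_card[OF m] by (simp add: S_def card_cartesian_product power2_eq_square)
qed

section \<open>Pairs sorted by their difference\<close>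

definition add4 :: "int4 \<Rightarrow> int4 \<Rightarrow> int4" where
  "add4 x y = (case x of (x0, x1, x2, x3) \<Rightarrow> case y of (y0, y1, y2, y3) \<Rightarrow> (x0 + y0, x1 + y1, x2 + y2, x3 + y3))"

definition dot4 :: "int4 \<Rightarrow> int4 \<Rightarrow> int" where
  "dot4 x y = (case x of (x0, x1, x2, x3) \<Rightarrow> case y of (y0, y1, y2, y3) \<Rightarrow> x0 * y0 + x1 * y1 + x2 * y2 + x3 * y3)"

definition fiber :: "int \<Rightarrow> int4 \<Rightarrow> int \<Rightarrow> int4 set" where
  "fiber m a T = {y. shifted_norm m (add4 y a) = shifted_norm m y \<and> shifted_norm m y \<le> T}"

text \<open>The squared norm of the mean of the vectors whose norms are \<open>shifted_norm\<close> at \<open>y\<close> and \<open>y + a\<close>; on a fiber this mean is orthogonal to \<open>a\<close>.\<close>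
definition mid_norm :: "int \<Rightarrow> int4 \<Rightarrow> int4 \<Rightarrow> int" where
  "mid_norm m a y = (case a of (a0, a1, a2, a3) \<Rightarrow> case y of (y0, y1, y2, y3) \<Rightarrow>
     (m * (2 * y0 + a0) - (m - 2))\<^sup>2 + (m * (2 * y1 + a1) - (m - 2))\<^sup>2 + (m * (2 * y2 + a2) - (m - 2))\<^sup>2 + (m * (2 * y3 + a3) - (m - 2))\<^sup>2)"

text \<open>The bracket is the inner product of \<open>a\<close> with the mean of the two shifted
  vectors, which differ by \<open>2 * m * a\<close>. Here it measures the difference of their norms;
  in \<open>shifted_norm_mid_norm\<close> it is the cross term of the mean minus
  \<open>m * a\<close>. On a fiber both vanish together.\<close>

lemma shifted_norm_add4:
  "shifted_norm m (add4 y a) = shifted_norm m y + 4 * m * (2 * m * dot4 a y - ((m - 2) * sum4 a - m * sq4 a))"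
  by (cases a; cases y) (simp add: shifted_norm_def add4_def dot4_def sum4_def sq4_def power2_eq_square algebra_simps)

lemma shifted_norm_mid_norm:
  "shifted_norm m y = mid_norm m a y + m\<^sup>2 * sq4 a - 2 * m * (2 * m * dot4 a y - ((m - 2) * sum4 a - m * sq4 a))"
  by (cases a; cases y) (simp add: shifted_norm_def mid_norm_def dot4_def sum4_def sq4_def power2_eq_square algebra_simps)

lemma mid_norm_nonneg: "mid_norm m a y \<ge> 0"
  by (cases a; cases y) (simp add: mid_norm_def)

lemma fiber_iff:
  assumes m: "m \<ge> 1"
  shows "y \<in> fiber m a T \<longleftrightarrow> 2 * m * dot4 a y = (m - 2) * sum4 a - m * sq4 a \<and> mid_norm m a y + m\<^sup>2 * sq4 a \<le> T"
proof -
  have "shifted_norm m (add4 y a) = shifted_norm m y \<longleftrightarrow> 2 * m * dot4 a y = (m - 2) * sum4 a - m * sq4 a"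
    unfolding shifted_norm_add4 using m by simp
  then show ?thesis unfolding fiber_def mem_Collect_eq using shifted_norm_mid_norm[of m y a] by auto
qed

lemma finite_fiber: "m \<ge> 1 \<Longrightarrow> finite (fiber m a T)"
  by (rule finite_subset[OF _ finite_shifted_norm_le[of m T]]) (auto simp: fiber_def)

lemma finite_scaled_sq4_le: 
  assumes "m \<ge> 1" shows "finite {a. m\<^sup>2 * sq4 a \<le> T}"
proof (rule finite_subset[OF _ finite_sq4_le[of "of_int T"]])
  have "sq4 a \<le> T" if "m\<^sup>2 * sq4 a \<le> T" for a
  proof -
    have "1 * sq4 a \<le> m\<^sup>2 * sq4 a" using assms by (intro mult_right_mono) (auto simp: one_le_power)
    then show ?thesis using that by simp
  qed
  then show "{a. m\<^sup>2 * sq4 a \<le> T} \<subseteq> {a. real_of_int (sq4 a) \<le> real_of_int T}" by (simp only: of_int_le_iff) blast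
qed

text \<open>A pair is recovered from its second entry and the difference \<open>a\<close>. The
  restriction on \<open>a\<close> loses nothing: \<open>mid_norm\<close> is nonnegative, so by
  \<open>fiber_iff\<close> all other fibers are empty.\<close>

lemma card_pairs_eq_sum_fibers:
  assumes m: "m \<ge> 1"
  shows "card (norm_pairs m T) = (\<Sum>a | m\<^sup>2 * sq4 a \<le> T. card (fiber m a T))"
proof -
  let ?A = "{a. m\<^sup>2 * sq4 a \<le> T}"
  have "bij_betw (\<lambda>(a, y). (add4 y a, y)) (Sigma ?A (\<lambda>a. fiber m a T)) (norm_pairs m T)" (is "bij_betw ?h ?S ?L")
  proof (rule bij_betw_imageI)
    show "inj_on ?h ?S"
    proof (rule inj_onI)
      fix v w assume e: "?h v = ?h w"
      obtain a y b z where v: "v = (a, y)" "w = (b, z)" by (metis prod.exhaust)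
      have "y = z" "add4 y a = add4 z b" using e v by auto
      then have "a = b" by (cases a; cases b; cases y) (auto simp: add4_def)
      then show "v = w" using v \<open>y = z\<close> by simp
    qed
    show "?h ` ?S = ?L"
    proof (intro equalityI subsetI)
      fix w assume "w \<in> ?h ` ?S"
      then obtain a y where "w = (add4 y a, y)" "y \<in> fiber m a T" by (metis (no_types, lifting) SigmaE case_prod_conv imageE)
      then show "w \<in> ?L" by (simp add: fiber_def norm_pairs_def)
    next
      fix w assume "w \<in> ?L"
      then obtain x y where w: "w = (x, y)" "shifted_norm m x = shifted_norm m y" "shifted_norm m y \<le> T" unfolding norm_pairs_def by blast
      obtain x0 x1 x2 x3 where x: "x = (x0, x1, x2, x3)" by (metis prod_cases4)
      obtain y0 y1 y2 y3 where y: "y = (y0, y1, y2, y3)" by (metis prod_cases4)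
      define a where "a = (x0 - y0, x1 - y1, x2 - y2, x3 - y3)"
      have xa: "x = add4 y a" by (simp add: x y a_def add4_def)
      have f: "y \<in> fiber m a T" using w xa by (simp add: fiber_def)
      then have "mid_norm m a y + m\<^sup>2 * sq4 a \<le> T" using fiber_iff[OF m] by blast
      then have "m\<^sup>2 * sq4 a \<le> T" using mid_norm_nonneg[of m a y] by linarith
      then have "(a, y) \<in> ?S" using f by blast
      then show "w \<in> ?h ` ?S" using w(1) xa by (intro image_eqI[of _ _ "(a, y)"]) auto
    qed
  qed
  then have "card (norm_pairs m T) = card ?S"
    by (rule bij_betw_same_card[symmetric])
  also have "\<dots> = (\<Sum>a\<in>?A. card (fiber m a T))"
    by (rule card_SigmaI) (use finite_scaled_sq4_le[OF m] finite_fiber[OF m] in auto)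
  finally show ?thesis .
qed

text \<open>The fiber of \<open>g b\<close>, \<open>b\<close> primitive, can only be nonempty if \<open>level m g\<close> divides the coordinate sum of \<open>b\<close>.\<close>
definition level :: "int \<Rightarrow> int \<Rightarrow> nat" where
  "level m g = nat (2 * m) div gcd (nat (2 * m)) (nat \<bar>m * (1 - g) - 2\<bar>)"

text \<open>Since \<open>sq4 a\<close> and \<open>sum4 a\<close> have the same parity,
  \<open>m * g * sq4 a\<close> may be replaced by \<open>m * g * sum4 a\<close> modulo
  \<open>2 * m\<close>. What remains is a multiple of \<open>sum4 a\<close>.\<close>

lemma level_dvd_iff:
  assumes m: "m \<ge> 1"
  shows "2 * m dvd (m - 2) * sum4 a - m * g * sq4 a \<longleftrightarrow> int (level m g) dvd sum4 a"
proof -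
  define e where "e = nat \<bar>m * (1 - g) - 2\<bar>"
  have par: "even (sum4 a - sq4 a)" by (cases a) (simp add: sum4_def sq4_def)
  have "(m - 2) * sum4 a - m * g * sq4 a = (m * (1 - g) - 2) * sum4 a + m * g * (sum4 a - sq4 a)"
    by (simp add: algebra_simps)
  moreover have "2 * m dvd m * g * (sum4 a - sq4 a)"
  proof -
    have "m * 2 dvd m * (g * (sum4 a - sq4 a))" using par by (intro mult_dvd_mono) auto
    then show ?thesis by (simp only: mult_ac)
  qed
  ultimately have "2 * m dvd (m - 2) * sum4 a - m * g * sq4 a \<longleftrightarrow> 2 * m dvd (m * (1 - g) - 2) * sum4 a"
    by (simp add: dvd_add_left_iff)
  also have "\<dots> \<longleftrightarrow> 2 * m dvd int e * sum4 a"
  proof -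
    have "int e = m * (1 - g) - 2 \<or> int e = - (m * (1 - g) - 2)" by (auto simp: e_def abs_if)
    then show ?thesis by (metis dvd_minus_iff mult_minus_left)
  qed
  also have "\<dots> \<longleftrightarrow> int (nat (2 * m)) dvd int e * sum4 a" using m by simp
  also have "\<dots> \<longleftrightarrow> int (level m g) dvd sum4 a"
    unfolding level_def e_def[symmetric] using m by (intro dvd_mult_gcd_div_iff) auto
  finally show ?thesis .
qed

section \<open>Counting one fiber\<close>

text \<open>The volume \<open>4 * pi / 3 * r ^ 3\<close> of the 3-dimensional ball over the covolume
  \<open>|b|\<close>. The radius is \<open>g / 2\<close> times the root in \<open>wt\<close>, and
  \<open>4 / 3 / 8 = 1 / 6\<close>.\<close>

definition fiber_main :: "int \<Rightarrow> int \<Rightarrow> int \<Rightarrow> int4 \<Rightarrow> real" where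
  "fiber_main m T g b = (if int (level m g) dvd sum4 b then pi / 6 * of_int g ^ 3 * wt (of_int T / (of_int (m * g))\<^sup>2) b else 0)"

text \<open>Division of the equation by \<open>2 * m * g\<close> leaves a hyperplane with primitive
  normal \<open>b\<close>, so the error bound does not involve \<open>g\<close>. If the level
  condition fails, both the count and its main term are zero.\<close>

lemma fiber_count:
  assumes m: "m \<ge> 1" and g: "g > 0" and h: "h > 0" and bh: "coprime b0 h"
    and pp: "p = (p1, p2, p3)" "gcd3 p = 1"
    and b: "b = (b0, h * p1, h * p2, h * p3)"
    and u: "gcd3 u = 1" "dot3 p u = 0" "(supn u)\<^sup>2 \<le> 9 * supn p"
    and T: "m\<^sup>2 * sq4 (smul4 g b) \<le> T" "T \<ge> 1" and R: "R = sqrt (of_int T)" "of_int (supn p) \<le> R"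
  shows "\<bar>real (card (fiber m (smul4 g b) T)) - fiber_main m T g b\<bar> \<le> 500 * R\<^sup>2 / of_int (supn u)"
proof (cases "int (level m g) dvd sum4 b")
  case False
  have "fiber m (smul4 g b) T = {}"
  proof -
    have False if y: "y \<in> fiber m (smul4 g b) T" for y
    proof -
      have "2 * m * dot4 (smul4 g b) y = (m - 2) * sum4 (smul4 g b) - m * sq4 (smul4 g b)"
        using y fiber_iff[OF m] by blast
      moreover have "dot4 (smul4 g b) y = g * dot4 b y"
        by (cases b; cases y) (simp add: dot4_def smul4_def algebra_simps)
      ultimately have "g * (2 * m * dot4 b y) = g * ((m - 2) * sum4 b - m * g * sq4 b)"
        by (simp add: sum4_smul4 sq4_smul4 power2_eq_square algebra_simps)
      then have "2 * m * dot4 b y = (m - 2) * sum4 b - m * g * sq4 b" using g by simp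
      then have "2 * m dvd (m - 2) * sum4 b - m * g * sq4 b" by (metis dvd_triv_left)
      then show False using level_dvd_iff[OF m] False by blast
    qed
    then show ?thesis by blast
  qed
  moreover have "supn u \<ge> 0" by (cases u) (auto simp: supn_def)
  ultimately show ?thesis using False by (simp add: fiber_main_def)
next
  case True
  then obtain c where c: "(m - 2) * sum4 b - m * g * sq4 b = 2 * m * c"
    using level_dvd_iff[OF m, of b g] by (auto elim: dvdE)
  define M where "M = real_of_int m"
  define G where "G = real_of_int g"
  have M: "M \<ge> 1" using m by (simp add: M_def)
  have G: "G > 0" using g by (simp add: G_def)
  \<comment> \<open>The coordinate of the centre where \<open>b\<close> has the entry
    \<open>x\<close>, read off from
    \<open>m * (2 * v + g * x) - (m - 2) = 2 * m * (v - z x)\<close>.\<close>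
  define z where "z x = ((M - 2) - M * G * of_int x) / (2 * M)" for x :: int
  define Q where "Q = (of_int T - M\<^sup>2 * G\<^sup>2 * of_int (sq4 b)) / (4 * M\<^sup>2)"
  have sqT: "M\<^sup>2 * G\<^sup>2 * of_int (sq4 b) \<le> of_int T"
  proof -
    have "real_of_int (m\<^sup>2 * sq4 (smul4 g b)) \<le> of_int T" using T(1) by (simp only: of_int_le_iff)
    then show ?thesis by (simp add: sq4_smul4 M_def G_def mult.assoc)
  qed
  have Q0: "Q \<ge> 0" unfolding Q_def using sqT by (intro divide_nonneg_nonneg) auto
  have QR: "sqrt Q \<le> R"
  proof -
    have "0 \<le> M\<^sup>2 * G\<^sup>2 * of_int (sq4 b)" by simp
    moreover have "1 \<le> M\<^sup>2" using M by (rule one_le_power)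
    then have "1 \<le> 4 * M\<^sup>2" by linarith
    moreover note this
    ultimately have "Q \<le> of_int T / 1" unfolding Q_def using T(2) by (intro frac_le) auto
    then show ?thesis unfolding R(1) by simp
  qed
  have R1: "R \<ge> 1" using T(2) by (simp add: R(1))
  have zc: "of_int b0 * z b0 + of_int h * (of_int p1 * z (h * p1) + of_int p2 * z (h * p2) + of_int p3 * z (h * p3)) = of_int c"
  proof -
    have "(M - 2) * of_int (sum4 b) - M * G * of_int (sq4 b) = 2 * M * of_int c"
      using arg_cong[OF c, of real_of_int] by (simp add: M_def G_def)
    moreover have "of_int b0 * z b0 + of_int h * (of_int p1 * z (h * p1) + of_int p2 * z (h * p2) + of_int p3 * z (h * p3))
      = ((M - 2) * of_int (sum4 b) - M * G * of_int (sq4 b)) / (2 * M)"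
      unfolding z_def b sum4_def sq4_def prod.case using M by (simp add: field_simps power2_eq_square)
    ultimately show ?thesis using M by simp
  qed
  let ?S = "{(y0::int, y1::int, y2::int, y3::int). b0 * y0 + h * (p1 * y1 + p2 * y2 + p3 * y3) = c \<and>
      (of_int y0 - z b0)\<^sup>2 + (of_int y1 - z (h * p1))\<^sup>2 + (of_int y2 - z (h * p2))\<^sup>2 + (of_int y3 - z (h * p3))\<^sup>2 \<le> Q}"
  have S: "fiber m (smul4 g b) T = ?S"
  proof (rule set_eqI)
    fix y :: int4
    obtain y0 y1 y2 y3 where y: "y = (y0, y1, y2, y3)" by (metis prod_cases4)
    have 1: "2 * m * dot4 (smul4 g b) y = (m - 2) * sum4 (smul4 g b) - m * sq4 (smul4 g b) \<longleftrightarrow> b0 * y0 + h * (p1 * y1 + p2 * y2 + p3 * y3) = c"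
    proof -
      have d: "dot4 (smul4 g b) y = g * (b0 * y0 + h * (p1 * y1 + p2 * y2 + p3 * y3))"
        by (simp add: dot4_def smul4_def b y algebra_simps)
      have "(m - 2) * sum4 (smul4 g b) - m * sq4 (smul4 g b) = g * (2 * m * c)"
        unfolding c[symmetric] by (simp add: sum4_smul4 sq4_smul4 power2_eq_square algebra_simps)
      then have "2 * m * dot4 (smul4 g b) y = (m - 2) * sum4 (smul4 g b) - m * sq4 (smul4 g b) \<longleftrightarrow>
          (2 * m * g) * (b0 * y0 + h * (p1 * y1 + p2 * y2 + p3 * y3)) = (2 * m * g) * c"
        unfolding d by (simp add: mult_ac)
      also have "\<dots> \<longleftrightarrow> b0 * y0 + h * (p1 * y1 + p2 * y2 + p3 * y3) = c" using m g by simp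
      finally show ?thesis .
    qed
    have co: "(of_int (m * (2 * v + g * x) - (m - 2)))\<^sup>2 = 4 * M\<^sup>2 * (of_int v - z x)\<^sup>2" for v x
    proof -
      have "of_int (m * (2 * v + g * x) - (m - 2)) = 2 * M * (of_int v - z x)"
        unfolding z_def using M by (simp add: M_def G_def field_simps)
      then show ?thesis by (simp add: power_mult_distrib)
    qed
    have f1: "of_int (mid_norm m (smul4 g b) y) = 4 * M\<^sup>2 * ((of_int y0 - z b0)\<^sup>2 + (of_int y1 - z (h * p1))\<^sup>2 + (of_int y2 - z (h * p2))\<^sup>2 + (of_int y3 - z (h * p3))\<^sup>2)"
      unfolding mid_norm_def smul4_def b y prod.case of_int_add of_int_power co by (simp add: algebra_simps)
    have f2: "of_int (m\<^sup>2 * sq4 (smul4 g b)) = M\<^sup>2 * G\<^sup>2 * of_int (sq4 b)"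
      by (simp add: sq4_smul4 M_def G_def mult.assoc)
    have f3: "4 * M\<^sup>2 * Q = of_int T - M\<^sup>2 * G\<^sup>2 * of_int (sq4 b)" using M by (simp add: Q_def)
    have f4: "4 * M\<^sup>2 > 0" using M by simp
    have cmp: "(mid_norm m (smul4 g b) y + m\<^sup>2 * sq4 (smul4 g b) \<le> T) =
       (real_of_int (mid_norm m (smul4 g b) y) + of_int (m\<^sup>2 * sq4 (smul4 g b)) \<le> of_int T)"
      by (simp only: of_int_add[symmetric] of_int_le_iff)
    have gen: "(X + w \<le> t) = (D \<le> Q')" if "X = k * D" "k * Q' = t - w" "k > 0" for X w t D Q' k :: real
    proof -
      have "(D \<le> Q') = (k * D \<le> k * Q')" using that(3) by simp
      then show ?thesis using that(1,2) by auto
    qed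
    have 2: "(mid_norm m (smul4 g b) y + m\<^sup>2 * sq4 (smul4 g b) \<le> T) =
       ((of_int y0 - z b0)\<^sup>2 + (of_int y1 - z (h * p1))\<^sup>2 + (of_int y2 - z (h * p2))\<^sup>2 + (of_int y3 - z (h * p3))\<^sup>2 \<le> Q)"
      unfolding cmp f2 by (rule gen[OF f1 f3 f4])
    show "y \<in> fiber m (smul4 g b) T \<longleftrightarrow> y \<in> ?S"
      unfolding fiber_iff[OF m] 1 2 unfolding y mem_Collect_eq prod.case ..
  qed
  have err: "\<bar>real (card ?S) - 4 * pi / 3 * sqrt Q ^ 3 / sqrt (of_int (b0\<^sup>2 + h\<^sup>2 * (p1\<^sup>2 + p2\<^sup>2 + p3\<^sup>2)))\<bar> \<le> 500 * R\<^sup>2 / of_int (supn u)"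
    by (rule hyperplane_count_error[OF h bh pp u zc Q0 QR R1 R(2)])
  have sqb: "b0\<^sup>2 + h\<^sup>2 * (p1\<^sup>2 + p2\<^sup>2 + p3\<^sup>2) = sq4 b" by (simp add: b sq4_def power_mult_distrib algebra_simps)
  have sQ: "sqrt Q = G / 2 * sqrt (of_int T / (M * G)\<^sup>2 - of_int (sq4 b))"
  proof -
    have "Q = (G / 2)\<^sup>2 * (of_int T / (M * G)\<^sup>2 - of_int (sq4 b))"
      unfolding Q_def using M G by (simp add: field_simps power2_eq_square)
    then show ?thesis using G by (simp add: real_sqrt_mult)
  qed
  have "4 * pi / 3 * sqrt Q ^ 3 / sqrt (of_int (sq4 b)) = fiber_main m T g b"
    using True unfolding fiber_main_def wt_def sQ by (simp add: power_mult_distrib power_divide M_def G_def)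
  then show ?thesis using err unfolding S sqb by simp
qed

section \<open>Primitive parts and crude bounds\<close>

definition prim3 :: "int \<times> int \<times> int \<Rightarrow> int \<times> int \<times> int" where
  "prim3 v = (case v of (x, y, z) \<Rightarrow> (x div gcd3 v, y div gcd3 v, z div gcd3 v))"

lemma gcd3_pos: "v \<noteq> (0, 0, 0) \<Longrightarrow> gcd3 v > 0"
  by (cases v) (auto simp: gcd3_def)

lemma prim3_decompose:
  assumes "v \<noteq> (0, 0, 0)"
  obtains p1 p2 p3 where "prim3 v = (p1, p2, p3)" "v = (gcd3 v * p1, gcd3 v * p2, gcd3 v * p3)" "gcd3 (p1, p2, p3) = 1"
proof -
  obtain x y z where v: "v = (x, y, z)" by (metis prod_cases3)
  define g where "g = gcd3 v"
  have g: "g > 0" using gcd3_pos[OF assms] by (simp add: g_def)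
  have d: "g dvd x" "g dvd y" "g dvd z" unfolding g_def v gcd3_def prod.case by (meson dvd_trans gcd_dvd1 gcd_dvd2)+
  define p1 p2 p3 where p: "p1 = x div g" "p2 = y div g" "p3 = z div g"
  have e: "x = g * p1" "y = g * p2" "z = g * p3" using d by (simp_all add: p)
  have "g * gcd3 (p1, p2, p3) = gcd3 (x, y, z)" unfolding e gcd3_def prod.case using g by (simp add: gcd_mult_left)
  also have "\<dots> = g" by (simp only: g_def v)
  finally have "gcd3 (p1, p2, p3) = 1" using g by simp
  moreover have "prim3 v = (p1, p2, p3)" unfolding prim3_def p g_def by (simp add: v)
  moreover have "v = (gcd3 v * p1, gcd3 v * p2, gcd3 v * p3)"
  proof -
    have "v = (g * p1, g * p2, g * p3)" using v e by simp
    then show ?thesis by (simp only: g_def)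
  qed
  ultimately show thesis using that by blast
qed

lemma short_orthogonal_function:
  obtains uf where "\<And>v. v \<noteq> (0, 0, 0) \<Longrightarrow> gcd3 (uf v) = 1 \<and> dot3 (prim3 v) (uf v) = 0 \<and> (supn (uf v))\<^sup>2 \<le> 9 * supn (prim3 v)"
proof -
  have "\<exists>u. gcd3 u = 1 \<and> dot3 (prim3 v) u = 0 \<and> (supn u)\<^sup>2 \<le> 9 * supn (prim3 v)" if v: "v \<noteq> (0, 0, 0)" for v
  proof -
    obtain p1 p2 p3 where p: "prim3 v = (p1, p2, p3)" "v = (gcd3 v * p1, gcd3 v * p2, gcd3 v * p3)" by (rule prim3_decompose[OF v])
    have "prim3 v \<noteq> (0, 0, 0)"
    proof
      assume "prim3 v = (0, 0, 0)"
      then have "p1 = 0" "p2 = 0" "p3 = 0" using p(1) by auto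
      then show False using p(2) v by simp
    qed
    then show ?thesis by (rule short_orthogonal_vector)
  qed
  then show thesis using that by metis
qed

definition div4 :: "int4 \<Rightarrow> int4" where
  "div4 a = (case a of (a0, a1, a2, a3) \<Rightarrow> (a0 div gcd4 a, a1 div gcd4 a, a2 div gcd4 a, a3 div gcd4 a))"

lemma gcd4_pos: "a \<noteq> (0, 0, 0, 0) \<Longrightarrow> gcd4 a > 0"
  by (cases a) (auto simp: gcd4_def)

lemma div4_smul4:
  assumes "e > 0" "gcd4 b = 1"
  shows "gcd4 (smul4 e b) = e" "div4 (smul4 e b) = b"
proof -
  show 1: "gcd4 (smul4 e b) = e" using gcd4_smul4[OF assms(1), of b] assms(2) by simp
  obtain b0 b1 b2 b3 where b: "b = (b0, b1, b2, b3)" by (metis prod_cases4)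
  have s: "smul4 e b = (e * b0, e * b1, e * b2, e * b3)" by (simp add: b smul4_def)
  show "div4 (smul4 e b) = b" using assms(1) unfolding div4_def 1 unfolding s prod.case by (simp add: b)
qed

lemma smul4_div4:
  assumes "a \<noteq> (0, 0, 0, 0)"
  shows "smul4 (gcd4 a) (div4 a) = a" "gcd4 (div4 a) = 1"
proof -
  have g: "gcd4 a > 0" by (rule gcd4_pos[OF assms])
  obtain b where b: "a = smul4 (gcd4 a) b" using dvd_gcd4_iff[of "gcd4 a" a] by auto
  have "gcd4 a = gcd4 a * gcd4 b" using gcd4_smul4[OF g, of b] b by simp
  then have b1: "gcd4 b = 1" using g by simp
  have d: "div4 a = b" using div4_smul4(2)[OF g b1] b by simp
  show "smul4 (gcd4 a) (div4 a) = a" unfolding d using b by simp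
  show "gcd4 (div4 a) = 1" unfolding d by (rule b1)
qed

definition fmain :: "int \<Rightarrow> int \<Rightarrow> int4 \<Rightarrow> real" where
  "fmain m T a = fiber_main m T (gcd4 a) (div4 a)"

lemma abs_int_le_floor_sqrt:
  assumes "x\<^sup>2 \<le> T"
  shows "\<bar>x\<bar> \<le> \<lfloor>sqrt (of_int T)\<rfloor>"
proof -
  have "(real_of_int \<bar>x\<bar>)\<^sup>2 \<le> of_int T"
  proof -
    have "real_of_int (x\<^sup>2) \<le> of_int T" using assms by (simp only: of_int_le_iff)
    then show ?thesis by simp
  qed
  then have "real_of_int \<bar>x\<bar> \<le> sqrt (of_int T)" by (rule real_le_rsqrt)
  then show ?thesis by (simp only: le_floor_iff)
qed

lemma scaled_sq4_le_bounds:
  assumes m: "m \<ge> 1" and a: "m\<^sup>2 * sq4 (a0, a1, a2, a3) \<le> T"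
  defines "K \<equiv> \<lfloor>sqrt (of_int T)\<rfloor>"
  shows "\<bar>a0\<bar> \<le> K" "supn (a1, a2, a3) \<le> K"
proof -
  have "1 * sq4 (a0, a1, a2, a3) \<le> m\<^sup>2 * sq4 (a0, a1, a2, a3)" using m by (intro mult_right_mono) (auto simp: one_le_power)
  then have s: "a0\<^sup>2 + a1\<^sup>2 + a2\<^sup>2 + a3\<^sup>2 \<le> T" using a by (simp add: sq4_def)
  have nn: "0 \<le> a0\<^sup>2" "0 \<le> a1\<^sup>2" "0 \<le> a2\<^sup>2" "0 \<le> a3\<^sup>2" by simp_all
  have "\<bar>a0\<bar> \<le> K" "\<bar>a1\<bar> \<le> K" "\<bar>a2\<bar> \<le> K" "\<bar>a3\<bar> \<le> K"
    unfolding K_def by (rule abs_int_le_floor_sqrt; use s nn in linarith)+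
  then show "\<bar>a0\<bar> \<le> K" "supn (a1, a2, a3) \<le> K" by (auto simp: supn_def)
qed

text \<open>Serves the vectors on the first axis, for which only the size of the main term matters.
  The estimates \<open>sq4 b \<ge> 1\<close> and \<open>g \<le> m * g\<close> remove the
  denominators.\<close>

lemma fmain_bound:
  assumes m: "m \<ge> 1" and a: "a \<noteq> (0, 0, 0, 0)" "m\<^sup>2 * sq4 a \<le> T"
  shows "0 \<le> fmain m T a" "fmain m T a \<le> sqrt (of_int T) ^ 3"
proof -
  define g where "g = gcd4 a"
  define b where "b = div4 a"
  have g: "g > 0" using gcd4_pos[OF a(1)] by (simp add: g_def)
  have ab: "a = smul4 g b" using smul4_div4(1)[OF a(1)] by (simp add: g_def b_def)
  have b1: "gcd4 b = 1" using smul4_div4(2)[OF a(1)] by (simp add: b_def)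
  then have sb: "sq4 b > 0" using gcd4_eq_0_iff[of b] by (simp add: sq4_pos_iff)
  then have sb1: "real_of_int (sq4 b) \<ge> 1" by simp
  define c where "c = real_of_int (m * g)"
  have c: "c > 0" using m g by (simp add: c_def)
  have le: "c\<^sup>2 * of_int (sq4 b) \<le> of_int T"
  proof -
    have "real_of_int (m\<^sup>2 * (g\<^sup>2 * sq4 b)) \<le> of_int T" using a(2) unfolding ab sq4_smul4 by (simp only: of_int_le_iff)
    then show ?thesis by (simp add: c_def power_mult_distrib mult.assoc)
  qed
  have q: "0 \<le> of_int T / c\<^sup>2 - of_int (sq4 b)" using le c by (simp add: field_simps)
  have w0: "0 \<le> wt (of_int T / c\<^sup>2) b" unfolding wt_def using q by (intro divide_nonneg_nonneg) auto
  have w1: "wt (of_int T / c\<^sup>2) b \<le> sqrt (of_int T / c\<^sup>2) ^ 3 / 1"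
    unfolding wt_def using q sb1 by (intro frac_le power_mono) auto
  have sT: "sqrt (of_int T / c\<^sup>2) = sqrt (of_int T) / c" using c by (simp add: real_sqrt_divide)
  have fm: "fmain m T a = (if int (level m g) dvd sum4 b then pi / 6 * of_int g ^ 3 * wt (of_int T / c\<^sup>2) b else 0)"
    by (simp add: fmain_def fiber_main_def g_def b_def c_def)
  show "0 \<le> fmain m T a" unfolding fm using w0 g by simp
  have T0: "0 \<le> sqrt (real_of_int T)" 
  proof -
    have "0 \<le> c\<^sup>2 * real_of_int (sq4 b)" by simp
    then have "0 \<le> real_of_int T" using le by (rule order_trans)
    then show ?thesis by simp
  qed
  have "pi / 6 * of_int g ^ 3 * wt (of_int T / c\<^sup>2) b \<le> 1 * of_int g ^ 3 * (sqrt (of_int T) / c) ^ 3"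
    using pi_less_4 w0 w1 g T0 c unfolding sT by (intro mult_mono) auto
  also have "\<dots> = (of_int g / c) ^ 3 * sqrt (of_int T) ^ 3" by (simp add: power_divide)
  also have "\<dots> \<le> 1 ^ 3 * sqrt (of_int T) ^ 3"
  proof (intro mult_right_mono power_mono)
    have "1 * real_of_int g \<le> real_of_int m * of_int g" using m g by (intro mult_right_mono) auto
    then show "of_int g / c \<le> 1" using c by (subst divide_le_eq_1_pos) (simp_all add: c_def)
  qed (use g c T0 in auto)
  finally show "fmain m T a \<le> sqrt (of_int T) ^ 3" unfolding fm using T0 by auto
qed

lemma card_box3: "K \<ge> 0 \<Longrightarrow> real (card (box3 K)) = (2 * of_int K + 1) ^ 3"
  by (simp add: box3_def card_cartesian_product power3_eq_cube)

lemma card_box4: "K \<ge> 0 \<Longrightarrow> real (card (box4 K)) = (2 * of_int K + 1) ^ 4"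
  by (simp add: box4_def card_cartesian_product eval_nat_numeral)

lemma fiber_subset_box4:
  assumes m: "m \<ge> 1" and T: "T \<ge> 1"
  shows "fiber m a T \<subseteq> box4 \<lfloor>sqrt (of_int T)\<rfloor>"
proof
  fix y assume "y \<in> fiber m a T"
  then have y: "shifted_norm m y \<le> T" by (simp add: fiber_def)
  define K where "K = \<lfloor>sqrt (real_of_int T)\<rfloor>"
  have K: "K \<ge> 0" using T by (simp add: K_def)
  have "sqrt (of_int T) < of_int (K + 1)" unfolding K_def by linarith
  then have "sqrt (of_int T) ^ 2 < (of_int (K + 1)) ^ 2" using T by (intro power_strict_mono) auto
  then have "real_of_int T < of_int ((K + 1)\<^sup>2)" using T by simp
  then have "T < (K + 1)\<^sup>2" by (simp only: of_int_less_iff)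
  then show "y \<in> box4 \<lfloor>sqrt (of_int T)\<rfloor>" using shifted_norm_le_box[OF m K _ y] by (simp add: K_def)
qed

text \<open>The hyperplane equation fixes the first coordinate of \<open>y\<close>, so the fiber
  injects into a 3-dimensional box.\<close>

lemma card_fiber_axis:
  assumes m: "m \<ge> 1" and T: "T \<ge> 1" and a0: "a0 \<noteq> 0"
  shows "real (card (fiber m (a0, 0, 0, 0) T)) \<le> 27 * sqrt (of_int T) ^ 3"
proof -
  define K where "K = \<lfloor>sqrt (real_of_int T)\<rfloor>"
  have K: "K \<ge> 1" "real_of_int K \<le> sqrt (of_int T)" using T by (simp_all add: K_def le_floor_iff)
  let ?F = "fiber m (a0, 0, 0, 0) T"
  have "card ?F = card (snd ` ?F)"
  proof (rule card_image[symmetric], rule inj_onI)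
    fix y z assume y: "y \<in> ?F" and z: "z \<in> ?F" and s: "snd y = snd z"
    have "2 * m * dot4 (a0, 0, 0, 0) y = 2 * m * dot4 (a0, 0, 0, 0) z"
      using y z fiber_iff[OF m] by metis
    then have "fst y = fst z" using m a0 by (cases y; cases z) (simp add: dot4_def)
    then show "y = z" using s by (simp add: prod_eq_iff)
  qed
  also have "\<dots> \<le> card (box3 K)"
  proof (rule card_mono)
    show "snd ` ?F \<subseteq> box3 K"
    proof
      fix v assume "v \<in> snd ` ?F"
      then obtain y where "y \<in> box4 K" "v = snd y" using fiber_subset_box4[OF m T] unfolding K_def by blast
      then show "v \<in> box3 K" by (cases y) (simp add: box4_def box3_def)
    qed
  qed simp
  finally have "real (card ?F) \<le> (2 * of_int K + 1) ^ 3" using card_box3[of K] K by simp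
  also have "\<dots> \<le> (3 * sqrt (of_int T)) ^ 3" using K by (intro power_mono) auto
  finally show ?thesis by (simp add: power_mult_distrib)
qed

section \<open>The total error and the grouping of the main term\<close>

text \<open>The vector \<open>a = 0\<close> costs at most all \<open>y\<close>, of order
  \<open>R ^ 4\<close>, and the first axis has order \<open>R\<close> vectors with fibers of order
  \<open>R ^ 3\<close>. For the others the constant is \<open>3 * 500 * 4050 = 6075000\<close>, from
  the first coordinate, \<open>hyperplane_count_error\<close> and
  \<open>sum_inverse_orthogonal\<close>; rounding it up absorbs the lower order terms.\<close>

lemma pair_count_error:
  assumes m: "m \<ge> 1" and T: "T \<ge> 1"
  defines "R \<equiv> sqrt (real_of_int T)"
  shows "\<bar>real (card (norm_pairs m T))
     - (\<Sum>a\<in>{a. m\<^sup>2 * sq4 a \<le> T} - {(0, 0, 0, 0)}. fmain m T a)\<bar> \<le> 6100000 * (R ^ 5 * sqrt R)"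
proof -
  let ?A = "{a. m\<^sup>2 * sq4 a \<le> T}"
  define K where "K = \<lfloor>R\<rfloor>"
  have R1: "R \<ge> 1" using T by (simp add: R_def)
  have K: "K \<ge> 1" "real_of_int K \<le> R" using R1 by (simp_all add: K_def le_floor_iff)
  have finA: "finite ?A" by (rule finite_scaled_sq4_le[OF m])
  \<comment> \<open>The short orthogonal vector is built from the last three coordinates and exists
    for the argument only if these are not all zero.\<close>
  define A1 where "A1 = {a \<in> ?A. snd a = (0, 0, 0) \<and> fst a \<noteq> 0}"
  define A2 where "A2 = {a \<in> ?A. snd a \<noteq> (0, 0, 0)}"
  have A: "?A - {(0, 0, 0, 0)} = A1 \<union> A2" "A1 \<inter> A2 = {}"
  proof -
    have "a \<noteq> (0, 0, 0, 0) \<longleftrightarrow> (snd a = (0, 0, 0) \<and> fst a \<noteq> 0) \<or> snd a \<noteq> (0, 0, 0)" for a :: int4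
      by (cases a) auto
    then show "?A - {(0, 0, 0, 0)} = A1 \<union> A2" unfolding A1_def A2_def by blast
    show "A1 \<inter> A2 = {}" unfolding A1_def A2_def by blast
  qed
  have fin: "finite A1" "finite A2" using finA by (simp_all add: A1_def A2_def)
  have bounds: "fst a \<in> {-K..K}" "snd a \<in> box3 K" if "a \<in> ?A" for a
  proof -
    obtain a0 a1 a2 a3 where a: "a = (a0, a1, a2, a3)" by (metis prod_cases4)
    have "m\<^sup>2 * sq4 (a0, a1, a2, a3) \<le> T" using that a by simp
    from scaled_sq4_le_bounds[OF m this] show "fst a \<in> {-K..K}" "snd a \<in> box3 K"
      unfolding a K_def R_def by (auto simp: box3_iff abs_le_iff)
  qed
  have cI: "real (card {-K..K}) \<le> 3 * R" using K by simp
  let ?e = "\<lambda>a. real (card (fiber m a T)) - fmain m T a"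
  have zero: "(0, 0, 0, 0) \<in> ?A" using T by (simp add: sq4_def)
  have "real (card (norm_pairs m T)) = (\<Sum>a\<in>?A. real (card (fiber m a T)))"
    unfolding card_pairs_eq_sum_fibers[OF m] by simp
  also have "\<dots> = real (card (fiber m (0, 0, 0, 0) T)) + (\<Sum>a\<in>?A - {(0, 0, 0, 0)}. real (card (fiber m a T)))"
    by (rule sum.remove[OF finA zero])
  finally have "real (card (norm_pairs m T)) - (\<Sum>a\<in>?A - {(0, 0, 0, 0)}. fmain m T a)
     = real (card (fiber m (0, 0, 0, 0) T)) + (\<Sum>a\<in>A1 \<union> A2. ?e a)" unfolding A(1) by (simp add: sum_subtractf)
  also have "(\<Sum>a\<in>A1 \<union> A2. ?e a) = (\<Sum>a\<in>A1. ?e a) + (\<Sum>a\<in>A2. ?e a)"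
    by (rule sum.union_disjoint[OF fin A(2)])
  finally have total: "real (card (norm_pairs m T)) - (\<Sum>a\<in>?A - {(0, 0, 0, 0)}. fmain m T a)
     = real (card (fiber m (0, 0, 0, 0) T)) + ((\<Sum>a\<in>A1. ?e a) + (\<Sum>a\<in>A2. ?e a))" .
  have E0: "real (card (fiber m (0, 0, 0, 0) T)) \<le> 81 * R ^ 4"
  proof -
    have "card (fiber m (0, 0, 0, 0) T) \<le> card (box4 K)"
      unfolding K_def R_def by (rule card_mono[OF finite_box4 fiber_subset_box4[OF m T]])
    then have "real (card (fiber m (0, 0, 0, 0) T)) \<le> (2 * of_int K + 1) ^ 4" using card_box4[of K] K by simp
    also have "\<dots> \<le> (3 * R) ^ 4" using K by (intro power_mono) auto
    finally show ?thesis by (simp add: power_mult_distrib)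
  qed
  have E1: "\<bar>\<Sum>a\<in>A1. ?e a\<bar> \<le> 84 * R ^ 4"
  proof -
    have "\<bar>?e a\<bar> \<le> 28 * R ^ 3" if a: "a \<in> A1" for a
    proof -
      obtain a0 where a0: "a = (a0, 0, 0, 0)" "a0 \<noteq> 0" using a by (cases a) (auto simp: A1_def)
      have "real (card (fiber m a T)) \<le> 27 * R ^ 3" unfolding a0(1) R_def by (rule card_fiber_axis[OF m T a0(2)])
      moreover have "0 \<le> fmain m T a" "fmain m T a \<le> R ^ 3"
        unfolding R_def by (rule fmain_bound[OF m]; use a a0 in \<open>simp add: A1_def\<close>)+
      moreover have "0 \<le> real (card (fiber m a T))" by simp
      ultimately show ?thesis by linarith
    qed
    then have "\<bar>\<Sum>a\<in>A1. ?e a\<bar> \<le> (\<Sum>a\<in>A1. 28 * R ^ 3)" by (intro order_trans[OF sum_abs] sum_mono)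
    also have "\<dots> = real (card A1) * (28 * R ^ 3)" by simp
    also have "\<dots> \<le> (3 * R) * (28 * R ^ 3)"
    proof (rule mult_right_mono)
      have "card A1 = card (fst ` A1)"
        by (rule card_image[symmetric], rule inj_onI) (simp add: A1_def prod_eq_iff)
      also have "\<dots> \<le> card {-K..K}" using bounds(1) by (intro card_mono) (auto simp: A1_def)
      finally show "real (card A1) \<le> 3 * R" using cI by linarith
    qed (use R1 in auto)
    also have "\<dots> = 84 * R ^ 4" by (simp add: eval_nat_numeral)
    finally show ?thesis .
  qed
  have E2: "\<bar>\<Sum>a\<in>A2. ?e a\<bar> \<le> 6075000 * (R ^ 5 * sqrt R)"
  proof -
    obtain uf where uf: "\<And>v. v \<noteq> (0, 0, 0) \<Longrightarrow> gcd3 (uf v) = 1 \<and> dot3 (prim3 v) (uf v) = 0 \<and> (supn (uf v))\<^sup>2 \<le> 9 * supn (prim3 v)"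
      by (rule short_orthogonal_function) blast
    have prim_le: "supn (prim3 v) \<le> supn v" "dot3 v (uf v) = 0" if v: "v \<noteq> (0, 0, 0)" for v
    proof -
      obtain p1 p2 p3 where p: "prim3 v = (p1, p2, p3)" "v = (gcd3 v * p1, gcd3 v * p2, gcd3 v * p3)" by (rule prim3_decompose[OF v])
      have g: "gcd3 v > 0" by (rule gcd3_pos[OF v])
      have le: "\<bar>x\<bar> \<le> \<bar>gcd3 v * x\<bar>" for x using g by (simp add: abs_mult mult_le_cancel_right1)
      have "supn (p1, p2, p3) \<le> supn (gcd3 v * p1, gcd3 v * p2, gcd3 v * p3)"
        unfolding supn_def prod.case by (intro max.mono le)
      then show "supn (prim3 v) \<le> supn v" using p by simp
      obtain w1 w2 w3 where w: "uf v = (w1, w2, w3)" by (metis prod_cases3)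
      have "p1 * w1 + p2 * w2 + p3 * w3 = 0" using uf[OF v] unfolding p(1) w by (simp add: dot3_def)
      then have "gcd3 v * (p1 * w1 + p2 * w2 + p3 * w3) = 0" by simp
      then have "dot3 (gcd3 v * p1, gcd3 v * p2, gcd3 v * p3) (uf v) = 0" unfolding w by (simp add: dot3_def algebra_simps)
      then show "dot3 v (uf v) = 0" using p(2) by simp
    qed
    have err: "\<bar>?e a\<bar> \<le> 500 * R\<^sup>2 * (1 / of_int (supn (uf (snd a))))" if a: "a \<in> A2" for a
    proof -
      obtain a0 v where av: "a = (a0, v)" by (cases a)
      have v: "v \<noteq> (0, 0, 0)" using a av by (simp add: A2_def)
      obtain p1 p2 p3 where p: "prim3 v = (p1, p2, p3)" "v = (gcd3 v * p1, gcd3 v * p2, gcd3 v * p3)" "gcd3 (p1, p2, p3) = 1"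
        by (rule prim3_decompose[OF v])
      \<comment> \<open>Here \<open>v = gcd3 v * p\<close> with \<open>p\<close> primitive.
        Splitting off \<open>g\<close> leaves \<open>b = (b0, h * p)\<close> with \<open>b0\<close>
        and \<open>h\<close> coprime, the shape required by \<open>fiber_count\<close>.\<close>
      define g where "g = gcd a0 (gcd3 v)"
      have g3: "gcd3 v > 0" by (rule gcd3_pos[OF v])
      have g: "g > 0" using g3 by (simp add: g_def)
      define h where "h = gcd3 v div g"
      define b0 where "b0 = a0 div g"
      have gh: "gcd3 v = g * h" "a0 = g * b0" by (simp_all add: h_def b0_def g_def)
      have h: "h > 0" using gh(1) g g3 by (simp add: zero_less_mult_iff)
      have cop: "coprime b0 h" unfolding b0_def h_def g_def using g3 by (intro div_gcd_coprime) auto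
      define b where "b = (b0, h * p1, h * p2, h * p3)"
      have a_eq: "a = smul4 g b"
      proof -
        have "a = (a0, gcd3 v * p1, gcd3 v * p2, gcd3 v * p3)" using av p(2) by simp
        then show ?thesis unfolding b_def smul4_def prod.case gh by (simp add: mult.assoc)
      qed
      have g4: "gcd4 a = g"
      proof -
        obtain v1 v2 v3 where v': "v = (v1, v2, v3)" by (metis prod_cases3)
        show ?thesis by (simp add: av v' gcd4_def g_def gcd3_def)
      qed
      have b1: "gcd4 b = 1"
      proof -
        have "g = g * gcd4 b" using g4 gcd4_smul4[OF g, of b] a_eq by simp
        then show ?thesis using g by simp
      qed
      have fm: "fmain m T a = fiber_main m T g b" unfolding fmain_def a_eq div4_smul4[OF g b1] ..
      have aA: "m\<^sup>2 * sq4 (smul4 g b) \<le> T" using a unfolding A2_def a_eq by simp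
      have "snd a \<in> box3 K" using a bounds(2) by (simp add: A2_def)
      then have "supn v \<le> K" by (simp add: av box3_iff)
      then have "supn (prim3 v) \<le> K" using prim_le(1)[OF v] by linarith
      then have pR: "real_of_int (supn (prim3 v)) \<le> R" using K(2) by linarith
      have "\<bar>real (card (fiber m (smul4 g b) T)) - fiber_main m T g b\<bar> \<le> 500 * R\<^sup>2 / of_int (supn (uf v))"
        by (rule fiber_count[OF m g h cop p(1) _ b_def _ _ _ aA T R_def[THEN meta_eq_to_obj_eq] pR]) (use uf[OF v] p in simp_all)
      then show ?thesis unfolding fm unfolding a_eq[symmetric] by (simp add: av)
    qed
    let ?B = "box3 K - {(0, 0, 0)}"
    have pos: "0 \<le> 1 / real_of_int (supn (uf v))" for v
    proof -
      have "0 \<le> supn (uf v)" by (cases "uf v") (auto simp: supn_def)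
      then show ?thesis by simp
    qed
    have "\<bar>\<Sum>a\<in>A2. ?e a\<bar> \<le> (\<Sum>a\<in>A2. 500 * R\<^sup>2 * (1 / of_int (supn (uf (snd a)))))"
      by (intro order_trans[OF sum_abs] sum_mono err)
    \<comment> \<open>The bound depends on the last three coordinates only, so the first one
      contributes just the factor \<open>card {-K..K} \<le> 3 * R\<close>.\<close>
    also have "\<dots> \<le> (\<Sum>a\<in>{-K..K} \<times> ?B. 500 * R\<^sup>2 * (1 / of_int (supn (uf (snd a)))))"
    proof (rule sum_mono2)
      show "A2 \<subseteq> {-K..K} \<times> ?B"
      proof
        fix a assume a: "a \<in> A2"
        then have "a \<in> ?A" "snd a \<noteq> (0, 0, 0)" by (simp_all add: A2_def)
        then have "fst a \<in> {-K..K}" "snd a \<in> ?B" using bounds[of a] by blast+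
        then show "a \<in> {-K..K} \<times> ?B" by (simp only: mem_Times_iff)
      qed
    qed (use pos in \<open>auto intro!: mult_nonneg_nonneg\<close>)
    also have "\<dots> = (\<Sum>x\<in>{-K..K}. \<Sum>v\<in>?B. 500 * R\<^sup>2 * (1 / of_int (supn (uf v))))"
      by (subst sum.cartesian_product) (rule sum.cong, auto)
    also have "\<dots> = real (card {-K..K}) * (500 * R\<^sup>2 * (\<Sum>v\<in>?B. 1 / of_int (supn (uf v))))"
      by (simp only: sum_constant sum_distrib_left)
    also have "\<dots> \<le> (3 * R) * (500 * R\<^sup>2 * (4050 * R\<^sup>2 * sqrt R))"
    proof (intro mult_mono)
      have "(\<Sum>v\<in>?B. 1 / real_of_int (supn (uf v))) \<le> 4050 * (of_int K)\<^sup>2 * sqrt (of_int K)"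
      proof (rule sum_inverse_orthogonal[OF K(1)])
        fix v assume v: "v \<in> ?B"
        then have v0: "v \<noteq> (0, 0, 0)" by blast
        have "supn v \<le> K" using v by (simp add: box3_iff)
        then show "gcd3 (uf v) = 1 \<and> dot3 v (uf v) = 0 \<and> (supn (uf v))\<^sup>2 \<le> 9 * K"
          using uf[OF v0] prim_le[OF v0] by linarith
      qed
      also have "\<dots> \<le> 4050 * R\<^sup>2 * sqrt R" using K by (intro mult_mono power_mono) auto
      finally show "(\<Sum>v\<in>?B. 1 / real_of_int (supn (uf v))) \<le> 4050 * R\<^sup>2 * sqrt R" .
      show "0 \<le> (\<Sum>v\<in>?B. 1 / real_of_int (supn (uf v)))" by (rule sum_nonneg) (rule pos)
    qed (use cI R1 pos in \<open>auto intro!: sum_nonneg mult_nonneg_nonneg\<close>)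
    also have "\<dots> = 6075000 * (R ^ 5 * sqrt R)" by (simp add: eval_nat_numeral)
    finally show ?thesis .
  qed
  have "R ^ 4 * 1 \<le> R ^ 5 * sqrt R" using R1 by (intro mult_mono power_increasing) auto
  moreover have "0 \<le> real (card (fiber m (0, 0, 0, 0) T))" by simp
  ultimately show ?thesis unfolding total using E0 E1 E2 by linarith
qed

text \<open>Vectors are grouped by \<open>g = gcd4 a\<close>, and the primitive part carries the
  scaled bound. The range up to \<open>T\<close> is generous, as
  \<open>g \<le> g\<^sup>2 \<le> sq4 a \<le> T\<close>.\<close>

lemma fmain_sum_eq:
  assumes m: "m \<ge> 1" and T: "T \<ge> 1"
  shows "(\<Sum>a\<in>{a. m\<^sup>2 * sq4 a \<le> T} - {(0, 0, 0, 0)}. fmain m T a)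
     = (\<Sum>g=1..nat T. pi / 6 * real g ^ 3 * prim_sum (level m (int g)) (of_int T / (of_int m * real g)\<^sup>2))"
proof -
  let ?A = "{a. m\<^sup>2 * sq4 a \<le> T} - {(0, 0, 0, 0)}"
  have fin: "finite ?A" using finite_scaled_sq4_le[OF m] by simp
  have img: "(\<lambda>a. nat (gcd4 a)) ` ?A \<subseteq> {1..nat T}"
  proof
    fix n assume "n \<in> (\<lambda>a. nat (gcd4 a)) ` ?A"
    then obtain a where a: "n = nat (gcd4 a)" "m\<^sup>2 * sq4 a \<le> T" "a \<noteq> (0, 0, 0, 0)" by blast
    define g where "g = gcd4 a"
    have g: "g > 0" using gcd4_pos[OF a(3)] by (simp add: g_def)
    have ab: "a = smul4 g (div4 a)" using smul4_div4(1)[OF a(3)] by (simp add: g_def)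
    have "sq4 (div4 a) > 0" using smul4_div4(2)[OF a(3)] gcd4_eq_0_iff[of "div4 a"] by (simp add: sq4_pos_iff)
    then have s: "1 \<le> sq4 (div4 a)" by simp
    have "g * 1 \<le> g * g" using g by (intro mult_left_mono) auto
    also have "g * g = g\<^sup>2 * 1" by (simp add: power2_eq_square)
    also have "\<dots> \<le> g\<^sup>2 * sq4 (div4 a)" using s by (intro mult_left_mono) auto
    also have "\<dots> = sq4 a" using ab sq4_smul4[of g "div4 a"] by simp
    also have "\<dots> = 1 * sq4 a" by simp
    also have "\<dots> \<le> m\<^sup>2 * sq4 a" using m by (intro mult_right_mono) (auto simp: one_le_power)
    finally have "g \<le> T" using a(2) by simp
    then have "nat g \<le> nat T" by (rule nat_mono)
    moreover have "1 \<le> nat g" using g by (simp add: Suc_le_eq)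
    ultimately show "n \<in> {1..nat T}" by (simp add: a(1) g_def[symmetric])
  qed
  have "(\<Sum>a\<in>?A. fmain m T a) = (\<Sum>g=1..nat T. \<Sum>a\<in>{a \<in> ?A. nat (gcd4 a) = g}. fmain m T a)"
    by (rule sum.group[OF fin _ img, symmetric]) simp
  also have "\<dots> = (\<Sum>g=1..nat T. pi / 6 * real g ^ 3 * prim_sum (level m (int g)) (of_int T / (of_int m * real g)\<^sup>2))"
  proof (rule sum.cong[OF refl])
    fix n assume n: "n \<in> {1..nat T}"
    define g where "g = int n"
    have g: "g > 0" using n by (simp add: g_def)
    define Q where "Q = real_of_int T / (of_int m * real n)\<^sup>2"
    let ?B = "{b. gcd4 b = 1 \<and> real_of_int (sq4 b) \<le> Q}"
    have iff: "m\<^sup>2 * sq4 (smul4 g b) \<le> T \<longleftrightarrow> real_of_int (sq4 b) \<le> Q" for b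
    proof -
      have c: "(real_of_int m * real n)\<^sup>2 > 0" using m n by simp
      have "m\<^sup>2 * sq4 (smul4 g b) \<le> T \<longleftrightarrow> real_of_int (m\<^sup>2 * sq4 (smul4 g b)) \<le> of_int T" by (simp only: of_int_le_iff)
      also have "real_of_int (m\<^sup>2 * sq4 (smul4 g b)) = of_int (sq4 b) * (real_of_int m * real n)\<^sup>2"
        by (simp add: sq4_smul4 g_def power_mult_distrib)
      also have "\<dots> \<le> of_int T \<longleftrightarrow> real_of_int (sq4 b) \<le> Q"
        unfolding Q_def using c by (simp only: pos_le_divide_eq)
      finally show ?thesis .
    qed
    have set: "{a \<in> ?A. nat (gcd4 a) = n} = smul4 g ` ?B"
    proof (intro equalityI subsetI)
      fix a assume "a \<in> {a \<in> ?A. nat (gcd4 a) = n}"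
      then have a: "m\<^sup>2 * sq4 a \<le> T" "a \<noteq> (0, 0, 0, 0)" "nat (gcd4 a) = n" by blast+
      have "int (nat (gcd4 a)) = gcd4 a" by (rule nat_0_le) simp
      then have "gcd4 a = g" using a(3) by (simp add: g_def)
      then have ab: "a = smul4 g (div4 a)" using smul4_div4(1)[OF a(2)] by simp
      have "div4 a \<in> ?B" using smul4_div4(2)[OF a(2)] iff[of "div4 a"] a(1) ab by simp
      then show "a \<in> smul4 g ` ?B" using ab by blast
    next
      fix a assume "a \<in> smul4 g ` ?B"
      then obtain b where b: "a = smul4 g b" "gcd4 b = 1" "real_of_int (sq4 b) \<le> Q" by blast
      have "gcd4 a = g" using div4_smul4(1)[OF g b(2)] b(1) by simp
      moreover have "a \<noteq> (0, 0, 0, 0)"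
      proof
        assume "a = (0, 0, 0, 0)"
        then show False using \<open>gcd4 a = g\<close> g by (simp add: gcd4_def)
      qed
      ultimately show "a \<in> {a \<in> ?A. nat (gcd4 a) = n}" using iff[of b] b by (simp add: g_def)
    qed
    have finB: "finite ?B" by (rule finite_subset[OF _ finite_sq4_le[of Q]]) blast
    have "(\<Sum>a\<in>{a \<in> ?A. nat (gcd4 a) = n}. fmain m T a) = (\<Sum>b\<in>?B. fmain m T (smul4 g b))"
      unfolding set using g by (subst sum.reindex) (simp_all add: inj_on_def smul4_inject)
    also have "\<dots> = (\<Sum>b\<in>?B. if int (level m g) dvd sum4 b then pi / 6 * real n ^ 3 * wt Q b else 0)"
    proof (rule sum.cong[OF refl])
      fix b assume "b \<in> ?B"
      then have b: "gcd4 b = 1" by blast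
      have c: "real_of_int (m * g) = of_int m * real n" by (simp add: g_def)
      show "fmain m T (smul4 g b) = (if int (level m g) dvd sum4 b then pi / 6 * real n ^ 3 * wt Q b else 0)"
        unfolding fmain_def div4_smul4[OF g b] fiber_main_def c Q_def[symmetric] by (simp add: g_def)
    qed
    also have "\<dots> = (\<Sum>b\<in>{b \<in> ?B. int (level m g) dvd sum4 b}. pi / 6 * real n ^ 3 * wt Q b)"
      by (rule sum.inter_filter[OF finB, symmetric])
    also have "{b \<in> ?B. int (level m g) dvd sum4 b} = {b. gcd4 b = 1 \<and> int (level m g) dvd sum4 b \<and> real_of_int (sq4 b) \<le> Q}" by blast
    also have "(\<Sum>b\<in>{b. gcd4 b = 1 \<and> int (level m g) dvd sum4 b \<and> real_of_int (sq4 b) \<le> Q}. pi / 6 * real n ^ 3 * wt Q b)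
       = pi / 6 * real n ^ 3 * prim_sum (level m g) Q"
      by (simp only: prim_sum_def sum_distrib_left)
    finally show "(\<Sum>a\<in>{a \<in> ?A. nat (gcd4 a) = n}. fmain m T a) = pi / 6 * real n ^ 3 * prim_sum (level m (int n)) (of_int T / (of_int m * real n)\<^sup>2)"
      by (simp only: Q_def g_def)
  qed
  finally show ?thesis .
qed

section \<open>The leading constant\<close>

lemma level_pos:
  assumes "m \<ge> 1"
  shows "level m g > 0"
proof -
  have "nat (2 * m) \<noteq> 0" using assms by simp
  then have "gcd (nat (2 * m)) w \<le> nat (2 * m)" "0 < gcd (nat (2 * m)) w" for w by (rule gcd_le1_nat) (use \<open>nat (2 * m) \<noteq> 0\<close> in \<open>simp only: gcd_pos_nat simp_thms\<close>)
  then show ?thesis unfolding level_def by (simp only: div_greater_zero_iff simp_thms)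
qed

lemma int_level:
  assumes "m \<ge> 1"
  shows "int (level m g) = 2 * m div gcd (2 * m) (m * (1 - g) - 2)"
proof -
  have "\<bar>2 * m\<bar> = 2 * m" "int (nat (2 * m)) = 2 * m" using assms by simp_all
  moreover have "gcd (2 * m) (m * (1 - g) - 2) = int (gcd (nat \<bar>2 * m\<bar>) (nat \<bar>m * (1 - g) - 2\<bar>))"
    by (rule gcd_int_def)
  ultimately show ?thesis unfolding level_def zdiv_int by (simp only:)
qed

text \<open>A change of \<open>g\<close> by \<open>2 * t\<close> moves
  \<open>m * (1 - g) - 2\<close> by a multiple of \<open>2 * m\<close>, which its gcd with
  \<open>2 * m\<close> does not see.\<close>

lemma level_cong_parity:
  assumes m: "m \<ge> 1" and e: "even (g - g')"
  shows "level m g = level m g'"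
proof -
  obtain t where t: "g - g' = 2 * t" using e by (elim evenE)
  have "m * (1 - g) - 2 = (- t) * (2 * m) + (m * (1 - g') - 2)" using t by (simp add: algebra_simps)
  then have "gcd (2 * m) (m * (1 - g) - 2) = gcd (2 * m) (m * (1 - g') - 2)" by (metis gcd_add_mult)
  then have "int (level m g) = int (level m g')" by (simp only: int_level[OF m])
  then show ?thesis by simp
qed

lemma level_1: "m \<ge> 1 \<Longrightarrow> level m 1 = nat m"
  using int_level[of m 1] by simp

text \<open>As \<open>2 * m = 2 * (m + 2) - 4\<close>, the gcd in question is that of
  \<open>m + 2\<close> and 4: it is 1, 4 or 2 in the three cases.\<close>

lemma level_2:
  assumes m: "m \<ge> 1"
  shows "int (level m 2) = (if odd m then 2 * m else if m mod 4 = 2 then m div 2 else m)"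
proof -
  have "gcd (2 * m) (m * (1 - 2) - 2) = gcd (m + 2) (2 * m)" 
  proof -
    have "m * (1 - 2) - 2 = - (m + 2)" by simp
    then show ?thesis by (simp only: gcd_neg2 gcd.commute)
  qed
  also have "2 * m = 2 * (m + 2) + (- 4)" by simp
  also have "gcd (m + 2) (2 * (m + 2) + (- 4)) = gcd (m + 2) 4" by (simp only: gcd_add_mult gcd_neg2)
  finally have g: "gcd (2 * m) (m * (1 - 2) - 2) = gcd (m + 2) 4" by simp
  have "odd m \<or> m mod 4 = 2 \<or> m mod 4 = 0" by presburger
  then consider "odd m" | "m mod 4 = 2" | "m mod 4 = 0" by blast
  then show ?thesis
  proof cases
    case 1
    have "coprime (m + 2) 2" using 1 by simp
    then have "coprime (m + 2) (2 * 2)" by (simp only: coprime_mult_right_iff simp_thms)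
    then have "gcd (m + 2) (2 * 2) = 1" by (simp only: coprime_iff_gcd_eq_1)
    then have "gcd (m + 2) 4 = 1" by simp
    then show ?thesis using int_level[OF m, of 2] g 1 by simp
  next
    case 2
    then have "4 dvd m + 2" by presburger
    then have "gcd (m + 2) 4 = 4" by (simp add: gcd_proj2_iff)
    then have "int (level m 2) = 2 * m div 4" using int_level[OF m, of 2] g by simp
    also have "2 * m div 4 = m div 2" by simp
    finally show ?thesis using 2 by (simp add: mod2_eq_if) presburger
  next
    case 3
    then obtain t where t: "m = 4 * t" by (auto elim: dvdE simp: mod_eq_0_iff_dvd)
    have "gcd (m + 2) 4 = gcd (2 * (2 * t + 1)) (2 * 2)" by (simp add: t algebra_simps)
    also have "\<dots> = 2 * gcd (2 * t + 1) 2" by (simp only: gcd_mult_left) simp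
    also have "gcd (2 * t + 1) 2 = (1::int)" by (simp add: coprime_iff_gcd_eq_1[symmetric])
    finally have "gcd (m + 2) 4 = 2" by simp
    then have "int (level m 2) = 2 * m div 2" using int_level[OF m, of 2] g by simp
    then show ?thesis using 3 t by simp
  qed
qed

definition euler_ratio :: "nat \<Rightarrow> real" where
  "euler_ratio p = (1 - 1 / real p ^ 3) / (1 - 1 / real p ^ 4)"

definition odd_euler_product :: "nat \<Rightarrow> real" where
  "odd_euler_product L = (\<Prod>p | prime p \<and> odd p \<and> p dvd L. euler_ratio p)"

text \<open>The prime 2 contributes \<open>(1 - 1/8) / (1 - 1/16) = 14/15\<close> when it divides
  \<open>L\<close>.\<close>

lemma prim_density_odd_part:
  assumes L: "L > 0"
  shows "prim_density L = 90 / pi ^ 4 / real L * ((if even L then 14 / 15 else 1) * odd_euler_product L)"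
proof -
  let ?O = "{p. prime p \<and> odd p \<and> p dvd L}"
  have fin: "finite ?O" using L by (intro finite_subset[OF _ finite_divisors_nat[OF L]]) auto
  have pf: "prime_factors L = (if even L then insert 2 ?O else ?O)"
  proof -
    have "p = 2 \<or> odd p" if "prime p" for p :: nat using that prime_odd_nat[of p] prime_ge_2_nat[of p] by fastforce
    moreover have "p \<in> prime_factors L \<longleftrightarrow> prime p \<and> p dvd L" for p using L by (simp add: prime_factors_dvd)
    moreover have "prime (2::nat)" by simp
    ultimately show ?thesis by (cases "even L") auto
  qed
  have "(\<Prod>p\<in>prime_factors L. euler_ratio p) = (if even L then 14 / 15 else 1) * odd_euler_product L"
    unfolding pf odd_euler_product_def using fin by (simp add: euler_ratio_def)
  then show ?thesis unfolding prim_density_eq[OF L] euler_ratio_def by simp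
qed

lemma odd_euler_product_cong:
  assumes "\<And>p. odd p \<Longrightarrow> prime p \<Longrightarrow> p dvd L \<longleftrightarrow> p dvd L'"
  shows "odd_euler_product L = odd_euler_product L'"
proof -
  have "{p. prime p \<and> odd p \<and> p dvd L} = {p. prime p \<and> odd p \<and> p dvd L'}" using assms by blast
  then show ?thesis by (simp add: odd_euler_product_def)
qed

text \<open>The weights are the shares of odd and even \<open>g\<close> in the sum of
  \<open>1 / g ^ 3\<close>.\<close>

definition level_density :: "int \<Rightarrow> real" where
  "level_density m = 7 / 8 * prim_density (level m 1) + 1 / 8 * prim_density (level m 2)"

text \<open>Apart from the common factor \<open>90 / pi ^ 4 / m\<close> and the odd Euler product,
  the densities for odd and even \<open>g\<close> are 1 and 7/15 for odd \<open>m\<close>, 14/15 and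
  2 for \<open>m\<close> congruent to 2 modulo 4, and 14/15 twice for \<open>m\<close> divisible by
  4. The weighted means are 14/15, 16/15 and 14/15, and \<open>16 / 3 * 90 = 480\<close> times these
  is 448, 512 and 448.\<close>

lemma level_density_eq:
  assumes m: "m \<ge> 1"
  shows "16 / 3 * pi ^ 4 * of_int m * level_density m
     = C_const (m + 2) * odd_euler_product (nat m)"
proof -
  define M where "M = nat m"
  have M: "M > 0" "int M = m" using m by (simp_all add: M_def)
  define P where "P = odd_euler_product M"
  have rM: "real_of_int m = real M" using M(2) by (metis of_int_of_nat_eq)
  have d1: "prim_density (level m 1) = 90 / pi ^ 4 / real M * ((if even M then 14 / 15 else 1) * P)"
    using prim_density_odd_part[OF M(1)] level_1[OF m] by (simp add: P_def M_def)
  have odd2: "p dvd 2 * n \<longleftrightarrow> p dvd n" if "odd p" "prime p" for p n :: nat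
    using that by (metis coprime_dvd_mult_right_iff coprime_right_2_iff_odd)
  have "odd m \<or> m mod 4 = 2 \<or> m mod 4 = 0" by presburger
  then consider (a) "odd m" | (b) "m mod 4 = 2" | (c) "m mod 4 = 0" by blast
  then show ?thesis
  proof cases
    case a
    then have oM: "odd M" using M(2) by (metis even_of_nat)
    have "int (level m 2) = int (2 * M)" using level_2[OF m] a M by simp
    then have l2: "level m 2 = 2 * M" by (simp only: of_nat_eq_iff)
    have "odd_euler_product (2 * M) = P" unfolding P_def by (rule odd_euler_product_cong) (rule odd2)
    then have d2: "prim_density (level m 2) = 90 / pi ^ 4 / (2 * real M) * (14 / 15 * P)"
      using prim_density_odd_part[of "2 * M"] M l2 by simp
    have C: "C_const (m + 2) = 448" unfolding C_const_def using a by presburger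
    show ?thesis unfolding level_density_def d1 d2 C rM M_def[symmetric] P_def[symmetric] using oM M by (simp add: field_simps)
  next
    case b
    then have "even m" by presburger
    then have eM: "even M" using M(2) by (metis even_of_nat)
    then obtain N where N: "M = 2 * N" by (elim evenE)
    have mN: "m = 2 * int N" using M(2) N by simp
    have oN: "odd N" using b mN by presburger
    have N0: "N > 0" using N M by simp
    have "int (level m 2) = int N" using level_2[OF m] b \<open>even m\<close> mN by simp
    then have l2: "level m 2 = N" by (simp only: of_nat_eq_iff)
    have "odd_euler_product N = P" unfolding P_def N by (rule odd_euler_product_cong) (simp add: odd2)
    then have d2: "prim_density (level m 2) = 90 / pi ^ 4 / real N * P"
      using prim_density_odd_part[OF N0] l2 oN by simp
    have C: "C_const (m + 2) = 512" unfolding C_const_def using b by presburger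
    show ?thesis unfolding level_density_def d1 d2 C rM M_def[symmetric] P_def[symmetric] using eM N N0 by (simp add: field_simps)
  next
    case c
    then have "even m" by presburger
    then have eM: "even M" using M(2) by (metis even_of_nat)
    have "int (level m 2) = int M" using level_2[OF m] c \<open>even m\<close> M by simp
    then have l2: "level m 2 = M" by (simp only: of_nat_eq_iff)
    have d2: "prim_density (level m 2) = 90 / pi ^ 4 / real M * (14 / 15 * P)"
      using prim_density_odd_part[OF M(1)] l2 eM by (simp add: P_def)
    have C: "C_const (m + 2) = 448" unfolding C_const_def using c by presburger
    show ?thesis unfolding level_density_def d1 d2 C rM M_def[symmetric] P_def[symmetric] using eM M by (simp add: field_simps)
  qed
qed

section \<open>Summation over the multiplier\<close>

lemma prim_sum_eq_0: "d > 0 \<Longrightarrow> Q < 1 \<Longrightarrow> prim_sum d Q = 0"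
  using prim_sum_eq[of d Q 0] by simp

lemma infsum_level_density:
  assumes m: "m \<ge> 1"
  shows "(\<Sum>\<^sub>\<infinity>g. prim_density (level m (int g)) / real g ^ 3) = level_density m * inv_powers 3"
    and "(\<lambda>g. prim_density (level m (int g)) / real g ^ 3) summable_on UNIV"
proof -
  let ?f = "\<lambda>g. prim_density (level m (int g)) / real g ^ 3"
  define d1 where "d1 = prim_density (level m 1)"
  define d2 where "d2 = prim_density (level m 2)"
  have lo: "prim_density (level m (int g)) = d1" if "odd g" for g
    unfolding d1_def using that by (subst level_cong_parity[OF m, of _ 1]) auto
  have le: "prim_density (level m (int g)) = d2" if "even g" for g
    unfolding d2_def using that by (subst level_cong_parity[OF m, of _ 2]) auto
  have b: "\<bar>?f g\<bar> \<le> (\<bar>d1\<bar> + \<bar>d2\<bar>) / real g ^ 3" for g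
    using lo[of g] le[of g] by (cases "even g") (auto simp: divide_right_mono)
  have sum: "?f summable_on A" for A by (rule summable_on_inverse_power_bound[OF _ b]) simp
  then show "?f summable_on UNIV" .
  have s1: "(\<lambda>g. 1 / real g ^ 3) summable_on A" for A
    by (rule summable_on_inverse_power_bound[where s = 3 and c = 1]) auto
  have inj: "inj_on ((*) 2) (UNIV :: nat set)" by (auto simp: inj_on_def)
  have ev: "{g. even g} = (*) 2 ` (UNIV :: nat set)" by (auto elim: evenE)
  \<comment> \<open>The even indices \<open>2 * g\<close> carry the part \<open>1 / 2 ^ 3\<close> of
    the whole sum.\<close>
  have E: "(\<Sum>\<^sub>\<infinity>g\<in>{g. even g}. 1 / real g ^ 3) = 1 / 8 * inv_powers 3"
  proof -
    have "(\<Sum>\<^sub>\<infinity>g\<in>{g. even g}. 1 / real g ^ 3) = (\<Sum>\<^sub>\<infinity>g. 1 / real (2 * g) ^ 3)"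
      unfolding ev using infsum_reindex[OF inj, of "\<lambda>g. 1 / real g ^ 3"] by (simp add: o_def)
    also have "\<dots> = (\<Sum>\<^sub>\<infinity>g. 1 / 8 * (1 / real g ^ 3))" by (simp add: power_mult_distrib)
    also have "\<dots> = 1 / 8 * inv_powers 3" unfolding infsum_cmult_right' inv_powers_def ..
    finally show ?thesis .
  qed
  have UN: "UNIV = {g::nat. even g} \<union> {g. odd g}" by auto
  have "inv_powers 3 = (\<Sum>\<^sub>\<infinity>g\<in>{g. even g}. 1 / real g ^ 3) + (\<Sum>\<^sub>\<infinity>g\<in>{g. odd g}. 1 / real g ^ 3)"
    unfolding inv_powers_def by (subst UN, rule infsum_Un_disjoint[OF s1 s1]) auto
  then have O: "(\<Sum>\<^sub>\<infinity>g\<in>{g. odd g}. 1 / real g ^ 3) = 7 / 8 * inv_powers 3" using E by simp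
  have "infsum ?f UNIV = infsum ?f {g. even g} + infsum ?f {g. odd g}"
    by (subst UN, rule infsum_Un_disjoint[OF sum sum]) auto
  also have "infsum ?f {g. even g} = (\<Sum>\<^sub>\<infinity>g\<in>{g. even g}. d2 * (1 / real g ^ 3))"
    by (rule infsum_cong) (simp add: le)
  also have "\<dots> = d2 * (1 / 8 * inv_powers 3)" unfolding infsum_cmult_right' E ..
  also have "infsum ?f {g. odd g} = (\<Sum>\<^sub>\<infinity>g\<in>{g. odd g}. d1 * (1 / real g ^ 3))"
    by (rule infsum_cong) (simp add: lo)
  also have "\<dots> = d1 * (7 / 8 * inv_powers 3)" unfolding infsum_cmult_right' O ..
  finally show "infsum ?f UNIV = level_density m * inv_powers 3"
    by (simp add: level_density_def d1_def d2_def algebra_simps)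
qed

lemma inv_powers_nonneg: "inv_powers s \<ge> 0"
  unfolding inv_powers_def by (rule infsum_nonneg) simp

text \<open>The constant \<open>pi ^ 4 / 96\<close> is \<open>pi / 6\<close> from the fibers times
  \<open>pi ^ 3 / 16\<close> from the primitive vectors. In the error, \<open>g ^ 3\<close> against
  the fifth power of \<open>R / (m * g)\<close> leaves \<open>1 / g ^ 2\<close>, so that summation
  over \<open>g\<close> costs only a constant.\<close>

lemma main_sum_approx:
  assumes m: "m \<ge> 1" and T: "T \<ge> 1"
  defines "R \<equiv> sqrt (real_of_int T)"
  shows "\<bar>(\<Sum>g=1..nat T. pi / 6 * real g ^ 3 * prim_sum (level m (int g)) (of_int T / (of_int m * real g)\<^sup>2))
     - pi ^ 4 / 96 / of_int m ^ 6 * of_int T ^ 3 * (level_density m * inv_powers 3)\<bar>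
     \<le> 1600 * inv_powers 3 * inv_powers 2 * R ^ 5"
proof -
  define M where "M = real_of_int m"
  have M: "M \<ge> 1" using m by (simp add: M_def)
  define t where "t = real_of_int T"
  have t: "t \<ge> 1" using T by (simp add: t_def)
  have R: "R \<ge> 1" "R * R = t" using t by (simp_all add: R_def t_def)
  define x where "x g = pi / 6 * real g ^ 3 * prim_sum (level m (int g)) (t / (M * real g)\<^sup>2)" for g
  define y where "y g = pi ^ 4 / 96 / M ^ 6 * t ^ 3 * (prim_density (level m (int g)) / real g ^ 3)" for g
  have x0: "x g = 0" if g: "g \<notin> {1..nat T}" for g
  proof (cases "g = 0")
    case False
    then have "nat T < g" using g by auto
    then have gT: "t < real g" using T unfolding t_def by linarith
    have "real g * 1 \<le> real g * real g" using False by (intro mult_left_mono) auto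
    also have "\<dots> = (1 * real g)\<^sup>2" by (simp add: power2_eq_square)
    also have "\<dots> \<le> (M * real g)\<^sup>2" using M by (intro power_mono mult_right_mono) auto
    finally have tg: "t < (M * real g)\<^sup>2" using gT by simp
    then have "0 < (M * real g)\<^sup>2" using t by linarith
    then have "t / (M * real g)\<^sup>2 < 1" using tg by (simp only: divide_less_eq_1_pos)
    then show ?thesis by (simp add: x_def prim_sum_eq_0 level_pos[OF m])
  qed (simp add: x_def)
  have "infsum x UNIV = infsum x {1..nat T}" by (rule infsum_cong_neutral) (use x0 in auto)
  then have sx: "infsum x UNIV = (\<Sum>g=1..nat T. x g)" by simp
  have xs: "x summable_on UNIV"
    using summable_on_cong_neutral[of UNIV "{1..nat T}" x x] x0 by auto
  have ys: "y summable_on UNIV" unfolding y_def by (intro summable_on_cmult_right infsum_level_density(2)[OF m])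
  have sy: "infsum y UNIV = pi ^ 4 / 96 / M ^ 6 * t ^ 3 * (level_density m * inv_powers 3)"
    unfolding y_def infsum_cmult_right' infsum_level_density(1)[OF m] ..
  have "\<bar>infsum x UNIV - infsum y UNIV\<bar> \<le> (1600 * inv_powers 3 * R ^ 5) * inv_powers 2"
  proof (rule infsum_diff_bound[OF xs ys])
    fix n :: nat
    show "\<bar>x n - y n\<bar> \<le> 1600 * inv_powers 3 * R ^ 5 / real n ^ 2"
    proof (cases "n = 0")
      case False
      define G where "G = real n"
      have G: "G > 0" using False by (simp add: G_def)
      define c where "c = M * G"
      have c: "c > 0" using M G by (simp add: c_def)
      define d where "d = level m (int n)"
      have ap: "\<bar>prim_sum d (t / c\<^sup>2) - pi ^ 3 / 16 * prim_density d * (t / c\<^sup>2) ^ 3\<bar> \<le> 1600 * inv_powers 3 * ((t / c\<^sup>2)\<^sup>2 * sqrt (t / c\<^sup>2))"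
        unfolding d_def by (rule prim_sum_approx[OF level_pos[OF m]]) (use t in auto)
      have "x n - y n = pi / 6 * G ^ 3 * (prim_sum d (t / c\<^sup>2) - pi ^ 3 / 16 * prim_density d * (t / c\<^sup>2) ^ 3)"
        unfolding x_def y_def G_def[symmetric] c_def[symmetric] d_def[symmetric] using M G
        by (simp add: c_def field_simps eval_nat_numeral)
      then have "\<bar>x n - y n\<bar> = pi / 6 * G ^ 3 * \<bar>prim_sum d (t / c\<^sup>2) - pi ^ 3 / 16 * prim_density d * (t / c\<^sup>2) ^ 3\<bar>"
        using G by (simp only: abs_mult) simp
      also have "\<dots> \<le> 1 * G ^ 3 * (1600 * inv_powers 3 * ((t / c\<^sup>2)\<^sup>2 * sqrt (t / c\<^sup>2)))"
        using ap G pi_less_4 by (intro mult_mono) auto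
      also have "(t / c\<^sup>2)\<^sup>2 * sqrt (t / c\<^sup>2) = (R / c) ^ 5"
      proof -
        have q: "t / c\<^sup>2 = (R / c)\<^sup>2" by (simp add: R(2)[symmetric] power2_eq_square)
        have s: "sqrt ((R / c)\<^sup>2) = R / c" using R c by simp
        have "(r\<^sup>2)\<^sup>2 * r = r ^ 5" for r :: real by (simp add: eval_nat_numeral)
        then show ?thesis by (simp only: q s)
      qed
      also have "1 * G ^ 3 * (1600 * inv_powers 3 * (R / c) ^ 5) = 1600 * inv_powers 3 * R ^ 5 / G ^ 2 / M ^ 5"
        using G M by (simp add: c_def field_simps eval_nat_numeral)
      also have "\<dots> \<le> 1600 * inv_powers 3 * R ^ 5 / G ^ 2 / 1"
        using M R inv_powers_nonneg[of 3] by (intro divide_left_mono) (auto simp: one_le_power)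
      finally show ?thesis by (simp add: G_def)
    qed (simp add: x_def y_def)
  qed simp
  then show ?thesis unfolding sx sy by (simp add: x_def M_def t_def mult_ac)
qed

lemma zeta_3_eq: "zeta 3 = inv_powers 3"
proof -
  have "(\<lambda>n. 1 / real n ^ 3) summable_on UNIV" by (rule summable_on_inverse_power) simp
  then have "((\<lambda>n. 1 / real n ^ 3) has_sum inv_powers 3) UNIV" unfolding inv_powers_def by (rule has_sum_infsum)
  then have "(\<lambda>n. 1 / real n ^ 3) sums inv_powers 3" by (rule has_sum_imp_sums)
  then have "(\<lambda>n. 1 / real (Suc n) ^ 3) sums inv_powers 3"
    using sums_Suc_iff[of "\<lambda>n. 1 / real n ^ 3"] by simp
  moreover have "real (Suc n) powr 3 = real (Suc n) ^ 3" for n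
    using powr_realpow[of "real (Suc n)" 3] by simp
  ultimately show ?thesis unfolding zeta_def by (simp add: sums_iff del: of_nat_Suc)
qed

lemma odd_euler_product_int:
  assumes "m \<ge> 1"
  shows "(\<Prod>p | prime p \<and> odd p \<and> p dvd m. (1 - (of_int p :: real) powi (-3)) / (1 - of_int p powi (-4))) = odd_euler_product (nat m)"
  unfolding odd_euler_product_def
proof (rule prod.reindex_bij_witness[where i = int and j = nat])
  fix p :: int assume p: "p \<in> {p. prime p \<and> odd p \<and> p dvd m}"
  then have p0: "p > 0" by (auto simp: prime_gt_0_int)
  show "int (nat p) = p" using p0 by simp
  show "nat p \<in> {p. prime p \<and> odd p \<and> p dvd nat m}"
  proof -
    obtain q where q: "p = int q" using p0 zero_le_imp_eq_int[of p] by auto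
    have "prime (int q)" "odd (int q)" "int q dvd m" using p q by blast+
    moreover have "int (nat m) = m" using assms by simp
    ultimately have "prime q" "odd q" "int q dvd int (nat m)" by (simp_all only: prime_nat_int_transfer even_of_nat simp_thms)
    then show ?thesis unfolding q by (simp only: nat_int mem_Collect_eq int_dvd_int_iff simp_thms)
  qed
  have r: "real (nat p) = of_int p" using p0 by simp
  have "(of_int p :: real) powi (-3) = 1 / of_int p ^ 3" "(of_int p :: real) powi (-4) = 1 / of_int p ^ 4"
    by (simp_all add: power_int_minus inverse_eq_divide)
  then show "euler_ratio (nat p) = (1 - (of_int p :: real) powi (-3)) / (1 - of_int p powi (-4))"
    unfolding euler_ratio_def r by (simp only:)
next
  fix p :: nat assume p: "p \<in> {p. prime p \<and> odd p \<and> p dvd nat m}"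
  show "nat (int p) = p" by simp
  have "int p dvd int (nat m)" using p by (simp only: int_dvd_int_iff mem_Collect_eq)
  moreover have "int (nat m) = m" using assms by simp
  ultimately have "int p dvd m" by simp
  then show "int p \<in> {p. prime p \<and> odd p \<and> p dvd m}" using p by simp
qed

lemma diff_cubes_bound:
  fixes a b B D :: real
  assumes "0 \<le> a" "0 \<le> b" "a \<le> B" "b \<le> B" "\<bar>a - b\<bar> \<le> D"
  shows "\<bar>a ^ 3 - b ^ 3\<bar> \<le> 3 * D * B\<^sup>2"
proof -
  have "a ^ 3 - b ^ 3 = (a - b) * (a * a + a * b + b * b)" by (simp add: power3_eq_cube algebra_simps)
  then have "\<bar>a ^ 3 - b ^ 3\<bar> = \<bar>a - b\<bar> * (a * a + a * b + b * b)" using assms by (simp add: abs_mult)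
  also have "\<dots> \<le> D * (B * B + B * B + B * B)" using assms by (intro mult_mono add_mono) auto
  finally show ?thesis by (simp add: power2_eq_square)
qed

theorem corollary1p2:
  fixes k :: int and \<epsilon> :: real
  assumes "k \<ge> 3" and "\<epsilon> > 0"
  shows "(\<lambda>x::real.
      (\<Sum>N | 0 < N \<and> real N \<le> x. (real (r4 k N))^2)
      - C_const k * zeta 3 / (of_int k - 2)^4
        * (\<Prod>p | prime p \<and> odd p \<and> p dvd k - 2.
             (1 - (of_int p :: real) powi (-3)) / (1 - of_int p powi (-4)))
        * x^3)
    \<in> O[at_top](\<lambda>x. x powr (11/4 + \<epsilon>))"
proof -
  define m where "m = k - 2"
  have m: "m \<ge> 1" and k: "k = m + 2" using assms(1) by (simp_all add: m_def)
  define M where "M = real_of_int m"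
  have M: "M \<ge> 1" using m by (simp add: M_def)
  \<comment> \<open>Chosen to serve twice: it bounds \<open>t\<close> by \<open>B * x\<close> for
    \<open>x \<ge> 1\<close>, and it bounds the distance of \<open>t\<close> from
    \<open>8 * M * x\<close>.\<close>
  define B where "B = 8 * M + 4 * (M - 2)\<^sup>2"
  have "0 \<le> 4 * (M - 2)\<^sup>2" by simp
  then have B: "B \<ge> 8" "8 * M \<le> B" "4 * (M - 2)\<^sup>2 \<le> B" using M unfolding B_def by linarith+
  define D where "D = level_density m"
  define c where "c = pi ^ 4 / 96 / M ^ 6 * (D * inv_powers 3)"
  define A where "A = C_const k * zeta 3 / (of_int k - 2) ^ 4 * (\<Prod>p | prime p \<and> odd p \<and> p dvd k - 2. (1 - (of_int p :: real) powi (-3)) / (1 - of_int p powi (-4)))"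
  \<comment> \<open>The main term is \<open>c * t ^ 3\<close> with \<open>t\<close> close to
    \<open>8 * M * x\<close>; the factor \<open>8 ^ 3 / 96 = 16 / 3\<close> is the one in
    \<open>level_density_eq\<close>.\<close>
  have Ac: "A = c * (8 * M) ^ 3"
  proof -
    have "A = C_const (m + 2) * inv_powers 3 / M ^ 4 * odd_euler_product (nat m)"
      unfolding A_def k zeta_3_eq using odd_euler_product_int[OF m] by (simp add: M_def)
    also have "\<dots> = C_const (m + 2) * odd_euler_product (nat m) * inv_powers 3 / M ^ 4" by simp
    also have "\<dots> = 16 / 3 * pi ^ 4 * M * D * inv_powers 3 / M ^ 4"
      unfolding level_density_eq[OF m, symmetric] D_def M_def ..
    also have "\<dots> = c * (8 * M) ^ 3" using M by (simp add: c_def field_simps eval_nat_numeral)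
    finally show ?thesis .
  qed
  define C where "C = (real (r4 k 0))\<^sup>2 + (6100000 + 1600 * inv_powers 3 * inv_powers 2) * B powr (11 / 4) + \<bar>c\<bar> * (3 * B * B\<^sup>2)"
  have bound: "\<bar>(\<Sum>N | 0 < N \<and> real N \<le> x. (real (r4 k N))\<^sup>2) - A * x ^ 3\<bar> \<le> C * x powr (11 / 4)" if x: "x \<ge> 1" for x
  proof -
    define n where "n = nat \<lfloor>x\<rfloor>"
    have n: "real n \<le> x" "x < real n + 1" "n \<ge> 1" using x unfolding n_def by (auto simp: le_nat_iff le_floor_iff)
    have set: "{N. 0 < N \<and> real N \<le> x} = {..n} - {0}"
    proof -
      have "real N \<le> x \<longleftrightarrow> N \<le> n" for N using n by linarith
      then show ?thesis by auto
    qed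
    \<comment> \<open>The shifted norm of the representations of \<open>n\<close>, so that a norm of
      at most \<open>T\<close> means a represented number of at most \<open>n\<close>.\<close>
    define T where "T = 8 * m * int n + 4 * (m - 2)\<^sup>2"
    define t where "t = real_of_int T"
    have tT: "t = 8 * M * real n + 4 * (M - 2)\<^sup>2" by (simp add: t_def T_def M_def)
    have T: "T \<ge> 1"
    proof -
      have "1 * 1 \<le> m * int n" using m n(3) by (intro mult_mono) auto
      moreover have "0 \<le> 4 * (m - 2)\<^sup>2" by simp
      ultimately show ?thesis unfolding T_def by linarith
    qed
    have t: "t \<ge> 1" using T by (simp add: t_def)
    have tB: "t \<le> B * x"
    proof -
      have "8 * M * real n \<le> 8 * M * x" using n M by (intro mult_left_mono) auto
      moreover have "4 * (M - 2)\<^sup>2 * 1 \<le> 4 * (M - 2)\<^sup>2 * x" using x by (intro mult_left_mono) auto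
      ultimately show ?thesis unfolding tT B_def by (simp add: distrib_right)
    qed
    define R where "R = sqrt (real_of_int T)"
    have R: "R \<ge> 1" using T by (simp add: R_def)
    \<comment> \<open>As \<open>R\<close> is the square root of \<open>t\<close>, the exponent
      \<open>11 / 2\<close> in \<open>R\<close> becomes \<open>11 / 4\<close> in
      \<open>t\<close>.\<close>
    have Rp: "R ^ 5 * sqrt R = t powr (11 / 4)"
    proof -
      have "R = t powr (1 / 2)" using t by (simp add: R_def t_def powr_half_sqrt)
      then have "R ^ 5 = t powr (5 / 2)" "sqrt R = t powr (1 / 4)"
        using t by (simp_all add: powr_power powr_half_sqrt[symmetric] powr_powr)
      then show ?thesis by (simp add: powr_add[symmetric])
    qed
    have "t powr (11 / 4) \<le> (B * x) powr (11 / 4)" using tB t by (intro powr_mono2) auto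
    also have "\<dots> = B powr (11 / 4) * x powr (11 / 4)" using B x by (simp add: powr_mult)
    finally have RB: "R ^ 5 * sqrt R \<le> B powr (11 / 4) * x powr (11 / 4)" using Rp by simp
    have R5: "R ^ 5 \<le> R ^ 5 * sqrt R" using R by (simp add: mult_le_cancel_left1)
    define W where "W = real (card (norm_pairs m T))"
    have "(\<Sum>N\<le>n. (real (r4 k N))\<^sup>2) = W"
    proof -
      have "real (\<Sum>N\<le>n. (r4 (m + 2) N)\<^sup>2) = W" unfolding W_def T_def sum_r4_squares[OF m] ..
      then show ?thesis by (simp add: k)
    qed
    moreover have "(\<Sum>N\<le>n. (real (r4 k N))\<^sup>2) = (real (r4 k 0))\<^sup>2 + (\<Sum>N\<in>{..n} - {0}. (real (r4 k N))\<^sup>2)"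
      by (rule sum.remove) auto
    \<comment> \<open>The pairs also count the number 0, whose contribution is a constant.\<close>
    ultimately have SW: "(\<Sum>N | 0 < N \<and> real N \<le> x. (real (r4 k N))\<^sup>2) = W - (real (r4 k 0))\<^sup>2" unfolding set by simp
    define Y where "Y = (\<Sum>g=1..nat T. pi / 6 * real g ^ 3 * prim_sum (level m (int g)) (of_int T / (of_int m * real g)\<^sup>2))"
    have e1: "\<bar>W - Y\<bar> \<le> 6100000 * (R ^ 5 * sqrt R)"
      unfolding W_def Y_def R_def fmain_sum_eq[OF m T, symmetric] by (rule pair_count_error[OF m T])
    have e2: "\<bar>Y - c * t ^ 3\<bar> \<le> 1600 * inv_powers 3 * inv_powers 2 * R ^ 5"
    proof -
      have "c * t ^ 3 = pi ^ 4 / 96 / of_int m ^ 6 * of_int T ^ 3 * (level_density m * inv_powers 3)"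
        by (simp add: c_def D_def M_def t_def)
      then show ?thesis unfolding Y_def R_def using main_sum_approx[OF m T] by simp
    qed
    have e3: "\<bar>c * t ^ 3 - A * x ^ 3\<bar> \<le> \<bar>c\<bar> * (3 * B * (B * x)\<^sup>2)"
    \<comment> \<open>Replacing \<open>t\<close> by \<open>8 * M * x\<close> moves the argument by
      at most \<open>B\<close>, hence its cube by a multiple of \<open>x ^ 2\<close>.\<close>
    proof -
      have "c * t ^ 3 - A * x ^ 3 = c * (t ^ 3 - (8 * M * x) ^ 3)" unfolding Ac by (simp add: power_mult_distrib algebra_simps)
      then have "\<bar>c * t ^ 3 - A * x ^ 3\<bar> = \<bar>c\<bar> * \<bar>t ^ 3 - (8 * M * x) ^ 3\<bar>" by (simp add: abs_mult)
      also have "\<bar>t ^ 3 - (8 * M * x) ^ 3\<bar> \<le> 3 * B * (B * x)\<^sup>2"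
      proof (rule diff_cubes_bound)
        show "8 * M * x \<le> B * x" using B x by (intro mult_right_mono) auto
        have "8 * M * real n \<le> 8 * M * x" "8 * M * x \<le> 8 * M * (real n + 1)" using n M by (intro mult_left_mono; simp)+
        then have "8 * M * x - 8 * M * real n \<le> 8 * M" "0 \<le> 8 * M * x - 8 * M * real n" by (simp_all add: distrib_left)
        moreover have "0 \<le> 4 * (M - 2)\<^sup>2" by simp
        ultimately show "\<bar>t - 8 * M * x\<bar> \<le> B" unfolding tT using B(2,3) by linarith
      qed (use t tB M x in auto)
      finally show ?thesis by (simp add: mult_left_mono)
    qed
    have x2: "x\<^sup>2 \<le> x powr (11 / 4)"
    proof -
      have "x\<^sup>2 = x powr 2" using x by simp
      also have "\<dots> \<le> x powr (11 / 4)" using x by (intro powr_mono) auto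
      finally show ?thesis .
    qed
    have x1: "1 \<le> x powr (11 / 4)" using x by (intro ge_one_powr_ge_zero) auto
    have p1: "(real (r4 k 0))\<^sup>2 * 1 \<le> (real (r4 k 0))\<^sup>2 * x powr (11 / 4)" using x1 by (intro mult_left_mono) auto
    have ip: "0 \<le> 1600 * inv_powers 3 * inv_powers 2" using inv_powers_nonneg by simp
    have p2: "6100000 * (R ^ 5 * sqrt R) + 1600 * inv_powers 3 * inv_powers 2 * R ^ 5 \<le> (6100000 + 1600 * inv_powers 3 * inv_powers 2) * (B powr (11 / 4) * x powr (11 / 4))"
    proof -
      have "1600 * inv_powers 3 * inv_powers 2 * R ^ 5 \<le> 1600 * inv_powers 3 * inv_powers 2 * (R ^ 5 * sqrt R)"
        using R5 ip by (intro mult_left_mono)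
      then have "6100000 * (R ^ 5 * sqrt R) + 1600 * inv_powers 3 * inv_powers 2 * R ^ 5 \<le> (6100000 + 1600 * inv_powers 3 * inv_powers 2) * (R ^ 5 * sqrt R)"
        by (simp add: distrib_right)
      also have "\<dots> \<le> (6100000 + 1600 * inv_powers 3 * inv_powers 2) * (B powr (11 / 4) * x powr (11 / 4))"
        using RB ip by (intro mult_left_mono) auto
      finally show ?thesis .
    qed
    have p3: "\<bar>c\<bar> * (3 * B * (B * x)\<^sup>2) \<le> \<bar>c\<bar> * (3 * B * B\<^sup>2) * x powr (11 / 4)"
    proof -
      have "\<bar>c\<bar> * (3 * B * (B * x)\<^sup>2) = \<bar>c\<bar> * (3 * B * B\<^sup>2) * x\<^sup>2" by (simp add: power_mult_distrib)
      also have "\<dots> \<le> \<bar>c\<bar> * (3 * B * B\<^sup>2) * x powr (11 / 4)" using x2 B by (intro mult_left_mono) auto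
      finally show ?thesis .
    qed
    have "0 \<le> (real (r4 k 0))\<^sup>2" by simp
    then have "\<bar>W - (real (r4 k 0))\<^sup>2 - A * x ^ 3\<bar> \<le> (real (r4 k 0))\<^sup>2 * 1 + (6100000 * (R ^ 5 * sqrt R) + 1600 * inv_powers 3 * inv_powers 2 * R ^ 5) + \<bar>c\<bar> * (3 * B * (B * x)\<^sup>2)"
      using e1 e2 e3 by linarith
    also have "\<dots> \<le> C * x powr (11 / 4)" unfolding C_def distrib_right using p1 p2 p3 by (simp only: distrib_right mult.assoc)
    finally show ?thesis unfolding SW .
  qed
  show ?thesis
  proof (rule bigoI[where c = C])
    show "\<forall>\<^sub>F x in at_top. norm ((\<Sum>N | 0 < N \<and> real N \<le> x. (real (r4 k N))\<^sup>2)
      - C_const k * zeta 3 / (of_int k - 2) ^ 4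
        * (\<Prod>p | prime p \<and> odd p \<and> p dvd k - 2. (1 - (of_int p :: real) powi (-3)) / (1 - of_int p powi (-4))) * x ^ 3)
      \<le> C * norm (x powr (11 / 4 + \<epsilon>))"
      using eventually_ge_at_top[of 1]
    proof eventually_elim
      case (elim x)
      have "C \<ge> 0" unfolding C_def using inv_powers_nonneg B by (intro add_nonneg_nonneg mult_nonneg_nonneg) auto
      moreover have "x powr (11 / 4) \<le> x powr (11 / 4 + \<epsilon>)" using elim assms(2) by (intro powr_mono) auto
      ultimately have "C * x powr (11 / 4) \<le> C * x powr (11 / 4 + \<epsilon>)" by (rule mult_left_mono[rotated])
      then show ?case using bound[OF elim] by (simp only: A_def[symmetric] real_norm_def abs_of_nonneg[OF powr_ge_zero])
    qed
  qed
qed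

end
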